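(* The topological realization of the projective Fraïssé limit of the family $\mathcal{T}_{\mathcal{CE}}$ is homeomorphic to the Mohler-Nikiel universal dendroid.
   Context: Graphs are pairs $(V,E)$ with $E\subseteq V^2$ reflexive and symmetric; a topological graph has compact zero-dimensional second-countable vertex set and closed edge set. Trees: finite graphs with unique simple paths between distinct vertices; rooted trees have a root $r$ and order $x\le y$ iff the path from $r$ to $y$ contains $x$. Epimorphisms between rooted trees: vertex maps sending edges to edges, surjective on vertices and edges, root to root, order-preserving. Connected: not a union of two nonempty disjoint closed sets with no edges between. Confluent: for each connected $Q$ of the target every component $K$ of $f^{-1}(Q)$ has $f(K)=Q$; light: distinct vertices with the same image are never adjacent. Splitting edge map: replace an edge $\langle a,b\rangle$ ($a<b$) by $\langle a,x\rangle,\langle x,b\rangle$ with $x$ new, identity elsewhere, $x\mapsto a$ or $b$. Simple-confluent epimorphisms are finite compositions of splitting edge maps and light confluent epimorphisms. $\mathcal T_{\mathcal{CE}}$ is the projective Fraïssé family of rooted trees with at least two vertices and simple-confluent epimorphisms. Its projective Fraïssé limit is the unique rooted topological graph $\mathbb T$ that is an inverse limit $\varprojlim\{F_n,\alpha_n\}$ of members of the family with bonding maps in the family (edges coordinatewise) such that (i) every member is an image of $\mathbb T$ under an admissible epimorphism and (ii) for admissible $f\colon\mathbb T\to A$ and $g\colon B\to A$ in the family there is admissible $h\colon\mathbb T\to B$ with $f=g\circ h$, admissible meaning $h'\circ\alpha^\infty_m$ with $h'$ in the family. Its topological realization is the quotient $V(\mathbb T)/E(\mathbb T)$ (the edge relation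 being an equivalence relation). Mohler-Nikiel dendroid: let $d_1,d_2,\dots$ be a dense sequence in $[0,1)$ containing $0$ in which every value occurs infinitely often. Let $Y_0=[0,1]$; given $Y_n$ and maps $g_k$, let $Y_{n+1}$ be the disjoint union $Y_n\times\{0\}\cup Y_n\times\{1\}$ with $(y,0)$ and $(y,1)$ identified whenever $g^n_0(y)\le d_{n+1}$ (where $g^n_0=g_0\circ\dots\circ g_{n-1}\colon Y_n\to Y_0$, $g^0_0=\mathrm{id}$), and $g_n\colon Y_{n+1}\to Y_n$, $(y,j)\mapsto y$. The inverse limit $\varprojlim\{Y_n,g_n\}$ is the Mohler-Nikiel universal (smooth) dendroid; up to homeomorphism it does not depend on the choice of the sequence. *)

theory Defs
  imports "HOL-Analysis.Analysis"
begin

text \<open>Quotient of the space X by the relation R (an equivalence relation on topspace X in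
  all uses below): points are the classes, a set of classes is open iff its union is open.\<close>

definition quotient_topology :: "'a topology \<Rightarrow> ('a \<times> 'a) set \<Rightarrow> 'a set topology" where
  "quotient_topology X R =
     topology (\<lambda>U. U \<subseteq> topspace X // R \<and> openin X (\<Union>U))"

record rtree =
  verts :: "nat set"
  edges :: "(nat \<times> nat) set"
  root  :: nat

definition is_path :: "rtree \<Rightarrow> nat list \<Rightarrow> nat \<Rightarrow> nat \<Rightarrow> bool" where
  "is_path T p u v \<longleftrightarrow> p \<noteq> [] \<and> hd p = u \<and> last p = v \<and> distinct p \<and> set p \<subseteq> verts T \<and>
     (\<forall>i. Suc i < length p \<longrightarrow> (p ! i, p ! Suc i) \<in> edges T)"

definition is_rtree :: "rtree \<Rightarrow> bool" where
  "is_rtree T \<longleftrightarrow> finite (verts T) \<and> edges T \<subseteq> verts T \<times> verts T \<and>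
     (\<forall>x\<in>verts T. (x, x) \<in> edges T) \<and> (\<forall>x y. (x, y) \<in> edges T \<longrightarrow> (y, x) \<in> edges T) \<and>
     (\<forall>u\<in>verts T. \<forall>v\<in>verts T. u \<noteq> v \<longrightarrow> (\<exists>!p. is_path T p u v)) \<and>
     root T \<in> verts T"

definition tree_le :: "rtree \<Rightarrow> nat \<Rightarrow> nat \<Rightarrow> bool" where
  "tree_le T x y \<longleftrightarrow> x \<in> verts T \<and> y \<in> verts T \<and>
     (\<exists>p. is_path T p (root T) y \<and> x \<in> set p)"

definition tree_less :: "rtree \<Rightarrow> nat \<Rightarrow> nat \<Rightarrow> bool" where
  "tree_less T x y \<longleftrightarrow> tree_le T x y \<and> x \<noteq> y"

text \<open>Epimorphisms f : A \<rightarrow> B between rooted trees (only the values on verts A matter).\<close>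
definition epimorphism :: "rtree \<Rightarrow> rtree \<Rightarrow> (nat \<Rightarrow> nat) \<Rightarrow> bool" where
  "epimorphism A B f \<longleftrightarrow> is_rtree A \<and> is_rtree B \<and>
     f ` verts A = verts B \<and>
     (\<lambda>(x, y). (f x, f y)) ` edges A = edges B \<and>
     f (root A) = root B \<and>
     (\<forall>x y. tree_le A x y \<longrightarrow> tree_le B (f x) (f y))"

section \<open>Connectedness, confluence, lightness (finite graphs: every set is closed)\<close>

definition graph_connected :: "rtree \<Rightarrow> nat set \<Rightarrow> bool" where
  "graph_connected G Q \<longleftrightarrow> Q \<subseteq> verts G \<and>
     \<not> (\<exists>A B. A \<noteq> {} \<and> B \<noteq> {} \<and> A \<inter> B = {} \<and> A \<union> B = Q \<and>
            (\<forall>a\<in>A. \<forall>b\<in>B. (a, b) \<notin> edges G))"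

definition graph_component :: "rtree \<Rightarrow> nat set \<Rightarrow> nat set \<Rightarrow> bool" where
  "graph_component G S K \<longleftrightarrow> K \<subseteq> S \<and> K \<noteq> {} \<and> graph_connected G K \<and>
     (\<forall>K'. K \<subseteq> K' \<and> K' \<subseteq> S \<and> graph_connected G K' \<longrightarrow> K' = K)"

definition confluent :: "rtree \<Rightarrow> rtree \<Rightarrow> (nat \<Rightarrow> nat) \<Rightarrow> bool" where
  "confluent A B f \<longleftrightarrow>
     (\<forall>Q. graph_connected B Q \<longrightarrow>
        (\<forall>K. graph_component A {x \<in> verts A. f x \<in> Q} K \<longrightarrow> f ` K = Q))"

definition light :: "rtree \<Rightarrow> (nat \<Rightarrow> nat) \<Rightarrow> bool" where
  "light A f \<longleftrightarrow> (\<forall>x\<in>verts A. \<forall>y\<in>verts A. x \<noteq> y \<and> f x = f y \<longrightarrow> (x, y) \<notin> edges A)"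

definition splitting_edge_map :: "rtree \<Rightarrow> rtree \<Rightarrow> (nat \<Rightarrow> nat) \<Rightarrow> bool" where
  "splitting_edge_map B A f \<longleftrightarrow> is_rtree A \<and>
     (\<exists>a b x. (a, b) \<in> edges A \<and> tree_less A a b \<and> x \<notin> verts A \<and>
        verts B = insert x (verts A) \<and>
        edges B = (edges A - {(a, b), (b, a)}) \<union> {(a, x), (x, a), (x, b), (b, x), (x, x)} \<and>
        root B = root A \<and>
        (\<forall>v\<in>verts A. f v = v) \<and> (f x = a \<or> f x = b))"

inductive simple_confluent :: "rtree \<Rightarrow> rtree \<Rightarrow> (nat \<Rightarrow> nat) \<Rightarrow> bool" where
  light_confluent: "epimorphism A B f \<Longrightarrow> confluent A B f \<Longrightarrow> light A f \<Longrightarrow>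
     simple_confluent A B f"
| splitting: "splitting_edge_map A B f \<Longrightarrow> simple_confluent A B f"
| comp: "simple_confluent A B f \<Longrightarrow> simple_confluent B C g \<Longrightarrow>
     (\<forall>v\<in>verts A. h v = g (f v)) \<Longrightarrow> simple_confluent A C h"

definition in_TCE :: "rtree \<Rightarrow> bool" where
  "in_TCE T \<longleftrightarrow> is_rtree T \<and> card (verts T) \<ge> 2"

definition TCE_map :: "rtree \<Rightarrow> rtree \<Rightarrow> (nat \<Rightarrow> nat) \<Rightarrow> bool" where
  "TCE_map A B f \<longleftrightarrow> in_TCE A \<and> in_TCE B \<and> simple_confluent A B f"

definition invlim_verts :: "(nat \<Rightarrow> rtree) \<Rightarrow> (nat \<Rightarrow> nat \<Rightarrow> nat) \<Rightarrow> (nat \<Rightarrow> nat) set" where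
  "invlim_verts F \<alpha> = {x. \<forall>n. x n \<in> verts (F n) \<and> \<alpha> n (x (Suc n)) = x n}"

definition invlim_edges :: "(nat \<Rightarrow> rtree) \<Rightarrow> (nat \<Rightarrow> nat \<Rightarrow> nat) \<Rightarrow> ((nat \<Rightarrow> nat) \<times> (nat \<Rightarrow> nat)) set" where
  "invlim_edges F \<alpha> = {(x, y). x \<in> invlim_verts F \<alpha> \<and> y \<in> invlim_verts F \<alpha> \<and>
                               (\<forall>n. (x n, y n) \<in> edges (F n))}"

definition invlim_root :: "(nat \<Rightarrow> rtree) \<Rightarrow> nat \<Rightarrow> nat" where
  "invlim_root F = (\<lambda>n. root (F n))"

definition invlim_topology :: "(nat \<Rightarrow> rtree) \<Rightarrow> (nat \<Rightarrow> nat \<Rightarrow> nat) \<Rightarrow> (nat \<Rightarrow> nat) topology" where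
  "invlim_topology F \<alpha> =
     subtopology (product_topology (\<lambda>n. discrete_topology (verts (F n))) UNIV) (invlim_verts F \<alpha>)"

definition admissible :: "(nat \<Rightarrow> rtree) \<Rightarrow> (nat \<Rightarrow> nat \<Rightarrow> nat) \<Rightarrow> rtree \<Rightarrow> ((nat \<Rightarrow> nat) \<Rightarrow> nat) \<Rightarrow> bool" where
  "admissible F \<alpha> B h \<longleftrightarrow>
     (\<exists>m h'. TCE_map (F m) B h' \<and> (\<forall>x\<in>invlim_verts F \<alpha>. h x = h' (x m)))"

definition is_TCE_Fraisse_limit :: "(nat \<Rightarrow> rtree) \<Rightarrow> (nat \<Rightarrow> nat \<Rightarrow> nat) \<Rightarrow> bool" where
  "is_TCE_Fraisse_limit F \<alpha> \<longleftrightarrow>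
     (\<forall>n. in_TCE (F n)) \<and> (\<forall>n. TCE_map (F (Suc n)) (F n) (\<alpha> n)) \<and>
     (\<forall>A. in_TCE A \<longrightarrow> (\<exists>h. admissible F \<alpha> A h)) \<and>
     (\<forall>A B f g. in_TCE A \<and> in_TCE B \<and> admissible F \<alpha> A f \<and> TCE_map B A g \<longrightarrow>
        (\<exists>h. admissible F \<alpha> B h \<and> (\<forall>x\<in>invlim_verts F \<alpha>. f x = g (h x))))"

definition TCE_realization :: "(nat \<Rightarrow> rtree) \<Rightarrow> (nat \<Rightarrow> nat \<Rightarrow> nat) \<Rightarrow> (nat \<Rightarrow> nat) set topology" where
  "TCE_realization F \<alpha> = quotient_topology (invlim_topology F \<alpha>) (invlim_edges F \<alpha>)"

text \<open>Admissible sequences d_1, d_2, ... (d 0 is unused): dense in [0,1), contain 0, and every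
  value occurs infinitely often.\<close>
definition MN_sequence :: "(nat \<Rightarrow> real) \<Rightarrow> bool" where
  "MN_sequence d \<longleftrightarrow> (\<forall>n\<ge>1. d n \<in> {0..<1}) \<and>
     (\<forall>x\<in>{0..<1}. \<forall>e>0. \<exists>n\<ge>1. \<bar>d n - x\<bar> < e) \<and>
     (\<exists>n\<ge>1. d n = 0) \<and>
     (\<forall>n\<ge>1. infinite {m. m \<ge> 1 \<and> d m = d n})"

text \<open>Y_n is realized as [0,1] \<times> {0,1}^n modulo the relation obtained by unfolding the
  recursive gluing: Y_(n+1) = (Y_n \<times> {0,1})/((y,0)~(y,1) iff g^n_0(y) \<le> d_(n+1)).
  A point (t, s) has g^n_0-image t; the relation is defined recursively along this construction.\<close>
fun MN_rel :: "(nat \<Rightarrow> real) \<Rightarrow> nat \<Rightarrow> ((real \<times> bool list) \<times> (real \<times> bool list)) set" where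
  "MN_rel d 0 = {((t, []), (t, [])) | t. t \<in> {0..1}}"
| "MN_rel d (Suc n) = {((t, s @ [i]), (t', s' @ [j])) | t s i t' s' j.
       ((t, s), (t', s')) \<in> MN_rel d n \<and> (i = j \<or> t \<le> d (Suc n))}"

definition MN_pre :: "nat \<Rightarrow> (real \<times> bool list) topology" where
  "MN_pre n = subtopology (prod_topology euclideanreal (discrete_topology UNIV))
                 {(t, s). t \<in> {0..1} \<and> length s = n}"

definition MN_Y :: "(nat \<Rightarrow> real) \<Rightarrow> nat \<Rightarrow> (real \<times> bool list) set topology" where
  "MN_Y d n = quotient_topology (MN_pre n) (MN_rel d n)"

definition MN_g :: "nat \<Rightarrow> (real \<times> bool list) set \<Rightarrow> (real \<times> bool list) set" where
  "MN_g n C = (\<lambda>(t, s). (t, take n s)) ` C"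

definition MN_dendroid :: "(nat \<Rightarrow> real) \<Rightarrow> (nat \<Rightarrow> (real \<times> bool list) set) topology" where
  "MN_dendroid d = subtopology (product_topology (MN_Y d) UNIV)
     {y. \<forall>n. y n \<in> topspace (MN_Y d n) \<and> MN_g n (y (Suc n)) = y n}"

end

theory Submission
  imports Defs "HOL-Library.Nat_Bijection" "HOL-Library.Sublist"
begin

text \<open>
  The points of the Mohler-Nikiel dendroid are the pairs \<open>(t, S)\<close> of a height \<open>t\<close> and a set \<open>S\<close>
  of indices, where only the indices \<open>j\<close> with \<open>d j < t\<close> matter. Finite approximations of it are the
  grid trees, which record heights up to a finite grid and finitely many of the indices. The grid
  points avoid the values of \<open>d\<close>, so that branching always happens strictly between two grid heights.

  A tree is \<open>nice\<close> if its vertices are marked with heights in such a way that it becomes a quotient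
  of the dendroid. Niceness lifts along the generators of the simple-confluent maps: density of the
  values of \<open>d\<close> makes room for the new vertex of a splitting edge map, and the infinite repetition of
  every value supplies fresh indices that encode the choices of lifts along a light confluent map.
  Conversely, a nice tree is a simple-confluent image of every sufficiently fine grid tree, by a
  light confluent map onto a subdivision of the tree followed by splitting edge maps.

  The extension property of the Fraisse limit therefore yields a sequence of trees in which
  finer and finer grid trees alternate with members of a cofinal subsequence of \<open>F\<close>. A point of the
  limit then determines nested grid cells, hence a height and a set of indices; this is a continuous
  surjection onto the dendroid whose kernel is the edge relation. No amalgamation is needed.
\<close>

section \<open>Rooted trees as finite orders\<close>

text \<open>All trees are compared through one fixed set of parameters. Each nice tree assigns a
  vertex to every pair \<open>(t, S)\<close>, and lifting and projecting are required to commute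
  with these assignments at every pair. This is what lets the construction continue: the extension
  property returns some \<open>F m\<close> with a map to a grid tree, and there is no control over
  either. Lifting niceness along that map marks \<open>F m\<close> by the same pairs, so the next
  grid tree can be mapped onto it compatibly. One pair then traces a point of the limit, which gives
  surjectivity onto the dendroid.

  The root is the rigid place. Neither kind of generator gives the root of the image more children
  than the root of the source has, and a splitting edge map never removes the root. So a segment
  between the root and a first branching point cannot be shrunk to the root, and the children of the
  root have to part at height \<open>0\<close> itself. Hence \<open>M\<close> and \<open>L\<close>
  both vanish there, and the value \<open>0\<close> of \<open>d\<close>, repeated infinitely often,
  supplies the branches.\<close>

definition covers :: "'a set \<Rightarrow> ('a \<Rightarrow> 'a \<Rightarrow> bool) \<Rightarrow> 'a \<Rightarrow> 'a \<Rightarrow> bool" where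
  "covers V le x y \<longleftrightarrow> x \<in> V \<and> y \<in> V \<and> x \<noteq> y \<and> le x y \<and>
     (\<forall>z\<in>V. le x z \<longrightarrow> le z y \<longrightarrow> z = x \<or> z = y)"

locale tree_order =
  fixes V :: "'a set" and le :: "'a \<Rightarrow> 'a \<Rightarrow> bool" and r :: 'a
  assumes finite_V: "finite V"
    and root_in: "r \<in> V"
    and le_refl: "x \<in> V \<Longrightarrow> le x x"
    and le_antisym: "\<lbrakk>x \<in> V; y \<in> V; le x y; le y x\<rbrakk> \<Longrightarrow> x = y"
    and le_trans: "\<lbrakk>x \<in> V; y \<in> V; z \<in> V; le x y; le y z\<rbrakk> \<Longrightarrow> le x z"
    and root_le: "x \<in> V \<Longrightarrow> le r x"
    and down_chain: "\<lbrakk>x \<in> V; y \<in> V; z \<in> V; le x z; le y z\<rbrakk> \<Longrightarrow> le x y \<or> le y x"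
begin

abbreviation cov :: "'a \<Rightarrow> 'a \<Rightarrow> bool" where "cov \<equiv> covers V le"

lemma covD:
  assumes "cov x y"
  shows "x \<in> V" "y \<in> V" "x \<noteq> y" "le x y"
  using assms by (auto simp: covers_def)

lemma cov_between: "\<lbrakk>cov x y; z \<in> V; le x z; le z y\<rbrakk> \<Longrightarrow> z = x \<or> z = y"
  by (auto simp: covers_def)

abbreviation down :: "'a \<Rightarrow> 'a set" where "down y \<equiv> {x \<in> V. le x y}"

lemma finite_down: "finite (down y)"
  using finite_V by auto

lemma down_psubset: "\<lbrakk>x \<in> V; y \<in> V; le x y; x \<noteq> y\<rbrakk> \<Longrightarrow> down x \<subset> down y"
  using le_trans le_antisym le_refl by blast

lemma card_down_less: "\<lbrakk>x \<in> V; y \<in> V; le x y; x \<noteq> y\<rbrakk> \<Longrightarrow> card (down x) < card (down y)"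
  by (intro psubset_card_mono finite_down down_psubset)

text \<open>The vertices below \<open>y\<close> form a chain along which
  \<open>card (down z)\<close> grows strictly, so one with the largest down-set is the greatest
  vertex strictly below \<open>y\<close>. It is the parent of \<open>y\<close> and lies above every
  such \<open>x\<close>.\<close>

lemma ex_parent_above:
  assumes "x \<in> V" "y \<in> V" "le x y" "x \<noteq> y"
  shows "\<exists>p. cov p y \<and> le x p"
proof -
  let ?A = "{z \<in> V. le z y \<and> z \<noteq> y}"
  have fin: "finite ?A" and ne: "?A \<noteq> {}"
    using finite_V assms by auto
  obtain p where p: "p \<in> ?A" "\<And>z. z \<in> ?A \<Longrightarrow> card (down z) \<le> card (down p)"
    using finite_has_maximal[of "(\<lambda>z. card (down z)) ` ?A"] fin ne
    by (smt (verit) Max_ge Max_in finite_imageI imageE image_eqI image_is_empty)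
  have max: "le z p" if "z \<in> ?A" for z
  proof (rule ccontr)
    assume "\<not> le z p"
    with that p(1) assms have "le p z" using down_chain by blast
    with \<open>\<not> le z p\<close> that p(1) le_refl have "p \<noteq> z" by auto
    with card_down_less[of p z] that p \<open>le p z\<close> show False
      by (metis (no_types, lifting) leD mem_Collect_eq)
  qed
  have "cov p y"
    unfolding covers_def using p(1) assms(2) max le_antisym by blast
  moreover have "le x p" using max assms by blast
  ultimately show ?thesis by blast
qed

lemma parent_unique: "\<lbrakk>cov x y; cov z y\<rbrakk> \<Longrightarrow> x = z"
  by (metis covD cov_between down_chain)

lemma le_parent: "\<lbrakk>cov p y; x \<in> V; le x y; x \<noteq> y\<rbrakk> \<Longrightarrow> le x p"
  using ex_parent_above parent_unique covD by metis

lemma not_cov_root: "\<not> cov x r"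
  using covD root_le le_antisym root_in by metis

lemma ex_parent: "\<lbrakk>y \<in> V; y \<noteq> r\<rbrakk> \<Longrightarrow> \<exists>p. cov p y"
  using ex_parent_above[of r y] root_in root_le by auto

lemma ex_child_below:
  assumes "x \<in> V" "y \<in> V" "le x y" "x \<noteq> y"
  shows "\<exists>c. cov x c \<and> le c y"
  using assms
proof (induction "card (down y)" arbitrary: y rule: less_induct)
  case less
  obtain p where p: "cov p y" "le x p" using ex_parent_above less.prems by blast
  show ?case
  proof (cases "x = p")
    case True then show ?thesis using p less.prems le_refl by blast
  next
    case False
    have "card (down p) < card (down y)" using p covD card_down_less by metis
    then obtain c where "cov x c" "le c p" using less.hyps[of p] p less.prems(1) covD(1) False by blast
    then show ?thesis using p le_trans covD less.prems by metis
  qed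
qed

lemma tree_induct [consumes 1, case_names root child]:
  assumes "y \<in> V" "P r" "\<And>x y. cov x y \<Longrightarrow> P x \<Longrightarrow> P y"
  shows "P y"
  using assms(1)
proof (induction "card (down y)" arbitrary: y rule: less_induct)
  case less
  show ?case
  proof (cases "y = r")
    case False
    then obtain p where "cov p y" using ex_parent less.prems by blast
    note p = this covD[OF this]
    have "P p" using less.hyps[OF card_down_less] p by blast
    then show ?thesis using assms(3) p(1) by blast
  qed (use assms in auto)
qed

end

section \<open>Paths, and attaching a leaf\<close>

lemma is_path_iff_successively:
  "is_path T p u v \<longleftrightarrow> p \<noteq> [] \<and> hd p = u \<and> last p = v \<and> distinct p \<and> set p \<subseteq> verts T \<and>
     successively (\<lambda>x y. (x, y) \<in> edges T) p"
  unfolding is_path_def successively_conv_nth by blast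

lemma is_path_self: "is_path T p u u \<longleftrightarrow> p = [u] \<and> u \<in> verts T"
proof
  assume "is_path T p u u"
  then show "p = [u] \<and> u \<in> verts T"
    unfolding is_path_def by (cases p) (auto split: if_splits)
qed (auto simp: is_path_def)

lemma is_path_snoc:
  "is_path T (p @ [w]) u w \<longleftrightarrow>
     (p = [] \<and> u = w \<and> w \<in> verts T) \<or>
     (p \<noteq> [] \<and> is_path T p u (last p) \<and> (last p, w) \<in> edges T \<and> w \<notin> set p \<and> w \<in> verts T)"
  unfolding is_path_iff_successively by (auto simp: successively_append_iff hd_append)

lemma is_path_rev:
  assumes "\<And>x y. (x, y) \<in> edges T \<Longrightarrow> (y, x) \<in> edges T" "is_path T p u v"
  shows "is_path T (rev p) v u"
proof -
  have "successively (\<lambda>x y. (y, x) \<in> edges T) p"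
    using assms(2) unfolding is_path_iff_successively
    by (auto intro: successively_mono assms(1))
  then show ?thesis
    using assms(2) unfolding is_path_iff_successively
    by (simp add: hd_rev last_rev)
qed

lemma is_rtree_single: "is_rtree \<lparr>verts = {r}, edges = {(r, r)}, root = r\<rparr>"
  unfolding is_rtree_def by auto

text \<open>A path visits no vertex twice, and \<open>a\<close> is the only neighbour of
  \<open>w\<close> besides \<open>w\<close> itself. So \<open>w\<close> is never interior to a path:
  paths between old vertices are the old ones, and a path to \<open>w\<close> is an old path to
  \<open>a\<close> prolonged by \<open>w\<close>.\<close>

lemma is_rtree_add_leaf:
  assumes T: "is_rtree T" and a: "a \<in> verts T" and w: "w \<notin> verts T"
    and V': "verts T' = insert w (verts T)"
    and E': "edges T' = edges T \<union> {(a, w), (w, a), (w, w)}"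
    and r': "root T' = root T"
  shows "is_rtree T'"
proof -
  have fin: "finite (verts T)" and EV: "edges T \<subseteq> verts T \<times> verts T"
    and rf: "\<And>x. x \<in> verts T \<Longrightarrow> (x, x) \<in> edges T"
    and sy: "\<And>x y. (x, y) \<in> edges T \<Longrightarrow> (y, x) \<in> edges T"
    and up: "\<And>u v. u \<in> verts T \<Longrightarrow> v \<in> verts T \<Longrightarrow> u \<noteq> v \<Longrightarrow> \<exists>!p. is_path T p u v"
    and rt: "root T \<in> verts T"
    using T unfolding is_rtree_def by blast+
  have sy': "\<And>x y. (x, y) \<in> edges T' \<Longrightarrow> (y, x) \<in> edges T'"
    using sy unfolding E' by auto
  have up_ex: "\<exists>p. is_path T p u v" if "u \<in> verts T" "v \<in> verts T" for u v
    using up[OF that] is_path_self that by blast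
  have up_eq: "p = q" if "is_path T p u v" "is_path T q u v" for p q u v
  proof -
    have "u \<in> verts T" "v \<in> verts T" using that(1) unfolding is_path_def
      using hd_in_set last_in_set by blast+
    then show ?thesis using up that is_path_self by metis
  qed
  have extend: "is_path T' p u v" if "is_path T p u v" for p u v
    using that unfolding is_path_def V' E' by auto
  have restrict: "is_path T p u v" if "is_path T' p u v" "w \<notin> set p" for p u v
  proof -
    have "(p ! i, p ! Suc i) \<in> edges T" if i: "Suc i < length p" for i
    proof -
      have "(p ! i, p ! Suc i) \<in> edges T'" using \<open>is_path T' p u v\<close> i unfolding is_path_def by blast
      moreover have "p ! i \<noteq> w" "p ! Suc i \<noteq> w" using \<open>w \<notin> set p\<close> i
        by (metis Suc_lessD nth_mem)+
      ultimately show ?thesis unfolding E' by auto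
    qed
    then show ?thesis using that unfolding is_path_def V' by auto
  qed
  have avoid: "w \<notin> set p" if p: "is_path T' p u v" and uv: "u \<noteq> w" "v \<noteq> w" for p u v
  proof
    assume "w \<in> set p"
    then obtain xs ys where xy: "p = xs @ w # ys" by (meson split_list)
    have "xs \<noteq> []" "ys \<noteq> []" using p uv unfolding xy is_path_def by auto
    then obtain xs' y ys' x where "xs = xs' @ [x]" "ys = y # ys'"
      by (meson neq_Nil_conv rev_exhaust)
    then have "(x, w) \<in> edges T'" "(w, y) \<in> edges T'" "x \<noteq> w" "y \<noteq> w" "x \<noteq> y"
      using p unfolding xy is_path_iff_successively
      by (auto simp: successively_append_iff)
    then show False using EV w unfolding E' by auto
  qed
  have to_w: "\<exists>!p. is_path T' p u w" if u: "u \<in> verts T" for u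
  proof -
    obtain q where q: "is_path T q u a" using up_ex u a by blast
    then have "q \<noteq> []" "last q = a" "w \<notin> set q" using w unfolding is_path_def by auto
    then have "is_path T' (q @ [w]) u w"
      using extend[OF q] unfolding is_path_snoc by (auto simp: V' E')
    moreover have "p = q @ [w]" if p: "is_path T' p u w" for p
    proof -
      obtain p' where p': "p = p' @ [w]"
        using p unfolding is_path_def by (metis append_butlast_last_id)
      have "u \<noteq> w" using u w by auto
      with p have "p' \<noteq> []" and p'': "is_path T' p' u (last p')"
        and e: "(last p', w) \<in> edges T'" and "w \<notin> set p'"
        unfolding p' is_path_snoc by auto
      then have "last p' = a" using EV w unfolding E' using last_in_set by fastforce
      then have "is_path T p' u a" using restrict p'' \<open>w \<notin> set p'\<close> by metis
      then show ?thesis using up_eq q p' by blast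
    qed
    ultimately show ?thesis by blast
  qed
  have uniq: "\<exists>!p. is_path T' p u v" if u: "u \<in> verts T'" and v: "v \<in> verts T'" and "u \<noteq> v" for u v
  proof -
    consider "v = w" "u \<in> verts T" | "u = w" "v \<in> verts T" | "u \<in> verts T" "v \<in> verts T"
      using u v \<open>u \<noteq> v\<close> unfolding V' by auto
    then show ?thesis
    proof cases
      case 1 then show ?thesis using to_w by blast
    next
      case 2
      then obtain p where p: "is_path T' p v w" "\<And>q. is_path T' q v w \<Longrightarrow> q = p"
        using to_w by blast
      show ?thesis
        using is_path_rev[OF sy' p(1)] p(2) is_path_rev[OF sy'] 2(1)
        by (metis rev_swap)
    next
      case 3
      then have ne: "u \<noteq> w" "v \<noteq> w" using w by auto
      obtain p where p: "is_path T p u v" using up_ex[OF 3] by blast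
      have "q = p" if "is_path T' q u v" for q
        using up_eq[OF restrict[OF that avoid[OF that ne]] p] .
      then show ?thesis using extend[OF p] by blast
    qed
  qed
  show ?thesis
    unfolding is_rtree_def
  proof (intro conjI)
    show "\<forall>u\<in>verts T'. \<forall>v\<in>verts T'. u \<noteq> v \<longrightarrow> (\<exists>!p. is_path T' p u v)"
      using uniq by blast
  qed (use fin EV rf sy' rt a in \<open>auto simp: V' E' r'\<close>)
qed

section \<open>Rooted trees obtained from orders\<close>

definition order_tree :: "nat set \<Rightarrow> (nat \<Rightarrow> nat \<Rightarrow> bool) \<Rightarrow> nat \<Rightarrow> rtree" where
  "order_tree V le r = \<lparr>verts = V,
     edges = {(x, y). x \<in> V \<and> y \<in> V \<and> (x = y \<or> covers V le x y \<or> covers V le y x)}, root = r\<rparr>"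

lemma order_tree_simps [simp]:
  "verts (order_tree V le r) = V" "root (order_tree V le r) = r"
  "edges (order_tree V le r) =
     {(x, y). x \<in> V \<and> y \<in> V \<and> (x = y \<or> covers V le x y \<or> covers V le y x)}"
  by (auto simp: order_tree_def)

text \<open>Induction on the number of vertices. A vertex with the largest down-set is maximal, and
  deleting it changes no other cover; \<open>is_rtree_add_leaf\<close> puts it back.\<close>

lemma is_rtree_order_tree:
  assumes "tree_order V le r"
  shows "is_rtree (order_tree V le r)"
  using assms
proof (induction "card V" arbitrary: V rule: less_induct)
  case less
  interpret tree_order V le r by fact
  show ?case
  proof (cases "V = {r}")
    case True
    then have "order_tree V le r = \<lparr>verts = {r}, edges = {(r, r)}, root = r\<rparr>"
      by (auto simp: order_tree_def covers_def)
    then show ?thesis using is_rtree_single by simp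
  next
    case False
    then have "V - {r} \<noteq> {}" using root_in by auto
    define m where "m = Max ((\<lambda>z. card (down z)) ` (V - {r}))"
    have "m \<in> (\<lambda>z. card (down z)) ` (V - {r})"
      unfolding m_def using finite_V \<open>V - {r} \<noteq> {}\<close> by (intro Max_in) auto
    then obtain w where w: "w \<in> V" "w \<noteq> r" "card (down w) = m" by auto
    have max: "x = w" if "x \<in> V" "le w x" for x
    proof (rule ccontr)
      assume "x \<noteq> w"
      then have "card (down w) < card (down x)" using card_down_less[of w x] that w by auto
      moreover have "x \<noteq> r" using that w root_le[of w] le_antisym[of w r] root_in by auto
      then have "card (down x) \<le> m" unfolding m_def using finite_V that by (intro Max_ge) auto
      ultimately show False using w by simp
    qed
    obtain a where a: "cov a w" using ex_parent w by blast
    let ?W = "V - {w}"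
    have W: "tree_order ?W le r"
    proof
      show "finite ?W" "r \<in> ?W" using finite_V root_in w by auto
      fix x y z
      show "x \<in> ?W \<Longrightarrow> le x x" "x \<in> ?W \<Longrightarrow> le r x" using le_refl root_le by auto
      show "\<lbrakk>x \<in> ?W; y \<in> ?W; le x y; le y x\<rbrakk> \<Longrightarrow> x = y" using le_antisym by auto
      show "\<lbrakk>x \<in> ?W; y \<in> ?W; z \<in> ?W; le x y; le y z\<rbrakk> \<Longrightarrow> le x z" using le_trans[of x y z] by auto
      show "\<lbrakk>x \<in> ?W; y \<in> ?W; z \<in> ?W; le x z; le y z\<rbrakk> \<Longrightarrow> le x y \<or> le y x"
        using down_chain[of x y z] by auto
    qed
    have cov_W: "covers ?W le x y \<longleftrightarrow> cov x y \<and> y \<noteq> w" for x y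
      using max unfolding covers_def by auto
    have "is_rtree (order_tree ?W le r)"
      using less.hyps[OF card_Diff1_less[OF finite_V w(1)] W] .
    then show ?thesis
    proof (rule is_rtree_add_leaf)
      show "a \<in> verts (order_tree ?W le r)" using a covD by auto
      show "edges (order_tree V le r) = edges (order_tree ?W le r) \<union> {(a, w), (w, a), (w, w)}"
        (is "?L = ?R")
      proof (rule set_eqI, clarify)
        fix x y
        have 1: "\<not> cov w z" for z using max covD by metis
        have 2: "cov z w \<longleftrightarrow> z = a" for z using a parent_unique by blast
        show "((x, y) \<in> ?L) = ((x, y) \<in> ?R)"
          using covD[OF a] w by (auto simp: cov_W 1 2)
      qed
    qed (use w in auto)
  qed
qed

text \<open>The path from the root to \<open>y\<close> runs exactly through \<open>down y\<close>:
  it grows by one vertex with each cover.\<close>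

lemma tree_le_order_tree:
  assumes "tree_order V le r"
  shows "tree_le (order_tree V le r) x y \<longleftrightarrow> x \<in> V \<and> y \<in> V \<and> le x y"
proof -
  interpret tree_order V le r by fact
  let ?T = "order_tree V le r"
  have T: "is_rtree ?T" using is_rtree_order_tree assms by blast
  have ex: "\<exists>p. is_path ?T p r y \<and> set p = down y" if "y \<in> V" for y
    using that
  proof (induction rule: tree_induct)
    case root
    have "down r = {r}" using root_le le_antisym root_in le_refl by blast
    then show ?case using root_in by (intro exI[of _ "[r]"]) (auto simp: is_path_def)
  next
    case (child x y)
    then obtain p where p: "is_path ?T p r x" "set p = down x" by blast
    have xy: "x \<in> V" "y \<in> V" "x \<noteq> y" "le x y" using child covD by auto
    have dy: "down y = insert y (down x)"
    proof (intro equalityI subsetI)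
      fix z assume "z \<in> down y"
      then show "z \<in> insert y (down x)" using le_parent[OF child(1), of z] by auto
    next
      fix z assume "z \<in> insert y (down x)"
      then show "z \<in> down y" using xy le_trans[of z x y] le_refl by auto
    qed
    have "p \<noteq> []" "last p = x" using p by (auto simp: is_path_def)
    moreover have "y \<notin> set p" using p(2) xy le_antisym by auto
    ultimately have "is_path ?T (p @ [y]) r y"
      unfolding is_path_snoc using p child xy by auto
    then show ?case using p(2) dy by (intro exI[of _ "p @ [y]"]) auto
  qed
  show ?thesis
  proof (cases "y \<in> V")
    case True
    then obtain p where p: "is_path ?T p r y" "set p = down y" using ex by blast
    have "q = p" if "is_path ?T q r y" for q
    proof (cases "y = r")
      case True
      then show ?thesis using that p is_path_self by metis
    next
      case False
      have "\<forall>u\<in>V. \<forall>v\<in>V. u \<noteq> v \<longrightarrow> (\<exists>!p. is_path ?T p u v)"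
        using T unfolding is_rtree_def by simp
      then have "\<exists>!p. is_path ?T p r y" using True root_in \<open>y \<noteq> r\<close> by metis
      then show ?thesis using that p(1) by metis
    qed
    then have "(\<exists>q. is_path ?T q r y \<and> x \<in> set q) \<longleftrightarrow> x \<in> set p" using p(1) by blast
    then show ?thesis using p(2) True by (simp add: tree_le_def)
  qed (auto simp: tree_le_def)
qed

abbreviation tcov :: "rtree \<Rightarrow> nat \<Rightarrow> nat \<Rightarrow> bool" where
  "tcov T \<equiv> covers (verts T) (tree_le T)"

lemma tcov_order_tree:
  assumes "tree_order V le r"
  shows "tcov (order_tree V le r) = covers V le"
  unfolding covers_def by (intro ext) (auto simp: tree_le_order_tree[OF assms])

section \<open>The order carried by a rooted tree\<close>

context
  fixes T assumes T: "is_rtree T"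
begin

private definition "rp y = (THE p. is_path T p (root T) y)"

private lemma root_path: "y \<in> verts T \<Longrightarrow> \<exists>!p. is_path T p (root T) y"
  using T is_path_self unfolding is_rtree_def by metis

private lemma rp: "y \<in> verts T \<Longrightarrow> is_path T (rp y) (root T) y"
  unfolding rp_def using root_path theI' by metis

private lemma rp_eq: "is_path T p (root T) y \<Longrightarrow> rp y = p"
proof -
  assume p: "is_path T p (root T) y"
  then have "y \<in> verts T" unfolding is_path_def using last_in_set by blast
  then show "rp y = p" using rp p root_path by blast
qed

private lemma rp_props:
  assumes "y \<in> verts T"
  shows "rp y \<noteq> []" "hd (rp y) = root T" "last (rp y) = y" "distinct (rp y)" "set (rp y) \<subseteq> verts T"
  using rp[OF assms] by (auto simp: is_path_def)

private lemma rp_prefix: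
  assumes "y \<in> verts T" "rp y = ps @ x # qs"
  shows "rp x = ps @ [x]"
proof (rule rp_eq)
  have "is_path T (ps @ x # qs) (root T) y" using rp assms by metis
  then show "is_path T (ps @ [x]) (root T) x"
    unfolding is_path_iff_successively
    by (auto simp: successively_append_iff hd_append successively_Cons)
qed

text \<open>Vertices are identified with their paths from the root. On these lists the tree order is
  the prefix order, so the order axioms, including that down-sets are chains, become facts about
  prefixes.\<close>

private lemma tree_le_iff:
  "tree_le T x y \<longleftrightarrow> x \<in> verts T \<and> y \<in> verts T \<and> prefix (rp x) (rp y)"
proof (cases "x \<in> verts T \<and> y \<in> verts T")
  case True
  then have "(\<exists>p. is_path T p (root T) y \<and> x \<in> set p) \<longleftrightarrow> x \<in> set (rp y)"
    using rp rp_eq by metis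
  also have "\<dots> \<longleftrightarrow> prefix (rp x) (rp y)"
  proof
    assume "x \<in> set (rp y)"
    then obtain ps qs where "rp y = ps @ x # qs" by (meson split_list)
    with rp_prefix[OF _ this] True show "prefix (rp x) (rp y)" by (auto simp: prefix_def)
  next
    assume "prefix (rp x) (rp y)"
    then show "x \<in> set (rp y)"
      using rp_props(1,3)[of x] True by (metis last_in_set set_mono_prefix subsetD)
  qed
  finally show ?thesis using True by (auto simp: tree_le_def)
qed (auto simp: tree_le_def)

lemma tree_order_rtree: "tree_order (verts T) (tree_le T) (root T)"
proof
  show "finite (verts T)" "root T \<in> verts T" using T by (auto simp: is_rtree_def)
  fix x y z
  show "x \<in> verts T \<Longrightarrow> tree_le T x x" by (simp add: tree_le_iff)
  show "\<lbrakk>x \<in> verts T; y \<in> verts T; tree_le T x y; tree_le T y x\<rbrakk> \<Longrightarrow> x = y"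
    unfolding tree_le_iff by (metis prefix_order.antisym rp_props(3))
  show "\<lbrakk>x \<in> verts T; y \<in> verts T; z \<in> verts T; tree_le T x y; tree_le T y z\<rbrakk> \<Longrightarrow> tree_le T x z"
    unfolding tree_le_iff by (metis prefix_order.trans)
  show "tree_le T (root T) x" if "x \<in> verts T"
  proof -
    have r: "root T \<in> verts T" using T by (auto simp: is_rtree_def)
    have "rp (root T) = [root T]" using r by (intro rp_eq) (simp add: is_path_self)
    moreover have "rp x = root T # tl (rp x)" using rp_props[OF that] by (metis list.collapse)
    ultimately show ?thesis using r that unfolding tree_le_iff
      by (metis Cons_prefix_Cons Nil_prefix)
  qed
  show "\<lbrakk>x \<in> verts T; y \<in> verts T; z \<in> verts T; tree_le T x z; tree_le T y z\<rbrakk>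
    \<Longrightarrow> tree_le T x y \<or> tree_le T y x"
    unfolding tree_le_iff using prefix_same_cases by blast
qed

private lemma rp_edge:
  assumes "(x, y) \<in> edges T" "y \<notin> set (rp x)"
  shows "rp y = rp x @ [y]"
proof (rule rp_eq)
  have "x \<in> verts T" "y \<in> verts T" using T assms unfolding is_rtree_def by auto
  then show "is_path T (rp x @ [y]) (root T) y"
    unfolding is_path_snoc using rp rp_props assms by auto
qed

text \<open>If \<open>y\<close> is off the root path of \<open>x\<close>, that path continues along
  the edge to \<open>y\<close>, and the edge is a cover. The remaining case, each vertex on the root
  path of the other, forces equality by antisymmetry.\<close>

lemma edges_rtree:
  "(x, y) \<in> edges T \<longleftrightarrow> x \<in> verts T \<and> y \<in> verts T \<and> (x = y \<or> tcov T x y \<or> tcov T y x)"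
proof -
  interpret tree_order "verts T" "tree_le T" "root T" by (rule tree_order_rtree)
  have sym: "\<And>x y. (x, y) \<in> edges T \<Longrightarrow> (y, x) \<in> edges T"
    and EV: "edges T \<subseteq> verts T \<times> verts T" and rf: "\<And>x. x \<in> verts T \<Longrightarrow> (x, x) \<in> edges T"
    using T unfolding is_rtree_def by blast+
  have cov_snoc: "tcov T x y" if e: "(x, y) \<in> edges T" and s: "y \<notin> set (rp x)" for x y
  proof -
    have V: "x \<in> verts T" "y \<in> verts T" using EV e by auto
    have y: "rp y = rp x @ [y]" using rp_edge e s by blast
    have "x \<noteq> y" using s rp_props(1,3)[OF V(1)] by (metis last_in_set)
    moreover have "z = x \<or> z = y" if "z \<in> verts T" "prefix (rp x) (rp z)" "prefix (rp z) (rp x @ [y])" for z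
    proof -
      have "rp z = rp x \<or> rp z = rp y" using that y
        by (metis prefix_order.antisym prefix_snoc)
      then show ?thesis using that V rp_props(3) by metis
    qed
    ultimately show ?thesis unfolding covers_def tree_le_iff y using V by auto
  qed
  have cov_edge: "(x, y) \<in> edges T" if c: "tcov T x y" for x y
  proof -
    have V: "x \<in> verts T" "y \<in> verts T" "x \<noteq> y" "prefix (rp x) (rp y)"
      using covD[OF c] tree_le_iff by auto
    then obtain qs where qs: "rp y = rp x @ qs" by (auto simp: prefix_def)
    have "qs \<noteq> []" using qs V rp_props(3) by (metis append_Nil2)
    then obtain q qs' where q: "qs = q # qs'" by (cases qs) auto
    then have rq: "rp q = rp x @ [q]" using rp_prefix[OF V(2), of "rp x" q qs'] qs by simp
    have "q \<in> verts T" using rp_props(5)[OF V(2)] qs q by auto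
    moreover have "q \<noteq> x" using rp_props(4)[OF V(2)] rp_props(1,3)[OF V(1)] qs q
      by (metis distinct_append disjoint_iff last_in_set list.set_intros(1))
    moreover have "tree_le T x q" "tree_le T q y"
      unfolding tree_le_iff using V \<open>q \<in> verts T\<close> rq qs q by (auto simp: prefix_def)
    ultimately have "q = y" using cov_between c by blast
    moreover have "(last (rp x), q) \<in> edges T"
      using rp[OF V(2)] rp_props(1)[OF V(1)] unfolding qs q is_path_iff_successively
      by (auto simp: successively_append_iff)
    ultimately show ?thesis using rp_props(3) V by metis
  qed
  show ?thesis
  proof
    assume e: "(x, y) \<in> edges T"
    then have V: "x \<in> verts T" "y \<in> verts T" using EV by auto
    have "x = y" if "y \<in> set (rp x)" "x \<in> set (rp y)"
    proof -
      have "tree_le T x y" "tree_le T y x" using that V rp unfolding tree_le_def by auto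
      then show ?thesis using le_antisym V by blast
    qed
    then show "x \<in> verts T \<and> y \<in> verts T \<and> (x = y \<or> tcov T x y \<or> tcov T y x)"
      using cov_snoc e sym V by blast
  next
    assume "x \<in> verts T \<and> y \<in> verts T \<and> (x = y \<or> tcov T x y \<or> tcov T y x)"
    then show "(x, y) \<in> edges T" using cov_edge sym rf by blast
  qed
qed

end

text \<open>Vertices of an \<open>rtree\<close> are natural numbers, while the trees built later
  have pairs as vertices; their orders are moved to the numbers along a coding with left inverse
  \<open>dec\<close>.\<close>

lemma tree_order_image:
  assumes "tree_order V le r" and dec: "\<And>x. x \<in> V \<Longrightarrow> dec (enc x) = x"
  shows "tree_order (enc ` V) (\<lambda>x y. le (dec x) (dec y)) (enc r)"
proof -
  interpret tree_order V le r by fact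
  show ?thesis
  proof
    show "finite (enc ` V)" "enc r \<in> enc ` V" using finite_V root_in by auto
    fix x y z
    show "x \<in> enc ` V \<Longrightarrow> le (dec x) (dec x)" using le_refl dec by auto
    show "x \<in> enc ` V \<Longrightarrow> le (dec (enc r)) (dec x)" using root_le root_in dec by auto
    show "\<lbrakk>x \<in> enc ` V; y \<in> enc ` V; le (dec x) (dec y); le (dec y) (dec x)\<rbrakk> \<Longrightarrow> x = y"
      using le_antisym dec by (metis imageE)
    show "\<lbrakk>x \<in> enc ` V; y \<in> enc ` V; z \<in> enc ` V; le (dec x) (dec y); le (dec y) (dec z)\<rbrakk>
      \<Longrightarrow> le (dec x) (dec z)"
      using le_trans[of "dec x" "dec y" "dec z"] dec by auto
    show "\<lbrakk>x \<in> enc ` V; y \<in> enc ` V; z \<in> enc ` V; le (dec x) (dec z); le (dec y) (dec z)\<rbrakk>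
      \<Longrightarrow> le (dec x) (dec y) \<or> le (dec y) (dec x)"
      using down_chain[of "dec x" "dec y" "dec z"] dec by auto
  qed
qed

lemma covers_image:
  assumes dec: "\<And>x. x \<in> V \<Longrightarrow> dec (enc x) = x" and "x \<in> V" "y \<in> V"
  shows "covers (enc ` V) (\<lambda>x y. le (dec x) (dec y)) (enc x) (enc y) \<longleftrightarrow> covers V le x y"
proof -
  have "enc x = enc y \<longleftrightarrow> x = y" if "x \<in> V" "y \<in> V" for x y
    using dec that by metis
  then show ?thesis using assms(2,3) dec unfolding covers_def by auto
qed

section \<open>Light confluent epimorphisms\<close>

text \<open>The local form of a light confluent epimorphism; the two results on it below give the
  equivalence. Lifting heights and constructing maps both work vertex by vertex and use this
  form.\<close>

definition tree_covering :: "rtree \<Rightarrow> rtree \<Rightarrow> (nat \<Rightarrow> nat) \<Rightarrow> bool" where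
  "tree_covering A B f \<longleftrightarrow> f (root A) = root B \<and>
     (\<forall>x y. tcov A x y \<longrightarrow> tcov B (f x) (f y)) \<and>
     (\<forall>x\<in>verts A. \<forall>c. tcov B (f x) c \<longrightarrow> (\<exists>y. tcov A x y \<and> f y = c))"

lemma graph_connectedI:
  assumes "Q \<subseteq> verts G"
    and "\<And>A B. \<lbrakk>A \<noteq> {}; B \<noteq> {}; A \<inter> B = {}; A \<union> B = Q; \<forall>a\<in>A. \<forall>b\<in>B. (a, b) \<notin> edges G\<rbrakk> \<Longrightarrow> False"
  shows "graph_connected G Q"
  unfolding graph_connected_def
  by (intro conjI assms(1) notI, elim exE conjE) (rule assms(2))

lemma graph_connectedD:
  assumes "graph_connected G Q" "A \<noteq> {}" "B \<noteq> {}" "A \<inter> B = {}" "A \<union> B = Q"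
    "\<forall>a\<in>A. \<forall>b\<in>B. (a, b) \<notin> edges G"
  shows False
proof -
  have "\<exists>A B. A \<noteq> {} \<and> B \<noteq> {} \<and> A \<inter> B = {} \<and> A \<union> B = Q \<and> (\<forall>a\<in>A. \<forall>b\<in>B. (a, b) \<notin> edges G)"
    by (intro exI[of _ A] exI[of _ B] conjI assms(2-))
  then show False using assms(1) unfolding graph_connected_def by (elim conjE notE)
qed

lemma graph_connected_insert:
  assumes K: "graph_connected G K" and k: "k \<in> K" and e: "(k, y) \<in> edges G" "(y, k) \<in> edges G"
    and y: "y \<in> verts G"
  shows "graph_connected G (insert y K)"
proof (cases "y \<in> K")
  case False
  have conn: False if "P \<noteq> {}" "Q \<noteq> {}" "P \<inter> Q = {}" "P \<union> Q = K" "\<forall>a\<in>P. \<forall>b\<in>Q. (a, b) \<notin> edges G" for P Q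
    using graph_connectedD[OF K] that .
  have False if PQ: "P \<noteq> {}" "Q \<noteq> {}" "P \<inter> Q = {}" "P \<union> Q = insert y K"
    "\<forall>a\<in>P. \<forall>b\<in>Q. (a, b) \<notin> edges G" for P Q
  proof -
    have "k \<in> P \<and> y \<in> P \<or> k \<in> Q \<and> y \<in> Q" using PQ k e by blast
    then show False
    proof
      assume *: "k \<in> P \<and> y \<in> P"
      then have "y \<notin> Q" "k \<noteq> y" using PQ(3) False k by auto
      then show False using * PQ False by (intro conn[of "P - {y}" Q]) auto
    next
      assume *: "k \<in> Q \<and> y \<in> Q"
      then have "y \<notin> P" "k \<noteq> y" using PQ(3) False k by auto
      then show False using * PQ False by (intro conn[of P "Q - {y}"]) auto
    qed
  qed
  moreover have "K \<subseteq> verts G" using K unfolding graph_connected_def by (elim conjE)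
  ultimately show ?thesis using y by (intro graph_connectedI) auto
qed (use K in \<open>simp add: insert_absorb\<close>)

lemma graph_connected_cross:
  assumes "graph_connected G Q" "P \<subseteq> Q" "P \<noteq> {}" "P \<noteq> Q"
  shows "\<exists>a\<in>P. \<exists>b\<in>Q - P. (a, b) \<in> edges G"
proof (rule ccontr)
  assume "\<not> ?thesis"
  then show False using assms by (intro graph_connectedD[of G Q P "Q - P"]) auto
qed

lemma graph_connected_singleton: "x \<in> verts G \<Longrightarrow> graph_connected G {x}"
  by (rule graph_connectedI) (auto simp: Un_singleton_iff)

lemma graph_connected_star:
  assumes "x \<in> verts G" "finite Y" "\<And>y. y \<in> Y \<Longrightarrow> y \<in> verts G \<and> (x, y) \<in> edges G \<and> (y, x) \<in> edges G"
  shows "graph_connected G (insert x Y)"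
  using assms(2,3)
proof (induction Y)
  case empty
  then show ?case using assms(1) by (simp add: graph_connected_singleton)
next
  case (insert y Y)
  then have "graph_connected G (insert y (insert x Y))"
    using graph_connected_insert[of G "insert x Y" x y] by blast
  then show ?case by (simp add: insert_commute)
qed

context
  fixes A B :: rtree and f :: "nat \<Rightarrow> nat"
  assumes A: "is_rtree A" and B: "is_rtree B"
begin

interpretation A: tree_order "verts A" "tree_le A" "root A" by (rule tree_order_rtree[OF A])
interpretation B: tree_order "verts B" "tree_le B" "root B" by (rule tree_order_rtree[OF B])

lemma tree_covering_imp_light_confluent:
  assumes f: "tree_covering A B f"
  shows "epimorphism A B f" "confluent A B f" "light A f"
proof -
  have fr: "f (root A) = root B" and fc: "\<And>x y. tcov A x y \<Longrightarrow> tcov B (f x) (f y)"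
    and fs: "\<And>x c. x \<in> verts A \<Longrightarrow> tcov B (f x) c \<Longrightarrow> \<exists>y. tcov A x y \<and> f y = c"
    using f unfolding tree_covering_def by blast+
  have fV: "f x \<in> verts B" if "x \<in> verts A" for x
    using that by (induction rule: A.tree_induct) (use fr B.root_in B.covD(2)[OF fc] in auto)
  have surj: "y \<in> f ` verts A" if "y \<in> verts B" for y
    using that
  proof (induction rule: B.tree_induct)
    case root
    then show ?case using fr A.root_in by (metis image_eqI)
  next
    case (child x y)
    then obtain x' where "x' \<in> verts A" "f x' = x" by blast
    then obtain y' where "tcov A x' y'" "f y' = y" using fs child by blast
    then show ?case using A.covD by blast
  qed
  have mono: "\<forall>x. tree_le A x y \<longrightarrow> tree_le B (f x) (f y)" if "y \<in> verts A" for y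
    using that
  proof (induction rule: A.tree_induct)
    case root
    have "x = root A" if "tree_le A x (root A)" for x
      using that A.le_antisym[of x "root A"] A.root_le[of x] A.root_in unfolding tree_le_def by blast
    then show ?case using fr B.le_refl B.root_in by metis
  next
    case (child p y)
    note p = A.covD[OF child(1)] B.covD[OF fc[OF child(1)]]
    show ?case
    proof (intro allI impI)
      fix x assume x: "tree_le A x y"
      then have xV: "x \<in> verts A" by (simp add: tree_le_def)
      show "tree_le B (f x) (f y)"
      proof (cases "x = y")
        case True then show ?thesis using B.le_refl p by auto
      next
        case False
        then have "tree_le B (f x) (f p)" using child(2) A.le_parent[OF child(1) xV x] by blast
        then show ?thesis using B.le_trans[OF fV[OF xV] p(5,6)] p by blast
      qed
    qed
  qed
  show "epimorphism A B f"
    unfolding epimorphism_def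
  proof (intro conjI allI impI)
    show "f ` verts A = verts B" using fV surj by blast
    show "(\<lambda>(x, y). (f x, f y)) ` edges A = edges B"
    proof (intro equalityI subsetI)
      fix e assume "e \<in> (\<lambda>(x, y). (f x, f y)) ` edges A"
      then obtain x y where "(x, y) \<in> edges A" "e = (f x, f y)" by auto
      then show "e \<in> edges B" using fV fc by (auto simp: edges_rtree[OF A] edges_rtree[OF B])
    next
      fix e assume e: "e \<in> edges B"
      obtain x y where xy: "e = (x, y)" by (cases e)
      have lift: "\<exists>x' y'. tcov A x' y' \<and> f x' = x \<and> f y' = y" if xy: "tcov B x y" for x y
      proof -
        obtain x' where "x' \<in> verts A" "f x' = x" using surj[OF B.covD(1)[OF xy]] by blast
        then show ?thesis using fs xy by metis
      qed
      consider "x = y" "x \<in> verts B" | "tcov B x y" | "tcov B y x"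
        using e unfolding xy edges_rtree[OF B] by blast
      then have "\<exists>x' y'. (x', y') \<in> edges A \<and> f x' = x \<and> f y' = y"
      proof cases
        case 1
        then show ?thesis using surj[of x] unfolding edges_rtree[OF A] by blast
      qed (use lift[of x y] lift[of y x] A.covD in \<open>unfold edges_rtree[OF A], blast+\<close>)
      then show "e \<in> (\<lambda>(x, y). (f x, f y)) ` edges A" unfolding xy by force
    qed
  qed (use A B fr mono in \<open>auto simp: tree_le_def\<close>)
  show "light A f"
    unfolding light_def edges_rtree[OF A] using fc B.covD(3) by metis
  show "confluent A B f"
    unfolding confluent_def
  proof (intro allI impI)
    fix Q K
    let ?S = "{x \<in> verts A. f x \<in> Q}"
    assume Q: "graph_connected B Q" and K: "graph_component A ?S K"
    then have KS: "K \<subseteq> ?S" and Kne: "K \<noteq> {}" and Kc: "graph_connected A K"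
      and Kmax: "\<And>K'. K \<subseteq> K' \<Longrightarrow> K' \<subseteq> ?S \<Longrightarrow> graph_connected A K' \<Longrightarrow> K' = K"
      unfolding graph_component_def by blast+
    have QV: "Q \<subseteq> verts B" using Q unfolding graph_connected_def by blast
    show "f ` K = Q"
    proof (rule ccontr)
      assume "f ` K \<noteq> Q"
      \<comment> \<open>If the image of \<open>K\<close> misses part of \<open>Q\<close>, an edge
        inside \<open>Q\<close> leaves it. Lifting this edge at \<open>k\<close>, to a child by the
        covering property or else to the parent, enlarges \<open>K\<close> within the preimage,
        against its maximality.\<close>
      then obtain k q where k: "k \<in> K" and q: "q \<in> Q" "q \<notin> f ` K" and e: "(f k, q) \<in> edges B"
        using graph_connected_cross[OF Q, of "f ` K"] KS Kne by blast
      have kA: "k \<in> verts A" using KS k by blast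
      have "\<exists>y. y \<in> verts A \<and> (k, y) \<in> edges A \<and> (y, k) \<in> edges A \<and> f y = q"
      proof -
        have "f k \<noteq> q" using k q by blast
        then consider "tcov B (f k) q" | "tcov B q (f k)"
          using e unfolding edges_rtree[OF B] by blast
        then show ?thesis
        proof cases
          case 1
          then obtain y where "tcov A k y" "f y = q" using fs kA by blast
          then show ?thesis using A.covD unfolding edges_rtree[OF A] by blast
        next
          case 2
          then have "k \<noteq> root A" using B.not_cov_root fr by metis
          then obtain y where y: "tcov A y k" using A.ex_parent kA by blast
          then have "f y = q" using fc 2 B.parent_unique by blast
          then show ?thesis using y A.covD unfolding edges_rtree[OF A] by blast
        qed
      qed
      then obtain y where y: "y \<in> verts A" "(k, y) \<in> edges A" "(y, k) \<in> edges A" "f y = q" by blast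
      then have "graph_connected A (insert y K)" using graph_connected_insert Kc k by blast
      then have "insert y K = K" using Kmax[of "insert y K"] KS y q by blast
      then show False using y q by blast
    qed
  qed
qed

text \<open>The component of \<open>x\<close> in the preimage of \<open>{f x, c}\<close> is the star
  formed by \<open>x\<close> and its children over \<open>c\<close>. Confluence maps it onto
  \<open>{f x, c}\<close>, so such a child exists.\<close>

lemma light_confluent_imp_tree_covering:
  assumes f: "epimorphism A B f" "confluent A B f" "light A f"
  shows "tree_covering A B f"
proof -
  have fr: "f (root A) = root B" and fV: "\<And>x. x \<in> verts A \<Longrightarrow> f x \<in> verts B"
    and fE: "\<And>x y. (x, y) \<in> edges A \<Longrightarrow> (f x, f y) \<in> edges B"
    and mono: "\<And>x y. tree_le A x y \<Longrightarrow> tree_le B (f x) (f y)"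
    using f(1) unfolding epimorphism_def by (auto 0 3)
  have fc: "tcov B (f x) (f y)" if xy: "tcov A x y" for x y
  proof -
    note p = A.covD[OF xy]
    have e: "(x, y) \<in> edges A" unfolding edges_rtree[OF A] using p xy by blast
    then have ne: "f x \<noteq> f y" using f(3) p unfolding light_def by blast
    have "\<not> tcov B (f y) (f x)"
      using B.le_antisym B.covD mono[OF p(4)] ne by metis
    then show ?thesis using fE[OF e] ne unfolding edges_rtree[OF B] by blast
  qed
  have "\<exists>y. tcov A x y \<and> f y = c" if x: "x \<in> verts A" and c: "tcov B (f x) c" for x c
  proof -
    let ?Q = "{f x, c}" and ?Y = "{y. tcov A x y \<and> f y = c}"
    let ?S = "{z \<in> verts A. f z \<in> ?Q}" and ?K = "insert x ?Y"
    note cV = B.covD[OF c]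
    have Q: "graph_connected B ?Q"
      using graph_connected_star[of "f x" B "{c}"] cV c by (auto simp: edges_rtree[OF B])
    have "finite ?Y" using A.finite_V A.covD by (auto intro: finite_subset[of _ "verts A"])
    then have Kc: "graph_connected A ?K"
      by (intro graph_connected_star) (use x A.covD in \<open>auto simp: edges_rtree[OF A]\<close>)
    have KS: "?K \<subseteq> ?S" using x A.covD by auto
    have "K' = ?K" if K': "?K \<subseteq> K'" "K' \<subseteq> ?S" "graph_connected A K'" for K'
    proof (rule ccontr)
      assume "K' \<noteq> ?K"
      then obtain k z where k: "k \<in> ?K" and z: "z \<in> K'" "z \<notin> ?K" and e: "(k, z) \<in> edges A"
        using graph_connected_cross[OF K'(3,1)] by blast
      have zQ: "f z = f x \<or> f z = c" using z K' by blast
      have kz: "tcov A k z \<or> tcov A z k" using e k z unfolding edges_rtree[OF A] by blast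
      have nle: "\<not> tcov B c (f x)" "\<And>u. tcov B u (f x) \<Longrightarrow> u \<noteq> c" "\<not> tcov B c c"
        "\<not> tcov B (f x) (f x)"
        using B.le_antisym cV B.covD by metis+
      show False
      proof (cases "k = x")
        case True
        with kz fc[of x z] fc[of z x] zQ z nle show False by auto
      next
        case False
        then have k: "tcov A x k" "f k = c" using k by auto
        show False
        proof (cases "tcov A z k")
          case True
          then have "z = x" using k A.parent_unique by blast
          then show False using z by blast
        next
          case False
          then have "tcov B c (f z)" using kz fc k by metis
          then show False using zQ nle by metis
        qed
      qed
    qed
    then have "graph_component A ?S ?K"
      unfolding graph_component_def using KS Kc by blast
    then have "f ` ?K = ?Q" using f(2) Q unfolding confluent_def by blast
    then have "c \<in> f ` ?K" by blast
    then show ?thesis using cV by auto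
  qed
  then show ?thesis unfolding tree_covering_def using fr fc by blast
qed

end

section \<open>Splitting an edge\<close>

text \<open>The definition describes \<open>B\<close> by its edges. An order on the vertices is
  written down whose order tree is \<open>B\<close>; this shows at once that \<open>B\<close> is a
  rooted tree and which pairs are its covers.\<close>

lemma splitting_edge_mapD:
  assumes "splitting_edge_map B A f"
  obtains a b x where "is_rtree A" "is_rtree B" "tcov A a b" "x \<notin> verts A"
    "verts B = insert x (verts A)" "root B = root A"
    "\<forall>u v. tcov B u v \<longleftrightarrow> tcov A u v \<and> (u, v) \<noteq> (a, b) \<or> (u, v) = (a, x) \<or> (u, v) = (x, b)"
    "\<forall>v\<in>verts A. f v = v" "f x = a \<or> f x = b"
proof -
  obtain a b x where A: "is_rtree A" and ab: "(a, b) \<in> edges A" "tree_less A a b"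
    and x: "x \<notin> verts A" and V: "verts B = insert x (verts A)"
    and E: "edges B = (edges A - {(a, b), (b, a)}) \<union> {(a, x), (x, a), (x, b), (b, x), (x, x)}"
    and r: "root B = root A" and f: "\<forall>v\<in>verts A. f v = v" "f x = a \<or> f x = b"
    using assms unfolding splitting_edge_map_def by (elim conjE exE) (rule that, assumption+)
  interpret tree_order "verts A" "tree_le A" "root A" by (rule tree_order_rtree[OF A])
  have tV: "u \<in> verts A" "v \<in> verts A" if "tree_le A u v" for u v
    using that by (auto simp: tree_le_def)
  have "\<not> cov b a" using ab le_antisym covD unfolding tree_less_def by metis
  then have c: "cov a b" using ab unfolding tree_less_def edges_rtree[OF A] by blast
  note cV = covD[OF c]
  \<comment> \<open>\<open>x\<close> is placed directly between \<open>a\<close> and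
    \<open>b\<close>: above everything up to \<open>a\<close>, below everything from
    \<open>b\<close> on.\<close>
  define le where "le u v = (if u = x then v = x \<or> tree_le A b v
    else if v = x then tree_le A u a else tree_le A u v)" for u v
  have tr: "tree_le A u w" if "tree_le A u v" "tree_le A v w" for u v w
    using le_trans[of u v w] that tV by blast
  have as: "u = v" if "tree_le A u v" "tree_le A v u" for u v
    using le_antisym[of u v] that tV by blast
  have ch: "tree_le A u v \<or> tree_le A v u" if "tree_le A u w" "tree_le A v w" for u v w
    using down_chain[of u v w] that tV by blast
  have x': "\<not> tree_le A x v" "\<not> tree_le A v x" for v using x tV by blast+
  have below_b: "u = b \<or> tree_le A u a" if "tree_le A u b" for u
    using le_parent[OF c] that tV by blast
  have nba: "\<not> tree_le A b a" using as cV by blast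
  have T: "tree_order (verts B) le (root B)"
  proof
    show "finite (verts B)" "root B \<in> verts B" using finite_V root_in V r by auto
    fix u v w
    show "u \<in> verts B \<Longrightarrow> le u u" using le_refl by (auto simp: le_def V)
    show "u \<in> verts B \<Longrightarrow> le (root B) u" using root_le x root_in cV by (auto simp: le_def V r)
    show "\<lbrakk>u \<in> verts B; v \<in> verts B; le u v; le v u\<rbrakk> \<Longrightarrow> u = v"
      using as[of u v] nba tr[of b v a] tr[of b u a] by (auto simp: le_def split: if_splits)
    show "le u w" if "le u v" "le v w"
    proof -
      consider "u = x" "v = x" | "u = x" "v \<noteq> x" "w = x" | "u = x" "v \<noteq> x" "w \<noteq> x"
        | "u \<noteq> x" "v = x" "w = x" | "u \<noteq> x" "v = x" "w \<noteq> x" | "u \<noteq> x" "v \<noteq> x" by blast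
      then show ?thesis
      proof cases
        case 5
        then have "tree_le A u a" "tree_le A b w" using that by (auto simp: le_def)
        then show ?thesis using 5 tr[OF tr[OF _ cV(4)]] by (auto simp: le_def)
      next
        case 6
        then show ?thesis using that tr[of u v w] tr[of u v a] by (auto simp: le_def split: if_splits)
      qed (use that tr[of b v a] tr[of b v w] nba in \<open>auto simp: le_def\<close>)
    qed
    show "le u v \<or> le v u" if "le u w" "le v w"
    proof -
      consider "w = x" | "w \<noteq> x" "u = x" "v = x" | "w \<noteq> x" "u \<noteq> x" "v = x"
        | "w \<noteq> x" "u = x" "v \<noteq> x" | "w \<noteq> x" "u \<noteq> x" "v \<noteq> x" by blast
      then show ?thesis
      proof cases
        case 3
        then have "tree_le A u b \<or> tree_le A b u" using that ch[of u w b] by (auto simp: le_def)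
        then show ?thesis using 3 below_b le_refl cV by (auto simp: le_def)
      next
        case 4
        then have "tree_le A v b \<or> tree_le A b v" using that ch[of v w b] by (auto simp: le_def)
        then show ?thesis using 4 below_b le_refl cV by (auto simp: le_def)
      qed (use that ch[of u a v] ch[of u w v] in \<open>auto simp: le_def split: if_splits\<close>)
    qed
  qed
  have cov': "covers (verts B) le u v \<longleftrightarrow>
      cov u v \<and> (u, v) \<noteq> (a, b) \<or> (u, v) = (a, x) \<or> (u, v) = (x, b)" for u v
  proof -
    have bB: "a \<in> verts B" "b \<in> verts B" "x \<in> verts B" "a \<noteq> x" "b \<noteq> x" using V cV x by auto
    consider "u = x" "v = x" | "u = x" "v \<in> verts A" | "u \<in> verts A" "v = x"
      | "u \<in> verts A" "v \<in> verts A" | "u \<notin> verts B \<or> v \<notin> verts B" using V by blast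
    then show ?thesis
    proof cases
      case 1
      then show ?thesis using x cV(1,2) bB(4,5) by (auto simp: covers_def)
    next
      case 2
      have "v \<noteq> x" using 2 x by blast
      have "covers (verts B) le x v \<longleftrightarrow> v = b"
      proof
        assume v: "covers (verts B) le x v"
        then have "le x v" by (simp add: covers_def)
        then have "tree_le A b v" using \<open>v \<noteq> x\<close> by (simp add: le_def)
        then have "le x b" "le b v" using cV le_refl bB \<open>v \<noteq> x\<close> by (auto simp: le_def)
        then show "v = b" using v bB by (auto simp: covers_def)
      next
        assume "v = b"
        then show "covers (verts B) le x v" using bB as le_refl[OF cV(2)]
          unfolding covers_def le_def by auto
      qed
      then show ?thesis using 2 \<open>v \<noteq> x\<close> bB covD x by blast
    next
      case 3
      have "u \<noteq> x" using 3 x by blast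
      have "covers (verts B) le u x \<longleftrightarrow> u = a"
      proof
        assume v: "covers (verts B) le u x"
        then have "le u x" by (simp add: covers_def)
        then have "tree_le A u a" using \<open>u \<noteq> x\<close> by (simp add: le_def)
        then have "le a x" "le u a" using cV le_refl bB \<open>u \<noteq> x\<close> by (auto simp: le_def)
        then show "u = a" using v bB by (auto simp: covers_def)
      next
        assume "u = a"
        then show "covers (verts B) le u x" using bB as le_refl[OF cV(1)]
          unfolding covers_def le_def by auto
      qed
      then show ?thesis using 3 \<open>u \<noteq> x\<close> bB covD x by blast
    next
      case 4
      have ne: "u \<noteq> x" "v \<noteq> x" using 4 x by auto
      have "covers (verts B) le u v \<longleftrightarrow> cov u v \<and> (u, v) \<noteq> (a, b)"
      proof
        assume uv: "covers (verts B) le u v"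
        have le_A: "le p q \<longleftrightarrow> tree_le A p q" if "p \<in> verts A" "q \<in> verts A" for p q
          using that x by (auto simp: le_def)
        have "cov u v" using uv 4 le_A V unfolding covers_def by auto
        moreover have "(u, v) \<noteq> (a, b)"
        proof
          assume "(u, v) = (a, b)"
          then have "le u x" "le x v" using cV le_refl bB by (auto simp: le_def)
          then show False using uv bB ne by (auto simp: covers_def)
        qed
        ultimately show "cov u v \<and> (u, v) \<noteq> (a, b)" by blast
      next
        assume uv: "cov u v \<and> (u, v) \<noteq> (a, b)"
        then have "\<not> (tree_le A u a \<and> tree_le A b v)"
          using cov_between[of u v a] cov_between[of u v b] cV nba tr[of a b v] tr[of u a b] by auto
        then show "covers (verts B) le u v" using uv ne x unfolding covers_def V le_def by auto
      qed
      then show ?thesis using ne by auto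
    next
      case 5
      then show ?thesis using bB V by (auto simp: covers_def)
    qed
  qed
  have "B = order_tree (verts B) le (root B)"
  proof (rule rtree.equality)
    have "(u, v) \<in> edges B \<longleftrightarrow> u \<in> verts B \<and> v \<in> verts B \<and>
      (u = v \<or> covers (verts B) le u v \<or> covers (verts B) le v u)" for u v
    proof -
      have 1: "\<not> cov b a" using nba covD by blast
      have 2: "u \<in> verts A" "v \<in> verts A" "u \<noteq> v" if "cov u v" for u v using covD that by auto
      show ?thesis
        unfolding cov' unfolding V E using c cV(1-3) x 1 by (auto simp: edges_rtree[OF A] dest: 2)
    qed
    then show "edges B = edges (order_tree (verts B) le (root B))" by auto
  qed auto
  then have B: "is_rtree B" "tcov B = covers (verts B) le"
    using is_rtree_order_tree[OF T] tcov_order_tree[OF T] by metis+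
  show ?thesis
    by (rule that[OF A B(1) c x V r]) (use cov' B(2) f in auto)
qed

text \<open>The converse construction. \<open>y\<close> is the least vertex above \<open>x\<close>,
  so \<open>x\<close> does not branch, and deleting it merges two covers into the single cover from
  \<open>p\<close> to \<open>y\<close>.\<close>

lemma splitting_edge_map_order_tree:
  assumes T: "tree_order V le r" and x: "x \<in> V" "x \<noteq> r" and p: "covers V le p x"
    and y: "y \<in> V" "x \<noteq> y" "le x y" "\<And>z. z \<in> V \<Longrightarrow> le x z \<Longrightarrow> z \<noteq> x \<Longrightarrow> le y z"
    and f: "\<And>v. v \<in> V - {x} \<Longrightarrow> f v = v" "f x = p \<or> f x = y"
  shows "tree_order (V - {x}) le r"
    and "splitting_edge_map (order_tree V le r) (order_tree (V - {x}) le r) f"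
proof -
  interpret tree_order V le r by fact
  let ?W = "V - {x}"
  show W: "tree_order ?W le r"
  proof
    show "finite ?W" "r \<in> ?W" using finite_V root_in x by auto
    fix u v w
    show "u \<in> ?W \<Longrightarrow> le u u" "u \<in> ?W \<Longrightarrow> le r u" using le_refl root_le by auto
    show "\<lbrakk>u \<in> ?W; v \<in> ?W; le u v; le v u\<rbrakk> \<Longrightarrow> u = v" using le_antisym by auto
    show "\<lbrakk>u \<in> ?W; v \<in> ?W; w \<in> ?W; le u v; le v w\<rbrakk> \<Longrightarrow> le u w" using le_trans[of u v w] by auto
    show "\<lbrakk>u \<in> ?W; v \<in> ?W; w \<in> ?W; le u w; le v w\<rbrakk> \<Longrightarrow> le u v \<or> le v u"
      using down_chain[of u v w] by auto
  qed
  note pV = covD[OF p]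
  have nyx: "\<not> le y x" and nxp: "\<not> le x p" using le_antisym x y pV by blast+
  have py: "le p y" "p \<noteq> y" using le_trans[of p x y] pV y nyx by auto
  have xy: "cov x y"
    unfolding covers_def using x y le_antisym by metis
  have cov_xv: "cov x v \<longleftrightarrow> v = y" for v
    using xy y covD cov_between by metis
  have cov_ux: "cov u x \<longleftrightarrow> u = p" for u
    using p parent_unique by blast
  have not_py: "\<not> cov p y" using cov_between[of p y x] pV y by auto
  have cov_W: "covers ?W le u v \<longleftrightarrow> cov u v \<and> u \<noteq> x \<and> v \<noteq> x \<or> (u, v) = (p, y)" for u v
  proof
    assume uv: "covers ?W le u v"
    then have V: "u \<in> V" "v \<in> V" "u \<noteq> x" "v \<noteq> x" "u \<noteq> v" "le u v" by (auto simp: covers_def)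
    show "cov u v \<and> u \<noteq> x \<and> v \<noteq> x \<or> (u, v) = (p, y)"
    proof (cases "cov u v")
      case False
      then have ux: "le u x" "le x v" using uv V unfolding covers_def by auto
      then have "le u p" "le y v" using le_parent[OF p] y V by blast+
      have "le p v" "le u y" using le_trans[of p x v] le_trans[of u x y] ux V pV y by blast+
      have "p = u \<or> p = v" using uv \<open>le u p\<close> \<open>le p v\<close> pV unfolding covers_def by auto
      moreover have "p \<noteq> v" using ux nxp by blast
      moreover have "y = u \<or> y = v" using uv \<open>le u y\<close> \<open>le y v\<close> y unfolding covers_def by auto
      moreover have "y \<noteq> u" using ux nyx by blast
      ultimately show ?thesis by blast
    qed (use V in blast)
  next
    assume "cov u v \<and> u \<noteq> x \<and> v \<noteq> x \<or> (u, v) = (p, y)"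
    then show "covers ?W le u v"
    proof
      assume "(u, v) = (p, y)"
      moreover have "z = p \<or> z = y" if z: "z \<in> ?W" "le p z" "le z y" for z
      proof -
        have "le z x \<or> le x z" using down_chain[of z x y] z y x by auto
        then show ?thesis
          using le_parent[OF p, of z] le_antisym[of z p] y(4)[of z] le_antisym[of z y] z pV y by auto
      qed
      ultimately show ?thesis using pV y py unfolding covers_def by auto
    qed (auto simp: covers_def)
  qed
  show "splitting_edge_map (order_tree V le r) (order_tree ?W le r) f"
    unfolding splitting_edge_map_def
  proof (intro conjI is_rtree_order_tree[OF W], rule exI[of _ p], rule exI[of _ y],
      rule exI[of _ x], intro conjI)
    show "(p, y) \<in> edges (order_tree ?W le r)" using pV y cov_W by auto
    show "tree_less (order_tree ?W le r) p y"
      using pV y py by (auto simp: tree_less_def tree_le_order_tree[OF W])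
    have "(u, v) \<in> edges (order_tree V le r) \<longleftrightarrow>
        (u, v) \<in> edges (order_tree ?W le r) - {(p, y), (y, p)} \<union> {(p, x), (x, p), (x, y), (y, x), (x, x)}"
      for u v
    proof -
      have "\<not> cov y p" using covD(4) le_antisym py pV y by blast
      then show ?thesis
        using pV(1,3) y(1,2) py(2) x(1) not_py
        by (cases "u = x"; cases "v = x") (auto simp: cov_W cov_xv cov_ux)
    qed
    then show "edges (order_tree V le r) = edges (order_tree ?W le r) - {(p, y), (y, p)} \<union>
      {(p, x), (x, p), (x, y), (y, x), (x, x)}" by auto
  qed (use x f in auto)
qed

section \<open>Heights on a tree\<close>

definition inner :: "rtree \<Rightarrow> nat \<Rightarrow> bool" where
  "inner T b \<longleftrightarrow> (\<exists>c. tcov T b c)"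

inductive on_branch :: "rtree \<Rightarrow> (nat \<Rightarrow> nat set \<Rightarrow> nat) \<Rightarrow> nat set \<Rightarrow> nat \<Rightarrow> bool"
  for T \<sigma> S where
  root: "on_branch T \<sigma> S (root T)"
| step: "on_branch T \<sigma> S b \<Longrightarrow> inner T b \<Longrightarrow> on_branch T \<sigma> S (\<sigma> b S)"

definition at_height ::
    "rtree \<Rightarrow> (nat \<Rightarrow> real) \<Rightarrow> (nat \<Rightarrow> nat set \<Rightarrow> nat) \<Rightarrow> real \<Rightarrow> nat set \<Rightarrow> nat \<Rightarrow> bool" where
  "at_height T M \<sigma> t S b \<longleftrightarrow> on_branch T \<sigma> S b \<and> M b \<le> t \<and> (inner T b \<longrightarrow> t < M (\<sigma> b S))"

text \<open>\<open>(t, S)\<close> is the point at height \<open>t\<close> on the branch of the dendroid coded by \<open>S\<close>.\<close>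

definition vertex_at ::
    "rtree \<Rightarrow> (nat \<Rightarrow> real) \<Rightarrow> (nat \<Rightarrow> nat set \<Rightarrow> nat) \<Rightarrow> real \<Rightarrow> nat set \<Rightarrow> nat" where
  "vertex_at T M \<sigma> t S = (THE b. at_height T M \<sigma> t S b)"

text \<open>\<open>Z\<close> is injected into \<open>N\<close>, and a set \<open>X\<close> selects
  the element coded by the least member of \<open>X \<inter> N\<close>. Singletons already reach
  every element.\<close>

lemma ex_subset_coding:
  assumes "finite Z" "Z \<noteq> {}" "finite N" "card Z \<le> card N"
  shows "\<exists>\<tau> :: nat set \<Rightarrow> 'a. (\<forall>X. \<tau> X \<in> Z) \<and> (\<forall>X. \<tau> X = \<tau> (X \<inter> N)) \<and> (\<forall>z\<in>Z. \<exists>X\<subseteq>N. \<tau> X = z)"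
proof -
  obtain h where h: "h ` Z \<subseteq> N" "inj_on h Z"
    using card_le_inj[OF assms(1,3,4)] by blast
  obtain z0 where z0: "z0 \<in> Z" using assms by blast
  define g where "g j = (if j \<in> h ` Z then inv_into Z h j else z0)" for j
  have g: "g j \<in> Z" for j
    using z0 inv_into_into unfolding g_def by metis
  \<comment> \<open>If \<open>X \<inter> N\<close> is empty the least element is unspecified. This
    is harmless: \<open>g\<close> has all its values in \<open>Z\<close>, and the result still
    depends only on \<open>X \<inter> N\<close>.\<close>
  define \<tau> where "\<tau> X = g (LEAST j. j \<in> X \<inter> N)" for X
  have "\<exists>X\<subseteq>N. \<tau> X = z" if "z \<in> Z" for z
  proof (intro exI conjI)
    show "{h z} \<subseteq> N" using h that by auto
    have "(LEAST j. j \<in> {h z} \<inter> N) = h z" using h that by (intro Least_equality) auto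
    then show "\<tau> {h z} = z" using that h by (simp add: \<tau>_def g_def)
  qed
  moreover have "\<tau> X = \<tau> (X \<inter> N)" for X by (simp add: \<tau>_def Int_assoc)
  moreover have "\<tau> X \<in> Z" for X by (simp add: \<tau>_def g)
  ultimately show ?thesis by (intro exI[of _ \<tau>]) simp
qed

section \<open>Values of the sequence, and nice trees\<close>

locale MN_seq =
  fixes d :: "nat \<Rightarrow> real"
  assumes MN_sequence: "MN_sequence d"
begin

definition D :: "real set" where "D = d ` {1..}"

lemma d_range: "1 \<le> j \<Longrightarrow> 0 \<le> d j \<and> d j < 1"
  using MN_sequence unfolding MN_sequence_def by auto

lemma D_range: "x \<in> D \<Longrightarrow> 0 \<le> x \<and> x < 1"
  using d_range unfolding D_def by auto

lemma zero_in_D: "0 \<in> D"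
  using MN_sequence unfolding MN_sequence_def D_def by force

lemma D_dense:
  assumes "0 \<le> x" "x < y" "y \<le> 1"
  shows "\<exists>v\<in>D. x < v \<and> v < y"
proof -
  have "\<forall>x\<in>{0..<1}. \<forall>e>0. \<exists>n\<ge>1. \<bar>d n - x\<bar> < e"
    using MN_sequence unfolding MN_sequence_def by blast
  moreover have "(x + y) / 2 \<in> {0..<1}" "(y - x) / 2 > 0" using assms by auto
  ultimately obtain n where "n \<ge> 1" "\<bar>d n - (x + y) / 2\<bar> < (y - x) / 2" by blast
  then have "x < d n \<and> d n < y" by (auto simp: abs_less_iff field_simps)
  then show ?thesis using \<open>n \<ge> 1\<close> unfolding D_def by auto
qed

lemma D_codense:
  assumes "x < y"
  shows "\<exists>v. v \<notin> D \<and> x < v \<and> v < y"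
proof -
  have "countable D" unfolding D_def by auto
  moreover have "uncountable {x<..<y}" using assms uncountable_open_interval by blast
  ultimately have "\<not> {x<..<y} \<subseteq> D" using countable_subset by blast
  then show ?thesis by auto
qed

lemma infinite_level: "v \<in> D \<Longrightarrow> infinite {j. 1 \<le> j \<and> d j = v}"
  using MN_sequence unfolding MN_sequence_def D_def by auto

definition bits :: "nat set \<Rightarrow> real \<Rightarrow> nat set" where
  "bits J v = {j \<in> J. d j = v}"

text \<open>
  The vertex \<open>b\<close> occupies the heights from \<open>M b\<close> on, up to the value of \<open>M\<close> at the next vertex of the
  branch; the children of \<open>b\<close> part at height \<open>L b\<close>, where \<open>\<sigma> b\<close> selects one of them from the
  indices \<open>j\<close> with \<open>d j = L b\<close>. Since \<open>L a < M b < L b\<close> strictly for \<open>a\<close> below \<open>b\<close>, an edge can always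
  be split. The value \<open>1\<close> of \<open>L\<close> at a leaf is a convention.
\<close>

definition nice ::
    "rtree \<Rightarrow> (nat \<Rightarrow> real) \<Rightarrow> (nat \<Rightarrow> real) \<Rightarrow> nat set \<Rightarrow> (nat \<Rightarrow> nat set \<Rightarrow> nat) \<Rightarrow> bool" where
  "nice T M L J \<sigma> \<longleftrightarrow> is_rtree T \<and> finite J \<and> J \<subseteq> {1..} \<and>
     inner T (root T) \<and> M (root T) = 0 \<and> L (root T) = 0 \<and>
     (\<forall>b\<in>verts T. b \<noteq> root T \<longrightarrow> M b \<notin> D \<and> 0 < M b \<and> M b < L b) \<and>
     (\<forall>b\<in>verts T. (if inner T b then L b \<in> D else L b = 1)) \<and>
     (\<forall>a b. tcov T a b \<longrightarrow> L a < M b) \<and>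
     (\<forall>b S. inner T b \<longrightarrow> tcov T b (\<sigma> b S)) \<and>
     (\<forall>b c. tcov T b c \<longrightarrow> (\<exists>S\<subseteq>bits J (L b). \<sigma> b S = c)) \<and>
     (\<forall>b S. inner T b \<longrightarrow> \<sigma> b S = \<sigma> b (S \<inter> bits J (L b)))"

context
  fixes T M L J \<sigma>
  assumes nice: "nice T M L J \<sigma>"
begin

lemma nice_rtree: "is_rtree T" "finite J" "J \<subseteq> {1..}" "inner T (root T)"
  "M (root T) = 0" "L (root T) = 0"
  using nice unfolding nice_def by blast+

lemma nice_M: "b \<in> verts T \<Longrightarrow> b \<noteq> root T \<Longrightarrow> M b \<notin> D \<and> 0 < M b \<and> M b < L b"
  using nice unfolding nice_def by blast

lemma nice_L: "b \<in> verts T \<Longrightarrow> if inner T b then L b \<in> D else L b = 1"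
  using nice unfolding nice_def by blast

lemma nice_LM: "tcov T a b \<Longrightarrow> L a < M b"
  using nice unfolding nice_def by blast

lemma nice_\<sigma>: "inner T b \<Longrightarrow> tcov T b (\<sigma> b S)"
  "tcov T b c \<Longrightarrow> \<exists>S\<subseteq>bits J (L b). \<sigma> b S = c"
  "inner T b \<Longrightarrow> \<sigma> b S = \<sigma> b (S \<inter> bits J (L b))"
  using nice unfolding nice_def by blast+

interpretation tree_order "verts T" "tree_le T" "root T"
  by (rule tree_order_rtree[OF nice_rtree(1)])

lemma nice_L_range: "b \<in> verts T \<Longrightarrow> 0 \<le> L b \<and> L b \<le> 1"
  using nice_L[of b] D_range by (auto split: if_splits intro: less_imp_le)

lemma nice_M_range: "b \<in> verts T \<Longrightarrow> 0 \<le> M b \<and> M b < 1"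
  using nice_M[of b] nice_L_range[of b] nice_rtree(5) by (cases "b = root T") auto

lemma nice_M_le_L: "b \<in> verts T \<Longrightarrow> M b \<le> L b"
  using nice_M[of b] nice_rtree(5,6) by (cases "b = root T") auto

lemma nice_M_less: "tcov T a b \<Longrightarrow> M a < M b"
  using nice_LM[of a b] nice_M_le_L[of a] covD(1) by fastforce

lemma nice_le_mono: "b \<in> verts T \<Longrightarrow> \<forall>a. tree_le T a b \<longrightarrow> M a \<le> M b \<and> L a \<le> L b"
proof (induction rule: tree_induct)
  case root
  have "a = root T" if "tree_le T a (root T)" for a
    using that le_antisym[of a "root T"] root_le[of a] root_in unfolding tree_le_def by blast
  then show ?case by blast
next
  case (child p b)
  note p = covD[OF child(1)]
  show ?case
  proof (intro allI impI)
    fix a assume a: "tree_le T a b"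
    then have "a = b \<or> tree_le T a p" using le_parent[OF child(1)] unfolding tree_le_def by blast
    moreover have "M p \<le> M b" "L p \<le> L b"
      using nice_M_less[OF child(1)] nice_LM[OF child(1)] nice_M_le_L[OF p(2)] by auto
    ultimately show "M a \<le> M b \<and> L a \<le> L b" using child(2) by fastforce
  qed
qed

lemma on_branch_verts: "on_branch T \<sigma> S b \<Longrightarrow> b \<in> verts T"
  by (induction rule: on_branch.induct) (use root_in nice_\<sigma>(1) covD(2) in blast)+

lemma on_branch_le:
  assumes "on_branch T \<sigma> S b" "a \<in> verts T" "tree_le T a b" "a \<noteq> b"
  shows "on_branch T \<sigma> S a \<and> inner T a \<and> tree_le T (\<sigma> a S) b"
  using assms
proof (induction rule: on_branch.induct)
  case root
  then show ?case using le_antisym root_le root_in by blast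
next
  case (step b)
  have c: "tcov T b (\<sigma> b S)" by (rule nice_\<sigma>(1)[OF step(2)])
  have ab: "tree_le T a b" using le_parent[OF c] step by blast
  show ?case
  proof (cases "a = b")
    case True
    then show ?thesis using step c covD le_refl by blast
  next
    case False
    then have IH: "on_branch T \<sigma> S a \<and> inner T a \<and> tree_le T (\<sigma> a S) b"
      using step ab by blast
    then have "tree_le T (\<sigma> a S) (\<sigma> b S)"
      using le_trans[of "\<sigma> a S" b "\<sigma> b S"] covD[OF c] unfolding tree_le_def[of T "\<sigma> a S" b] by blast
    then show ?thesis using IH by blast
  qed
qed

lemma on_branch_linear:
  assumes "on_branch T \<sigma> S b" "on_branch T \<sigma> S a"
  shows "tree_le T a b \<or> tree_le T b a"
  using assms
proof (induction rule: on_branch.induct)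
  case root
  then show ?case using root_le on_branch_verts by blast
next
  case (step b)
  have c: "tcov T b (\<sigma> b S)" by (rule nice_\<sigma>(1)[OF step(2)])
  note cV = covD[OF c]
  have aV: "a \<in> verts T" using step on_branch_verts by blast
  from step consider "tree_le T a b" | "b = a" | "tree_le T b a" "b \<noteq> a" by blast
  then show ?case
  proof cases
    case 1
    then show ?thesis using le_trans[OF aV cV(1,2)] cV by blast
  next
    case 2
    then show ?thesis using cV by blast
  next
    case 3
    then show ?thesis using on_branch_le[OF step.prems cV(1)] by blast
  qed
qed

lemma at_height_unique:
  assumes "at_height T M \<sigma> t S a" "at_height T M \<sigma> t S b"
  shows "a = b"
proof (rule ccontr)
  assume ne: "a \<noteq> b"
  have *: False if "at_height T M \<sigma> t S a" "at_height T M \<sigma> t S b" "a \<noteq> b" "tree_le T a b" for a b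
  proof -
    have V: "a \<in> verts T" "b \<in> verts T" using that on_branch_verts unfolding at_height_def by blast+
    then have "inner T a" "tree_le T (\<sigma> a S) b"
      using that on_branch_le unfolding at_height_def by blast+
    then have "t < M b" using that nice_le_mono V(2) unfolding at_height_def by fastforce
    then show False using that unfolding at_height_def by auto
  qed
  show False using *[of a b] *[of b a] assms ne on_branch_linear unfolding at_height_def by metis
qed

lemma at_height_ex:
  assumes "0 \<le> t"
  shows "\<exists>b. at_height T M \<sigma> t S b"
proof -
  let ?A = "{b. on_branch T \<sigma> S b \<and> M b \<le> t}"
  have fin: "finite ?A" using finite_V on_branch_verts by (auto intro: finite_subset[of _ "verts T"])
  have "root T \<in> ?A" using assms nice_rtree by (auto intro: on_branch.root)
  then have "Max (M ` ?A) \<in> M ` ?A" using fin by (intro Max_in) auto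
  then obtain b where b: "b \<in> ?A" "M b = Max (M ` ?A)" by auto
  have "at_height T M \<sigma> t S b"
    unfolding at_height_def
  proof (intro conjI impI)
    assume i: "inner T b"
    show "t < M (\<sigma> b S)"
    proof (rule ccontr)
      assume "\<not> t < M (\<sigma> b S)"
      then have "\<sigma> b S \<in> ?A" using b i by (auto intro: on_branch.step)
      then have "M (\<sigma> b S) \<le> M b" unfolding b(2) using fin by (intro Max_ge) auto
      then show False using nice_M_less[OF nice_\<sigma>(1)[OF i, of S]] by simp
    qed
  qed (use b in auto)
  then show ?thesis by blast
qed

lemma vertex_at_eqI: "at_height T M \<sigma> t S b \<Longrightarrow> vertex_at T M \<sigma> t S = b"
  unfolding vertex_at_def using at_height_unique by blast

lemma at_height_vertex_at: "0 \<le> t \<Longrightarrow> at_height T M \<sigma> t S (vertex_at T M \<sigma> t S)"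
  using at_height_ex vertex_at_eqI by metis

text \<open>The choices leading to \<open>b\<close> are made at its proper ancestors, whose
  \<open>L\<close> is at most that of the parent of \<open>b\<close> and hence below
  \<open>t\<close>. Each choice reads only indices of \<open>J\<close> with value
  \<open>L a < t\<close>, and there \<open>S\<close> and \<open>S'\<close> agree.\<close>

lemma on_branch_cong:
  assumes "on_branch T \<sigma> S b" "\<And>a. tcov T a b \<Longrightarrow> L a < t" "\<And>j. j \<in> J \<Longrightarrow> d j < t \<Longrightarrow> j \<in> S \<longleftrightarrow> j \<in> S'"
  shows "on_branch T \<sigma> S' b"
  using assms(1,2)
proof (induction rule: on_branch.induct)
  case root
  show ?case by (rule on_branch.root)
next
  case (step b)
  have c: "tcov T b (\<sigma> b S)" by (rule nice_\<sigma>(1)[OF step(2)])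
  have "L b < t" using c step by auto
  then have "S \<inter> bits J (L b) = S' \<inter> bits J (L b)" using assms(3) by (auto simp: bits_def)
  then have eq: "\<sigma> b S = \<sigma> b S'" using nice_\<sigma>(3)[OF step(2)] by metis
  have "L a < t" if "tcov T a b" for a
    using nice_LM[OF that] nice_M_le_L[OF covD(2)[OF that]] \<open>L b < t\<close> by simp
  then have "on_branch T \<sigma> S' b" using step by blast
  then show ?case unfolding eq by (rule on_branch.step[OF _ step(2)])
qed

end

text \<open>Heights are pulled back from \<open>B\<close>. What is new is the choice among the
  children of \<open>a\<close> over one child of \<open>f a\<close>. It is read from indices that
  \<open>B\<close> does not use, so it is independent of the choice made in
  \<open>B\<close>.\<close>

lemma nice_lift_covering:
  assumes B: "nice B M L J \<sigma>" and A: "is_rtree A" and f: "tree_covering A B f"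
  shows "\<exists>M' L' J' \<sigma>'. nice A M' L' J' \<sigma>' \<and>
    (\<forall>t\<ge>0. \<forall>S. f (vertex_at A M' \<sigma>' t S) = vertex_at B M \<sigma> t S)"
proof -
  interpret A: tree_order "verts A" "tree_le A" "root A" by (rule tree_order_rtree[OF A])
  interpret B: tree_order "verts B" "tree_le B" "root B"
    by (rule tree_order_rtree[OF nice_rtree(1)[OF B]])
  have fr: "f (root A) = root B" and fc: "\<And>x y. tcov A x y \<Longrightarrow> tcov B (f x) (f y)"
    and fs: "\<And>x c. x \<in> verts A \<Longrightarrow> tcov B (f x) c \<Longrightarrow> \<exists>y. tcov A x y \<and> f y = c"
    using f unfolding tree_covering_def by blast+
  have fV: "f x \<in> verts B" if "x \<in> verts A" for x
    using that by (induction rule: A.tree_induct) (use fr B.root_in B.covD(2)[OF fc] in auto)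
  have fnr: "f x \<noteq> root B" if "x \<in> verts A" "x \<noteq> root A" for x
    using A.ex_parent[OF that] fc B.not_cov_root by metis
  have f_inner: "inner B (f x) \<longleftrightarrow> inner A x" if "x \<in> verts A" for x
    using that fc fs unfolding inner_def by metis
  have innerV: "x \<in> verts A" if "inner A x" for x using that A.covD unfolding inner_def by blast
  have LD: "L (f a) \<in> D" if "inner A a" for a
    using nice_L[OF B fV[OF innerV[OF that]]] f_inner[OF innerV[OF that]] that by simp
  \<comment> \<open>For each value \<open>v\<close> a block of fresh indices, as many as
    \<open>A\<close> has vertices, which is enough to code any set of siblings. The infinite
    repetition of \<open>v\<close> provides it.\<close>
  have "\<exists>N. v \<in> D \<longrightarrow> finite N \<and> card N = card (verts A) \<and> N \<subseteq> {j. 1 \<le> j \<and> d j = v} - J" for v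
    using infinite_arbitrarily_large[OF Diff_infinite_finite[OF nice_rtree(2)[OF B] infinite_level]]
    by metis
  then obtain N where N: "\<And>v. v \<in> D \<Longrightarrow> finite (N v) \<and> card (N v) = card (verts A) \<and>
      N v \<subseteq> {j. 1 \<le> j \<and> d j = v} - J" by metis
  let ?Z = "\<lambda>a c. {y. tcov A a y \<and> f y = c}"
  define code where "code a c \<tau> \<longleftrightarrow> (\<forall>X. \<tau> X \<in> ?Z a c) \<and> (\<forall>X. \<tau> X = \<tau> (X \<inter> N (L (f a)))) \<and>
      (\<forall>z\<in>?Z a c. \<exists>X\<subseteq>N (L (f a)). \<tau> X = z)" for a c and \<tau> :: "nat set \<Rightarrow> nat"
  have "\<exists>\<tau>. tcov B (f a) c \<and> a \<in> verts A \<longrightarrow> code a c \<tau>" for a c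
  proof (cases "tcov B (f a) c \<and> a \<in> verts A")
    case True
    then have ne: "?Z a c \<noteq> {}" using fs by blast
    then have "inner A a" unfolding inner_def by blast
    note NN = N[OF LD[OF this]]
    have sub: "?Z a c \<subseteq> verts A" using A.covD by blast
    have "finite (?Z a c)" "card (?Z a c) \<le> card (N (L (f a)))"
      using finite_subset[OF sub A.finite_V] card_mono[OF A.finite_V sub] NN by auto
    then have "\<exists>\<tau>. code a c \<tau>"
      unfolding code_def using ex_subset_coding[OF _ ne, of "N (L (f a))"] NN by blast
    then show ?thesis by blast
  qed auto
  then obtain \<tau> where \<tau>': "\<And>a c. tcov B (f a) c \<Longrightarrow> a \<in> verts A \<Longrightarrow> code a c (\<tau> a c)" by metis
  have \<tau>: "(\<forall>X. \<tau> a c X \<in> ?Z a c) \<and> (\<forall>X. \<tau> a c X = \<tau> a c (X \<inter> N (L (f a)))) \<and>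
      (\<forall>z\<in>?Z a c. \<exists>X\<subseteq>N (L (f a)). \<tau> a c X = z)" if "tcov B (f a) c" "a \<in> verts A" for a c
    using \<tau>'[OF that] unfolding code_def .
  \<comment> \<open>The indices of \<open>B\<close> select a child of \<open>f a\<close>; the fresh
    block then selects a lift of that child.\<close>
  define \<sigma>' where "\<sigma>' a S = \<tau> a (\<sigma> (f a) S) S" for a S
  define J' where "J' = J \<union> (\<Union>a\<in>{a \<in> verts A. inner A a}. N (L (f a)))"
  have bits': "bits J' (L (f a)) = bits J (L (f a)) \<union> N (L (f a))"
    and NJ: "N (L (f a)) \<inter> bits J (L (f a)) = {}" if a: "inner A a" for a
  proof -
    show "bits J' (L (f a)) = bits J (L (f a)) \<union> N (L (f a))"
      using N[OF LD] a innerV unfolding bits_def J'_def by fastforce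
    show "N (L (f a)) \<inter> bits J (L (f a)) = {}"
      using N[OF LD[OF a]] unfolding bits_def by blast
  qed
  have \<sigma>'Z: "tcov A a (\<sigma>' a S)" "f (\<sigma>' a S) = \<sigma> (f a) S" if a: "inner A a" for a S
  proof -
    have "inner B (f a)" using a f_inner innerV by blast
    then have "tcov B (f a) (\<sigma> (f a) S)" by (rule nice_\<sigma>(1)[OF B])
    then show "tcov A a (\<sigma>' a S)" "f (\<sigma>' a S) = \<sigma> (f a) S"
      using \<tau> innerV[OF a] unfolding \<sigma>'_def by blast+
  qed
  have nA: "nice A (M \<circ> f) (L \<circ> f) J' \<sigma>'"
    unfolding nice_def
  proof (intro conjI allI impI ballI)
    show "finite J'" unfolding J'_def using nice_rtree(2)[OF B] N[OF LD] A.finite_V by auto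
    show "J' \<subseteq> {1..}" unfolding J'_def using nice_rtree(3)[OF B] N[OF LD] by fastforce
    show "inner A (root A)" using f_inner[OF A.root_in] nice_rtree(4)[OF B] fr by simp
    show "(M \<circ> f) (root A) = 0" "(L \<circ> f) (root A) = 0" using nice_rtree(5,6)[OF B] fr by auto
    fix b assume "b \<in> verts A"
    then show "if inner A b then (L \<circ> f) b \<in> D else (L \<circ> f) b = 1"
      using nice_L[OF B fV] f_inner by simp
    assume "b \<noteq> root A"
    with \<open>b \<in> verts A\<close> show "(M \<circ> f) b \<notin> D" "0 < (M \<circ> f) b" "(M \<circ> f) b < (L \<circ> f) b"
      using nice_M[OF B fV fnr] by auto
  next
    fix a b assume ab: "tcov A a b"
    then show "(L \<circ> f) a < (M \<circ> f) b" using nice_LM[OF B fc] by simp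
    have a: "inner A a" "a \<in> verts A" using ab innerV unfolding inner_def by auto
    obtain S where S: "S \<subseteq> bits J (L (f a))" "\<sigma> (f a) S = f b"
      using nice_\<sigma>(2)[OF B fc[OF ab]] by blast
    obtain X where X: "X \<subseteq> N (L (f a))" "\<tau> a (f b) X = b"
      using \<tau>[OF fc[OF ab] a(2)] ab by blast
    have ia: "inner B (f a)" using a f_inner by blast
    \<comment> \<open>\<open>S\<close> and \<open>X\<close> lie in disjoint sets of indices, so
      their union makes both choices at once: \<open>f b\<close> in \<open>B\<close> and its lift
      \<open>b\<close>.\<close>
    have "(S \<union> X) \<inter> bits J (L (f a)) = S \<inter> bits J (L (f a))" using S X NJ[OF a(1)] by blast
    then have 1: "\<sigma> (f a) (S \<union> X) = f b" using nice_\<sigma>(3)[OF B ia] S by metis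
    have "(S \<union> X) \<inter> N (L (f a)) = X \<inter> N (L (f a))" using S X NJ[OF a(1)] by blast
    then have "\<tau> a (f b) (S \<union> X) = b" using \<tau>[OF fc[OF ab] a(2)] X by metis
    then have "\<sigma>' a (S \<union> X) = b" unfolding \<sigma>'_def 1 .
    moreover have "S \<union> X \<subseteq> bits J' ((L \<circ> f) a)" using S X bits'[OF a(1)] by auto
    ultimately show "\<exists>S\<subseteq>bits J' ((L \<circ> f) a). \<sigma>' a S = b" by blast
  next
    fix a S assume a: "inner A a"
    then show "tcov A a (\<sigma>' a S)" using \<sigma>'Z by blast
    let ?S = "S \<inter> bits J' (L (f a))"
    have ia: "inner B (f a)" using a f_inner innerV by blast
    have "?S \<inter> bits J (L (f a)) = S \<inter> bits J (L (f a))" using bits'[OF a] by blast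
    then have 1: "\<sigma> (f a) ?S = \<sigma> (f a) S" using nice_\<sigma>(3)[OF B ia] by metis
    have "?S \<inter> N (L (f a)) = S \<inter> N (L (f a))" using bits'[OF a] by blast
    then have "\<tau> a (\<sigma> (f a) S) ?S = \<tau> a (\<sigma> (f a) S) S"
      using \<tau>[OF nice_\<sigma>(1)[OF B ia] innerV[OF a]] by metis
    then show "\<sigma>' a S = \<sigma>' a (S \<inter> bits J' ((L \<circ> f) a))" by (simp add: \<sigma>'_def 1)
  qed (rule A)
  have "f (vertex_at A (M \<circ> f) \<sigma>' t S) = vertex_at B M \<sigma> t S" if "0 \<le> t" for t S
  proof -
    let ?a = "vertex_at A (M \<circ> f) \<sigma>' t S"
    have a: "at_height A (M \<circ> f) \<sigma>' t S ?a" by (rule at_height_vertex_at[OF nA that])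
    have br: "on_branch B \<sigma> S (f x)" if "on_branch A \<sigma>' S x" for x
      using that
    proof (induction rule: on_branch.induct)
      case root
      show ?case unfolding fr by (rule on_branch.root)
    next
      case (step x)
      then show ?case using \<sigma>'Z(2)[OF step(2)] f_inner innerV on_branch.step by metis
    qed
    have "?a \<in> verts A" using a on_branch_verts[OF nA] unfolding at_height_def by blast
    then have "at_height B M \<sigma> t S (f ?a)"
      using a br f_inner \<sigma>'Z(2) unfolding at_height_def by auto
    then show ?thesis using vertex_at_eqI[OF B] by metis
  qed
  then show ?thesis using nA by blast
qed

lemma vertex_at_in_verts: "nice T M L J \<sigma> \<Longrightarrow> 0 \<le> t \<Longrightarrow> vertex_at T M \<sigma> t S \<in> verts T"
  using at_height_vertex_at on_branch_verts unfolding at_height_def by blast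

text \<open>The new vertex takes over part of the heights of the vertex it is sent to; the strict
  inequalities between \<open>L a\<close>, \<open>M b\<close> and \<open>L b\<close> leave room for
  it. It has a single child, so \<open>J\<close> can stay as it is.\<close>

lemma nice_lift_splitting:
  assumes B: "nice B M L J \<sigma>" and f: "splitting_edge_map A B f"
  shows "\<exists>M' L' J' \<sigma>'. nice A M' L' J' \<sigma>' \<and>
    (\<forall>t\<ge>0. \<forall>S. f (vertex_at A M' \<sigma>' t S) = vertex_at B M \<sigma> t S)"
proof -
  obtain a b x where "is_rtree B" and A: "is_rtree A" and ab: "tcov B a b" and x: "x \<notin> verts B"
    and V: "verts A = insert x (verts B)" and r: "root A = root B"
    and cov: "\<forall>u v. tcov A u v \<longleftrightarrow>
      tcov B u v \<and> (u, v) \<noteq> (a, b) \<or> (u, v) = (a, x) \<or> (u, v) = (x, b)"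
    and fid: "\<forall>v\<in>verts B. f v = v" and fx: "f x = a \<or> f x = b"
    by (rule splitting_edge_mapD[OF f])
  have cov': "tcov A u v \<longleftrightarrow>
      tcov B u v \<and> (u, v) \<noteq> (a, b) \<or> (u, v) = (a, x) \<or> (u, v) = (x, b)" for u v
    using cov by blast
  interpret tree_order "verts B" "tree_le B" "root B"
    by (rule tree_order_rtree[OF nice_rtree(1)[OF B]])
  note abV = covD[OF ab]
  have ax: "a \<noteq> x" "b \<noteq> x" and bnr: "b \<noteq> root B" using abV x ab not_cov_root by auto
  have ia: "inner B a" using ab by (auto simp: inner_def)
  have innerV: "u \<in> verts B" if "inner B u" for u using that covD unfolding inner_def by blast
  have inner': "inner A u \<longleftrightarrow> inner B u \<or> u = x" for u
    using ab ax unfolding inner_def cov' by auto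
  \<comment> \<open>A branch from \<open>a\<close> to \<open>b\<close> now passes through
    \<open>x\<close>, whose only child is \<open>b\<close>; all other choices stay.\<close>
  define \<sigma>' where "\<sigma>' u S = (if u = x then b else if u = a \<and> \<sigma> a S = b then x else \<sigma> u S)" for u S
  have \<sigma>V: "\<sigma> u S \<in> verts B" "\<sigma> u S \<noteq> x" "\<sigma> u S \<noteq> u" "\<sigma> u S = b \<Longrightarrow> u = a" if "inner B u" for u S
  proof -
    note c = nice_\<sigma>(1)[OF B that, of S]
    show "\<sigma> u S \<in> verts B" "\<sigma> u S \<noteq> x" "\<sigma> u S \<noteq> u" using covD[OF c] x by auto
    show "u = a" if "\<sigma> u S = b" using parent_unique c ab that by metis
  qed
  \<comment> \<open>Niceness only asks for the chain \<open>L a < M' x < L' x < M' b < L b\<close>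
    and for membership in \<open>D\<close>. The cases \<open>f x = a\<close> and
    \<open>f x = b\<close> fill in the numbers differently.\<close>
  have nA: "nice A M' L' J \<sigma>'"
    if *: "\<And>u. u \<noteq> x \<Longrightarrow> u \<noteq> b \<Longrightarrow> M' u = M u" "\<And>u. u \<noteq> x \<Longrightarrow> L' u = L u"
      "L a < M' x" "M' x < L' x" "L' x < M' b" "M' b < L b" "M' x \<notin> D" "M' b \<notin> D" "L' x \<in> D"
    for M' L'
    unfolding nice_def
  proof (intro conjI allI impI ballI)
    show "finite J" "J \<subseteq> {1..}" using nice_rtree[OF B] by auto
    show "inner A (root A)" using nice_rtree(4)[OF B] r inner' by simp
    have "root B \<noteq> x" using x root_in by blast
    then show "M' (root A) = 0" "L' (root A) = 0" using * nice_rtree(5,6)[OF B] bnr r by auto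
    have La: "0 \<le> L a" using nice_L_range[OF B abV(1)] by simp
    fix u assume u: "u \<in> verts A"
    then show "if inner A u then L' u \<in> D else L' u = 1"
      using nice_L[OF B, of u] *(2,9) inner' V by (cases "u = x") auto
    assume "u \<noteq> root A"
    have "M' u \<notin> D \<and> 0 < M' u \<and> M' u < L' u"
    proof (cases "u = x \<or> u = b")
      case True
      then show ?thesis using *(2)[OF ax(2)] *(3-8) La by auto
    next
      case False
      then have "M' u = M u" "L' u = L u" "u \<in> verts B" using * u V by auto
      then show ?thesis using nice_M[OF B, of u] \<open>u \<noteq> root A\<close> r by simp
    qed
    then show "M' u \<notin> D" "0 < M' u" "M' u < L' u" by auto
  next
    fix u v assume uv: "tcov A u v"
    then consider "tcov B u v" "v \<noteq> b" | "u = a" "v = x" | "u = x" "v = b"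
      unfolding cov' using parent_unique ab by blast
    then show "L' u < M' v"
    proof cases
      case 1
      then have "u \<noteq> x" "v \<noteq> x" using covD x by blast+
      then show ?thesis using 1 * nice_LM[OF B 1(1)] by simp
    qed (use * ax in auto)
    show "\<exists>S\<subseteq>bits J (L' u). \<sigma>' u S = v"
    proof (cases "u = x")
      case True
      then have "v = b" using uv x covD(1) ax unfolding cov' by blast
      then show ?thesis using True unfolding \<sigma>'_def by auto
    next
      case False
      then have "\<exists>w. tcov B u w \<and> (if u = a \<and> w = b then v = x else v = w)"
        using uv ab ax unfolding cov' by auto
      then obtain w where w: "tcov B u w" "if u = a \<and> w = b then v = x else v = w" by blast
      then obtain S where "S \<subseteq> bits J (L u)" "\<sigma> u S = w" using nice_\<sigma>(2)[OF B] by blast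
      then show ?thesis using w False * unfolding \<sigma>'_def by (intro exI[of _ S]) auto
    qed
  next
    fix u S assume u: "inner A u"
    show "tcov A u (\<sigma>' u S)"
    proof (cases "u = x")
      case False
      then have "inner B u" using u inner' by blast
      then show ?thesis using nice_\<sigma>(1)[OF B, of u S] False unfolding cov' \<sigma>'_def by auto
    qed (auto simp: cov' \<sigma>'_def)
    show "\<sigma>' u S = \<sigma>' u (S \<inter> bits J (L' u))"
    proof (cases "u = x")
      case False
      then have "inner B u" using u inner' by blast
      have "\<sigma> u (S \<inter> bits J (L u)) = \<sigma> u S"
        by (rule nice_\<sigma>(3)[OF B \<open>inner B u\<close>, symmetric])
      then show ?thesis unfolding *(2)[OF False] \<sigma>'_def by (cases "u = a") simp_all
    qed (auto simp: \<sigma>'_def)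
  qed (rule A)
  have br: "if y = x then on_branch B \<sigma> S a \<and> \<sigma> a S = b \<and> on_branch B \<sigma> S b else on_branch B \<sigma> S y"
    if "on_branch A \<sigma>' S y" for S y
    using that
  proof (induction rule: on_branch.induct)
    case root
    then show ?case using r x root_in on_branch.root[of B] by auto
  next
    case (step y)
    show ?case
    proof (cases "y = x")
      case True
      then show ?thesis using step ax by (auto simp: \<sigma>'_def)
    next
      case False
      then have y: "on_branch B \<sigma> S y" "inner B y" using step inner' by auto
      then show ?thesis using on_branch.step[OF y] \<sigma>V(2)[OF y(2), of S] False unfolding \<sigma>'_def by auto
    qed
  qed
  have LM: "M a \<le> L a" "L a < M b" "M b < L b" "0 \<le> L a" "L b \<le> 1"
    using nice_M_le_L[OF B abV(1)] nice_LM[OF B ab] nice_M[OF B abV(2) bnr]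
      nice_L_range[OF B abV(1)] nice_L_range[OF B abV(2)] by auto
  show ?thesis
  proof (cases "f x = a")
    case True
    \<comment> \<open>Here \<open>x\<close> gets the heights from \<open>m\<close> up to
      \<open>M b\<close>, the upper end of what belonged to \<open>a\<close> on this branch, and
      \<open>b\<close> keeps its own.\<close>
    obtain m where m: "m \<notin> D" "L a < m" "m < M b" using D_codense LM by blast
    obtain l where l: "l \<in> D" "m < l" "l < M b" using D_dense[of m "M b"] m LM by auto
    have n: "nice A (M(x := m)) (L(x := l)) J \<sigma>'"
      by (rule nA) (use m l LM ax nice_M[OF B abV(2) bnr] in auto)
    have "f (vertex_at A (M(x := m)) \<sigma>' t S) = vertex_at B M \<sigma> t S" if "0 \<le> t" for t S
    proof -
      define y where "y = vertex_at A (M(x := m)) \<sigma>' t S"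
      have y: "at_height A (M(x := m)) \<sigma>' t S y"
        unfolding y_def by (rule at_height_vertex_at[OF n that])
      have "at_height B M \<sigma> t S (f y)"
      proof (cases "y = x")
        case True
        then show ?thesis using y br[of S x] \<open>f x = a\<close> m LM ax inner' unfolding at_height_def
          by (auto simp: \<sigma>'_def)
      next
        case False
        then have o: "on_branch B \<sigma> S y" and "M y \<le> t"
          using y br[of S y] unfolding at_height_def by auto
        then have fy: "f y = y" using fid on_branch_verts[OF B] by blast
        have "t < M (\<sigma> y S)" if i: "inner B y"
        proof -
          have t: "t < (M(x := m)) (\<sigma>' y S)" using y i inner' unfolding at_height_def by blast
          show ?thesis
          proof (cases "y = a \<and> \<sigma> a S = b")
            case True
            then show ?thesis using t m ax by (simp add: \<sigma>'_def)
          next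
            case *: False
            then have "\<sigma>' y S = \<sigma> y S" using False by (auto simp: \<sigma>'_def)
            then show ?thesis using t \<sigma>V(2)[OF i, of S] by simp
          qed
        qed
        then show ?thesis unfolding fy using o \<open>M y \<le> t\<close> by (simp add: at_height_def)
      qed
      then show ?thesis unfolding y_def using vertex_at_eqI[OF B] by metis
    qed
    then show ?thesis using n by blast
  next
    case False
    then have fx: "f x = b" using fx by blast
    \<comment> \<open>Here \<open>x\<close> gets the lower end of the heights of \<open>b\<close>,
      from \<open>M b\<close> up to \<open>m\<close>, and \<open>b\<close> starts only at
      \<open>m\<close>.\<close>
    obtain l where l: "l \<in> D" "M b < l" "l < L b" using D_dense[of "M b" "L b"] LM by auto
    obtain m where m: "m \<notin> D" "l < m" "m < L b" using D_codense l by blast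
    let ?M = "M(x := M b, b := m)"
    have n: "nice A ?M (L(x := l)) J \<sigma>'"
      by (rule nA) (use m l LM ax nice_M[OF B abV(2) bnr] in auto)
    have "f (vertex_at A ?M \<sigma>' t S) = vertex_at B M \<sigma> t S" if "0 \<le> t" for t S
    proof -
      define y where "y = vertex_at A ?M \<sigma>' t S"
      have y: "at_height A ?M \<sigma>' t S y" unfolding y_def by (rule at_height_vertex_at[OF n that])
      have Lb: "L b < M (\<sigma> b S)" if "inner B b" using nice_LM[OF B nice_\<sigma>(1)[OF B that]] .
      have "at_height B M \<sigma> t S (f y)"
      proof (cases "y = x")
        case True
        then show ?thesis using y br[of S x] fx m l LM ax inner' Lb unfolding at_height_def
          by (auto simp: \<sigma>'_def)
      next
        case False
        then have o: "on_branch B \<sigma> S y" and "?M y \<le> t"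
          using y br[of S y] unfolding at_height_def by auto
        then have My: "M y \<le> t" using False l m by (auto split: if_splits)
        have fy: "f y = y" using o fid on_branch_verts[OF B] by blast
        have "t < M (\<sigma> y S)" if i: "inner B y"
        proof -
          have t: "t < ?M (\<sigma>' y S)" using y i inner' unfolding at_height_def by blast
          show ?thesis
          proof (cases "y = a \<and> \<sigma> a S = b")
            case True
            then show ?thesis using t ax by (simp add: \<sigma>'_def)
          next
            case *: False
            then have "\<sigma>' y S = \<sigma> y S" using False by (auto simp: \<sigma>'_def)
            moreover have "\<sigma> y S \<noteq> b" using * \<sigma>V(4)[OF i, of S] by metis
            ultimately show ?thesis using t \<sigma>V(2)[OF i, of S] by simp
          qed
        qed
        then show ?thesis unfolding fy using o My by (simp add: at_height_def)
      qed
      then show ?thesis unfolding y_def using vertex_at_eqI[OF B] by metis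
    qed
    then show ?thesis using n by blast
  qed
qed

lemma nice_lift:
  assumes "simple_confluent A B f" "nice B M L J \<sigma>"
  shows "\<exists>M' L' J' \<sigma>'. nice A M' L' J' \<sigma>' \<and>
    (\<forall>t\<ge>0. \<forall>S. f (vertex_at A M' \<sigma>' t S) = vertex_at B M \<sigma> t S)"
  using assms
proof (induction arbitrary: M L J \<sigma> rule: simple_confluent.induct)
  case (light_confluent A B f)
  then have "is_rtree A" "is_rtree B" by (auto simp: epimorphism_def)
  then show ?case
    using nice_lift_covering light_confluent light_confluent_imp_tree_covering by blast
next
  case (splitting A B f)
  then show ?case using nice_lift_splitting by blast
next
  case (comp A B f C g h)
  obtain M1 L1 J1 \<sigma>1 where 1: "nice B M1 L1 J1 \<sigma>1"
    "\<And>t S. 0 \<le> t \<Longrightarrow> g (vertex_at B M1 \<sigma>1 t S) = vertex_at C M \<sigma> t S"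
    using comp.IH(2)[OF comp.prems] by blast
  obtain M2 L2 J2 \<sigma>2 where 2: "nice A M2 L2 J2 \<sigma>2"
    "\<And>t S. 0 \<le> t \<Longrightarrow> f (vertex_at A M2 \<sigma>2 t S) = vertex_at B M1 \<sigma>1 t S"
    using comp.IH(1)[OF 1(1)] by blast
  have "h (vertex_at A M2 \<sigma>2 t S) = vertex_at C M \<sigma> t S" if "0 \<le> t" for t S
    using comp.hyps(3) vertex_at_in_verts[OF 2(1) that] 1(2)[OF that] 2(2)[OF that] by simp
  then show ?case using 2(1) by blast
qed

end

section \<open>Grid trees\<close>

context MN_seq
begin

definition low :: "nat set \<Rightarrow> real \<Rightarrow> nat set" where
  "low J v = {j \<in> J. d j < v}"

text \<open>All indices of \<open>J\<close> in one cell share their value, so that a grid vertex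
  parts at a single height. In the first cell this value is \<open>0\<close>, as the rule
  \<open>L = 0\<close> at the root demands. The cell above \<open>u N\<close> is not restricted: its
  vertices are leaves.\<close>

definition grid :: "(nat \<Rightarrow> real) \<Rightarrow> nat \<Rightarrow> nat set \<Rightarrow> bool" where
  "grid u N J \<longleftrightarrow> 1 \<le> N \<and> u 0 = 0 \<and> (\<forall>i<N. u i < u (Suc i)) \<and>
     (\<forall>i. 1 \<le> i \<and> i \<le> N \<longrightarrow> u i \<notin> D \<and> u i < 1) \<and> finite J \<and> J \<subseteq> {1..} \<and>
     (\<forall>i<N. \<forall>j\<in>J. \<forall>j'\<in>J. u i \<le> d j \<and> d j < u (Suc i) \<and> u i \<le> d j' \<and> d j' < u (Suc i) \<longrightarrow> d j = d j') \<and>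
     (\<forall>j\<in>J. d j < u 1 \<longrightarrow> d j = 0)"

lemma grid_refinement:
  assumes U0: "finite U0" "U0 \<subseteq> {0<..<1}" "U0 \<inter> D = {}"
    and J: "finite J" "J \<subseteq> {1..}" and \<epsilon>: "0 < \<epsilon>"
  shows "\<exists>u N. grid u N J \<and> U0 \<subseteq> u ` {..N} \<and> (\<forall>i<N. u (Suc i) - u i < \<epsilon>) \<and> 1 - u N < \<epsilon>"
proof -
  have "\<forall>x y. \<exists>v. x < y \<longrightarrow> v \<notin> D \<and> x < v \<and> v < y" using D_codense by metis
  then obtain w where w: "\<And>x y. x < y \<Longrightarrow> w x y \<notin> D \<and> x < w x y \<and> w x y < y" by metis
  \<comment> \<open>\<open>U2\<close> has one point inside each interval of length
    \<open>1 / K\<close>. The first such interval starting at or after a height \<open>x\<close>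
    ends before \<open>x + 2 / K\<close>, which bounds the gaps.\<close>
  obtain K :: nat where K: "0 < K" "2 / K < \<epsilon>"
  proof -
    obtain K :: nat where "K > 2 / \<epsilon>" using reals_Archimedean2 by blast
    moreover from this have "0 < real K" using \<epsilon> by (meson divide_pos_pos less_trans zero_less_numeral)
    ultimately show ?thesis using \<epsilon> that[of K] by (simp add: field_simps)
  qed
  \<comment> \<open>\<open>U1\<close> separates any two points of \<open>X\<close>, so no cell
    contains two values of indices in \<open>J\<close>. Including \<open>0\<close> leaves it as the
    only value in the first cell.\<close>
  define X where "X = insert 0 (d ` J)"
  define U1 where "U1 = (\<lambda>(x, y). w x y) ` {(x, y) \<in> X \<times> X. x < y}"
  define U2 where "U2 = (\<lambda>m. w (real m / K) ((real m + 1) / K)) ` {..<K}"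
  define U where "U = U0 \<union> U1 \<union> U2"
  have X: "finite X" "X \<subseteq> {0..<1}" using J d_range by (auto simp: X_def)
  have "finite U1" unfolding U1_def using X by (auto intro: finite_subset[of _ "X \<times> X"])
  then have finU: "finite U" unfolding U_def U2_def using U0 by auto
  have "v \<in> {0<..<1} - D" if "v \<in> U1" for v
  proof -
    obtain x y where "x \<in> X" "y \<in> X" "x < y" "v = w x y" using \<open>v \<in> U1\<close> unfolding U1_def by auto
    then show ?thesis using w[of x y] X by fastforce
  qed
  moreover have "v \<in> {0<..<1} - D" if "v \<in> U2" for v
  proof -
    obtain m where m: "m < K" "v = w (real m / K) ((real m + 1) / K)"
      using \<open>v \<in> U2\<close> unfolding U2_def by auto
    have "real m / K < (real m + 1) / K" using K by (simp add: divide_strict_right_mono)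
    note w[OF this, folded m(2)]
    moreover have "0 \<le> real m / K" "(real m + 1) / K \<le> 1" using m K by auto
    ultimately have "0 < v" "v < 1" "v \<notin> D" by linarith+
    then show ?thesis by simp
  qed
  ultimately have U: "U \<subseteq> {0<..<1} - D" unfolding U_def using U0 by blast
  define xs where "xs = sorted_list_of_set (insert 0 U)"
  define u where "u i = xs ! i" for i
  define N where "N = length xs - 1"
  have "finite (insert 0 U)" using finU by simp
  then have xs: "set xs = insert 0 U" "sorted_wrt (<) xs"
    unfolding xs_def by (rule set_sorted_list_of_set) (rule strict_sorted_list_of_set)
  have len: "length xs = Suc N" using xs(1) unfolding N_def by (cases xs) auto
  have mono: "u i < u j" if "i < j" "j \<le> N" for i j
    using xs(2) that len unfolding u_def by (simp add: sorted_wrt_iff_nth_less)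
  have img: "u ` {..N} = insert 0 U"
    unfolding xs(1)[symmetric] u_def set_conv_nth using len by (auto simp: less_Suc_eq_le)
  have u0: "u 0 = 0"
  proof -
    have "0 \<in> u ` {..N}" unfolding img by simp
    then obtain k where k: "k \<le> N" "u k = 0" by auto
    have "u 0 \<in> insert 0 U" unfolding img[symmetric] by simp
    then have "u 0 \<ge> 0" using U by auto
    then show ?thesis using mono[of 0 k] k by (cases "k = 0") auto
  qed
  have uU: "u i \<in> U" if "1 \<le> i" "i \<le> N" for i
  proof -
    have "u i \<in> insert 0 U" unfolding img[symmetric] using that by simp
    then show ?thesis using mono[of 0 i] u0 that by auto
  qed
  have gap: False if "i < N" "v \<in> U" "u i < v" "v < u (Suc i)" for i v
  proof -
    have "v \<in> u ` {..N}" unfolding img using that(2) by simp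
    then obtain k where k: "k \<le> N" "u k = v" by auto
    have "k < i \<or> k = i \<or> k = Suc i \<or> Suc i < k" by linarith
    then show False using mono[of k i] mono[of "Suc i" k] k that by auto
  qed
  have top: False if "v \<in> U" "u N < v" for v
  proof -
    have "v \<in> u ` {..N}" unfolding img using that(1) by simp
    then obtain k where k: "k \<le> N" "u k = v" by auto
    then show False using mono[of k N] that by (cases "k = N") auto
  qed
  have U2_dense: "\<exists>v\<in>U. x < v \<and> v < x + 2 / K" if "0 \<le> x" "x + 2 / K \<le> 1" for x
  proof -
    define m where "m = nat \<lceil>x * K\<rceil>"
    have m: "x * K \<le> m" "m < x * K + 1"
      using that K unfolding m_def by (auto simp: le_of_int_ceiling of_nat_nat mult_nonneg_nonneg ceiling_less_iff; linarith)+
    have "(real m + 1) / K < (x * K + 2) / K" using m K by (intro divide_strict_right_mono) auto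
    then have m1: "x \<le> m / K" "(real m + 1) / K < x + 2 / K"
      using m K by (auto simp: pos_le_divide_eq add_divide_distrib)
    have "x * K + 2 \<le> K" using that(2) K by (simp add: field_simps)
    then have "real m + 1 < K" using m by linarith
    then have "w (real m / K) ((real m + 1) / K) \<in> U" unfolding U_def U2_def by auto
    moreover have "real m / K < (real m + 1) / K" using K by (simp add: divide_strict_right_mono)
    ultimately show ?thesis using w m1 by (meson le_less_trans less_trans)
  qed
  have u_lt: "u i < 1" if "i \<le> N" for i
    using uU[of i] U u0 that by (cases "i = 0") auto
  have u_ge: "0 \<le> u i" if "i \<le> N" for i
    using mono[of 0 i] u0 that by (cases "i = 0") auto
  have "1 \<le> N"
  proof (rule ccontr)
    assume "\<not> 1 \<le> N"
    then have "N = 0" by simp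
    moreover have "U \<noteq> {}" unfolding U_def U2_def using K by auto
    ultimately show False using top u0 U by force
  qed
  have sep: False if "i < N" "x \<in> X" "y \<in> X" "u i \<le> x" "x < y" "y < u (Suc i)" for i x y
  proof -
    have "w x y \<in> U" using that unfolding U_def U1_def by auto
    then show False using gap[of i "w x y"] w[of x y] that by auto
  qed
  have "grid u N J"
    unfolding grid_def
  proof (intro conjI allI impI ballI)
    fix i assume "i < N" then show "u i < u (Suc i)" using mono by simp
  next
    fix i assume i: "1 \<le> i \<and> i \<le> N"
    then show "u i \<notin> D" "u i < 1" using uU[of i] U by auto
  next
    fix i j j' assume *: "i < N" "j \<in> J" "j' \<in> J"
      "u i \<le> d j \<and> d j < u (Suc i) \<and> u i \<le> d j' \<and> d j' < u (Suc i)"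
    then have "d j \<in> X" "d j' \<in> X" by (auto simp: X_def)
    then show "d j = d j'" using sep[of i "d j" "d j'"] sep[of i "d j'" "d j"] *
      by (cases "d j" "d j'" rule: linorder_cases) auto
  next
    fix j assume *: "j \<in> J" "d j < u 1"
    have "1 \<le> j" using J * by auto
    then show "d j = 0" using sep[of 0 0 "d j"] * u0 \<open>1 \<le> N\<close> d_range[of j]
      by (cases "d j = 0") (auto simp: X_def)
  qed (use \<open>1 \<le> N\<close> u0 J in auto)
  moreover have "u (Suc i) - u i < \<epsilon>" if i: "i < N" for i
  proof (rule ccontr)
    assume "\<not> ?thesis"
    then have "u i + 2 / K < u (Suc i)" using K by auto
    moreover have "u (Suc i) < 1" using u_lt i by simp
    ultimately obtain v where "v \<in> U" "u i < v" "v < u i + 2 / K" using U2_dense[of "u i"] u_ge[of i] i by auto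
    then show False using gap[of i v] \<open>u i + 2 / K < u (Suc i)\<close> i by auto
  qed
  moreover have "1 - u N < \<epsilon>"
  proof (rule ccontr)
    assume "\<not> ?thesis"
    then have "u N + 2 / K \<le> 1" using K by auto
    then show False using U2_dense[of "u N"] u_ge[of N] top by auto
  qed
  moreover have "U0 \<subseteq> u ` {..N}" unfolding img U_def by auto
  ultimately show ?thesis by blast
qed

text \<open>
  \<open>(i, S)\<close> stands for the part of the dendroid that lies above the point \<open>(u i, S)\<close> and below the
  height \<open>u (Suc i)\<close>; the indices with value between these two heights are not recorded in \<open>S\<close>.
\<close>

definition grid_verts :: "(nat \<Rightarrow> real) \<Rightarrow> nat \<Rightarrow> nat set \<Rightarrow> (nat \<times> nat set) set" where
  "grid_verts u N J = {(i, S). i \<le> N \<and> S \<subseteq> low J (u i)}"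

definition grid_le :: "(nat \<Rightarrow> real) \<Rightarrow> nat set \<Rightarrow> nat \<times> nat set \<Rightarrow> nat \<times> nat set \<Rightarrow> bool" where
  "grid_le u J x y \<longleftrightarrow> fst x \<le> fst y \<and> snd x = snd y \<inter> low J (u (fst x))"

definition enc :: "nat \<times> nat set \<Rightarrow> nat" where
  "enc x = prod_encode (fst x, set_encode (snd x))"

definition dec :: "nat \<Rightarrow> nat \<times> nat set" where
  "dec n = (fst (prod_decode n), set_decode (snd (prod_decode n)))"

definition grid_tree :: "(nat \<Rightarrow> real) \<Rightarrow> nat \<Rightarrow> nat set \<Rightarrow> rtree" where
  "grid_tree u N J = order_tree (enc ` grid_verts u N J) (\<lambda>x y. grid_le u J (dec x) (dec y)) (enc (0, {}))"

lemma dec_enc: "finite (snd x) \<Longrightarrow> dec (enc x) = x"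
  by (simp add: enc_def dec_def)

definition level :: "(nat \<Rightarrow> real) \<Rightarrow> nat \<Rightarrow> real \<Rightarrow> nat" where
  "level u N t = Max {i. i \<le> N \<and> u i \<le> t}"

definition grid_point :: "(nat \<Rightarrow> real) \<Rightarrow> nat \<Rightarrow> nat set \<Rightarrow> real \<Rightarrow> nat set \<Rightarrow> nat" where
  "grid_point u N J t S = enc (level u N t, S \<inter> low J (u (level u N t)))"

context
  fixes u N J
  assumes grid: "grid u N J"
begin

lemma gridD: "1 \<le> N" "u 0 = 0" "i < N \<Longrightarrow> u i < u (Suc i)" "finite J" "J \<subseteq> {1..}"
  "1 \<le> i \<Longrightarrow> i \<le> N \<Longrightarrow> u i \<notin> D \<and> u i < 1"
  using grid unfolding grid_def by blast+

lemma grid_less: "i < j \<Longrightarrow> j \<le> N \<Longrightarrow> u i < u j"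
proof (induction j)
  case (Suc j)
  then show ?case using gridD(3)[of j] by (cases "i = j") auto
qed auto

lemma grid_mono: "i \<le> j \<Longrightarrow> j \<le> N \<Longrightarrow> u i \<le> u j"
  using grid_less[of i j] by (cases "i = j") auto

lemma grid_le_iff: "i \<le> N \<Longrightarrow> j \<le> N \<Longrightarrow> u i \<le> u j \<longleftrightarrow> i \<le> j"
  using grid_less[of j i] grid_mono[of i j] by force

lemma level_eqI: "i \<le> N \<Longrightarrow> u i \<le> t \<Longrightarrow> (i < N \<Longrightarrow> t < u (Suc i)) \<Longrightarrow> level u N t = i"
  unfolding level_def
proof (rule Max_eqI)
  assume *: "i \<le> N" "u i \<le> t" "i < N \<Longrightarrow> t < u (Suc i)"
  fix k assume "k \<in> {i. i \<le> N \<and> u i \<le> t}"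
  then show "k \<le> i" using * grid_mono[of "Suc i" k] by (cases "k \<le> i") auto
qed auto

lemma level_props:
  assumes "0 \<le> t"
  shows "level u N t \<le> N" "u (level u N t) \<le> t" "level u N t < N \<Longrightarrow> t < u (Suc (level u N t))"
proof -
  let ?A = "{i. i \<le> N \<and> u i \<le> t}"
  have "finite ?A" "?A \<noteq> {}" using assms gridD(2) by auto
  then have m: "level u N t \<in> ?A" and le: "\<And>i. i \<in> ?A \<Longrightarrow> i \<le> level u N t"
    unfolding level_def using Max_in Max_ge by blast+
  then show "level u N t \<le> N" "u (level u N t) \<le> t" by auto
  show "t < u (Suc (level u N t))" if "level u N t < N"
    using le[of "Suc (level u N t)"] that by force
qed

lemma finite_low: "finite (low J v)"
  using gridD by (auto simp: low_def)

lemma low_mono: "v \<le> w \<Longrightarrow> low J v \<subseteq> low J w"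
  by (auto simp: low_def)

lemma low_inter: "i \<le> j \<Longrightarrow> j \<le> N \<Longrightarrow> low J (u j) \<inter> low J (u i) = low J (u i)"
  using low_mono[OF grid_mono] by blast

lemma low_zero: "low J (u 0) = {}"
  using gridD d_range by (fastforce simp: low_def)

lemma finite_snd: "x \<in> grid_verts u N J \<Longrightarrow> finite (snd x)"
proof -
  assume "x \<in> grid_verts u N J"
  then have "snd x \<subseteq> low J (u (fst x))" by (auto simp: grid_verts_def)
  then show "finite (snd x)" by (rule finite_subset[OF _ finite_low])
qed

lemma dec_enc_grid: "x \<in> grid_verts u N J \<Longrightarrow> dec (enc x) = x"
  using finite_snd dec_enc by blast

lemma tree_order_grid: "tree_order (grid_verts u N J) (grid_le u J) (0, {})"
proof
  have "grid_verts u N J = Sigma {..N} (\<lambda>i. Pow (low J (u i)))" by (auto simp: grid_verts_def)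
  then show "finite (grid_verts u N J)" using finite_low by simp
  show "(0, {}) \<in> grid_verts u N J" by (auto simp: grid_verts_def)
  fix x y z assume x: "x \<in> grid_verts u N J"
  then show "grid_le u J x x" by (auto simp: grid_le_def grid_verts_def)
  show "grid_le u J (0, {}) x" by (auto simp: grid_le_def low_zero)
  assume y: "y \<in> grid_verts u N J"
  show "x = y" if "grid_le u J x y" "grid_le u J y x"
    using that y unfolding grid_le_def grid_verts_def by (auto simp: prod_eq_iff)
  assume z: "z \<in> grid_verts u N J"
  show "grid_le u J x z" if "grid_le u J x y" "grid_le u J y z"
  proof -
    have "low J (u (fst y)) \<inter> low J (u (fst x)) = low J (u (fst x))"
      using that y by (intro low_inter) (auto simp: grid_le_def grid_verts_def)
    then show ?thesis using that by (auto simp: grid_le_def)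
  qed
  have *: "grid_le u J x y" if "grid_le u J x z" "grid_le u J y z" "fst x \<le> fst y" "y \<in> grid_verts u N J" for x y
  proof -
    have "low J (u (fst y)) \<inter> low J (u (fst x)) = low J (u (fst x))"
      using that by (intro low_inter) (auto simp: grid_verts_def)
    then show ?thesis using that by (auto simp: grid_le_def)
  qed
  show "grid_le u J x y \<or> grid_le u J y x" if "grid_le u J x z" "grid_le u J y z"
    using *[of x y] *[of y x] that x y by (metis nle_le)
qed

lemma covers_grid:
  "covers (grid_verts u N J) (grid_le u J) x y \<longleftrightarrow>
    (\<exists>i S. i < N \<and> S \<subseteq> low J (u (Suc i)) \<and> x = (i, S \<inter> low J (u i)) \<and> y = (Suc i, S))"
proof
  interpret tree_order "grid_verts u N J" "grid_le u J" "(0, {})" by (rule tree_order_grid)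
  assume c: "cov x y"
  note xy = covD[OF c]
  obtain i R where x: "x = (i, R)" by (cases x)
  obtain k S where y: "y = (k, S)" by (cases y)
  have "i \<noteq> k" using xy unfolding x y grid_le_def grid_verts_def by auto
  then have ik: "i < k" "k \<le> N" "R = S \<inter> low J (u i)" "S \<subseteq> low J (u k)"
    using xy unfolding x y grid_le_def grid_verts_def by auto
  \<comment> \<open>Cutting \<open>S\<close> down to level \<open>Suc i\<close> gives a vertex
    between \<open>x\<close> and \<open>y\<close>, so a cover rises by exactly one level.\<close>
  let ?z = "(Suc i, S \<inter> low J (u (Suc i)))"
  have "low J (u (Suc i)) \<inter> low J (u i) = low J (u i)" using ik by (intro low_inter) auto
  then have "?z = x \<or> ?z = y"
    using ik by (intro cov_between[OF c]) (auto simp: grid_verts_def grid_le_def x y)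
  then have "k = Suc i" "S \<subseteq> low J (u (Suc i))" using x y by auto
  then show "\<exists>i S. i < N \<and> S \<subseteq> low J (u (Suc i)) \<and> x = (i, S \<inter> low J (u i)) \<and> y = (Suc i, S)"
    using ik x y by auto
next
  assume "\<exists>i S. i < N \<and> S \<subseteq> low J (u (Suc i)) \<and> x = (i, S \<inter> low J (u i)) \<and> y = (Suc i, S)"
  then obtain i S where *: "i < N" "S \<subseteq> low J (u (Suc i))" "x = (i, S \<inter> low J (u i))" "y = (Suc i, S)" by blast
  show "covers (grid_verts u N J) (grid_le u J) x y"
    unfolding covers_def
  proof (intro conjI ballI impI)
    fix z assume z: "z \<in> grid_verts u N J" "grid_le u J x z" "grid_le u J z y"
    then have "fst z = i \<or> fst z = Suc i" using * by (auto simp: grid_le_def)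
    then show "z = x \<or> z = y" using z * by (auto simp: grid_le_def prod_eq_iff)
  qed (use * in \<open>auto simp: grid_verts_def grid_le_def\<close>)
qed

lemma tree_order_grid_enc:
  "tree_order (enc ` grid_verts u N J) (\<lambda>x y. grid_le u J (dec x) (dec y)) (enc (0, {}))"
  by (rule tree_order_image[where enc = enc and dec = dec, OF tree_order_grid dec_enc_grid])

lemma is_rtree_grid: "is_rtree (grid_tree u N J)"
  unfolding grid_tree_def by (rule is_rtree_order_tree[OF tree_order_grid_enc])

lemma verts_grid_tree: "verts (grid_tree u N J) = enc ` grid_verts u N J"
  and root_grid_tree: "root (grid_tree u N J) = enc (0, {})"
  by (simp_all add: grid_tree_def)

lemma tcov_grid_tree:
  "tcov (grid_tree u N J) x y \<longleftrightarrow>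
    (\<exists>i S. i < N \<and> S \<subseteq> low J (u (Suc i)) \<and> x = enc (i, S \<inter> low J (u i)) \<and> y = enc (Suc i, S))"
proof -
  have "tcov (grid_tree u N J) x y \<longleftrightarrow>
      (\<exists>x'\<in>grid_verts u N J. \<exists>y'\<in>grid_verts u N J. x = enc x' \<and> y = enc y' \<and>
        covers (grid_verts u N J) (grid_le u J) x' y')"
    unfolding grid_tree_def tcov_order_tree[OF tree_order_grid_enc]
  proof
    assume c: "covers (enc ` grid_verts u N J) (\<lambda>x y. grid_le u J (dec x) (dec y)) x y"
    then obtain x' y' where *: "x' \<in> grid_verts u N J" "y' \<in> grid_verts u N J" "x = enc x'" "y = enc y'"
      by (auto simp: covers_def)
    then show "\<exists>x'\<in>grid_verts u N J. \<exists>y'\<in>grid_verts u N J. x = enc x' \<and> y = enc y' \<and>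
        covers (grid_verts u N J) (grid_le u J) x' y'"
      using c covers_image[where enc = enc and dec = dec, OF dec_enc_grid *(1,2)] by blast
  next
    assume "\<exists>x'\<in>grid_verts u N J. \<exists>y'\<in>grid_verts u N J. x = enc x' \<and> y = enc y' \<and>
        covers (grid_verts u N J) (grid_le u J) x' y'"
    then show "covers (enc ` grid_verts u N J) (\<lambda>x y. grid_le u J (dec x) (dec y)) x y"
      using covers_image[where enc = enc and dec = dec, OF dec_enc_grid] by blast
  qed
  also have "\<dots> \<longleftrightarrow> (\<exists>i S. i < N \<and> S \<subseteq> low J (u (Suc i)) \<and> x = enc (i, S \<inter> low J (u i)) \<and> y = enc (Suc i, S))"
  proof
    assume "\<exists>i S. i < N \<and> S \<subseteq> low J (u (Suc i)) \<and> x = enc (i, S \<inter> low J (u i)) \<and> y = enc (Suc i, S)"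
    then obtain i S where *: "i < N" "S \<subseteq> low J (u (Suc i))"
      "x = enc (i, S \<inter> low J (u i))" "y = enc (Suc i, S)" by blast
    then show "\<exists>x'\<in>grid_verts u N J. \<exists>y'\<in>grid_verts u N J. x = enc x' \<and> y = enc y' \<and>
        covers (grid_verts u N J) (grid_le u J) x' y'"
      unfolding covers_grid
      by (intro bexI[of _ "(i, S \<inter> low J (u i))"] bexI[of _ "(Suc i, S)"])
        (auto simp: grid_verts_def)
  next
    assume "\<exists>x'\<in>grid_verts u N J. \<exists>y'\<in>grid_verts u N J. x = enc x' \<and> y = enc y' \<and>
        covers (grid_verts u N J) (grid_le u J) x' y'"
    then show "\<exists>i S. i < N \<and> S \<subseteq> low J (u (Suc i)) \<and> x = enc (i, S \<inter> low J (u i)) \<and> y = enc (Suc i, S)"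
      unfolding covers_grid by blast
  qed
  finally show ?thesis .
qed

lemma inner_grid_tree:
  assumes "(i, S) \<in> grid_verts u N J"
  shows "inner (grid_tree u N J) (enc (i, S)) \<longleftrightarrow> i < N"
proof
  assume "inner (grid_tree u N J) (enc (i, S))"
  then obtain k S' where k: "k < N" "S' \<subseteq> low J (u (Suc k))" "enc (i, S) = enc (k, S' \<inter> low J (u k))"
    unfolding inner_def tcov_grid_tree by blast
  then have "(i, S) = (k, S' \<inter> low J (u k))"
    using dec_enc_grid assms dec_enc[of "(k, S' \<inter> low J (u k))"] finite_low by (metis finite_Int snd_conv)
  then show "i < N" using k by simp
next
  assume i: "i < N"
  have "S \<subseteq> low J (u i)" using assms by (auto simp: grid_verts_def)
  moreover have "low J (u i) \<subseteq> low J (u (Suc i))" using gridD(3)[OF i] by (intro low_mono) simp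
  ultimately have "tcov (grid_tree u N J) (enc (i, S)) (enc (Suc i, S))"
    unfolding tcov_grid_tree using i by (intro exI[of _ i] exI[of _ S]) (auto simp: Int_absorb2)
  then show "inner (grid_tree u N J) (enc (i, S))" unfolding inner_def by blast
qed

lemma in_TCE_grid_tree: "in_TCE (grid_tree u N J)"
proof -
  have "(0, {}) \<in> grid_verts u N J" "(1, {}) \<in> grid_verts u N J" using gridD(1) by (auto simp: grid_verts_def)
  then have "{enc (0, {}), enc (1, {})} \<subseteq> verts (grid_tree u N J)"
    unfolding verts_grid_tree by auto
  moreover have "enc (0, {}) \<noteq> enc (1, {})" by (simp add: enc_def)
  moreover have "finite (verts (grid_tree u N J))" using is_rtree_grid by (simp add: is_rtree_def)
  ultimately have "2 \<le> card (verts (grid_tree u N J))"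
    by (metis card_2_iff card_mono)
  then show ?thesis unfolding in_TCE_def using is_rtree_grid by simp
qed

text \<open>The vertex \<open>(i, S)\<close> starts at \<open>u i\<close> and parts at the common
  value of the indices of \<open>J\<close> in its cell. If there are none it has a single child, and
  any value of \<open>D\<close> inside the cell serves as \<open>L\<close>. The indices recorded on
  passing to level \<open>Suc i\<close> are then exactly those at the parting height.\<close>

lemma nice_grid_tree:
  "\<exists>M L \<sigma>. nice (grid_tree u N J) M L J \<sigma> \<and>
    (\<forall>t\<ge>0. \<forall>S. vertex_at (grid_tree u N J) M \<sigma> t S = grid_point u N J t S)"
proof -
  let ?T = "grid_tree u N J"
  have "\<exists>l. i < N \<longrightarrow> l \<in> D \<and> (i = 0 \<longrightarrow> l = 0) \<and> (0 < i \<longrightarrow> u i < l) \<and> l < u (Suc i) \<and>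
      (\<forall>j\<in>J. u i \<le> d j \<and> d j < u (Suc i) \<longrightarrow> d j = l)" for i
  proof (cases "i < N")
    case i: True
    consider "i = 0" | "0 < i" "\<exists>j\<in>J. u i \<le> d j \<and> d j < u (Suc i)"
      | "0 < i" "\<not> (\<exists>j\<in>J. u i \<le> d j \<and> d j < u (Suc i))" by blast
    then show ?thesis
    proof cases
      case 1
      then show ?thesis using zero_in_D gridD(2) gridD(3)[OF i] grid unfolding grid_def
        by (intro exI[of _ 0]) auto
    next
      case 2
      then obtain j where j: "j \<in> J" "u i \<le> d j" "d j < u (Suc i)" by blast
      have "d j \<in> D" using j gridD(5) by (auto simp: D_def)
      moreover have "u i \<notin> D" using gridD(6)[of i] i 2 by simp
      ultimately have "d j \<in> D" "u i < d j" using j by (auto simp: less_le)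
      then show ?thesis using 2 i j grid unfolding grid_def by (intro exI[of _ "d j"]) auto
    next
      case 3
      have "0 \<le> u i" using grid_mono[of 0 i] gridD(2) i by simp
      then obtain v where "v \<in> D" "u i < v" "v < u (Suc i)"
        using D_dense[of "u i" "u (Suc i)"] gridD(3)[OF i] gridD(6)[of "Suc i"] i by auto
      then show ?thesis using 3 by (intro exI[of _ v]) auto
    qed
  qed auto
  then obtain l where l: "\<And>i. i < N \<Longrightarrow> l i \<in> D \<and> (i = 0 \<longrightarrow> l i = 0) \<and> (0 < i \<longrightarrow> u i < l i) \<and>
      l i < u (Suc i) \<and> (\<forall>j\<in>J. u i \<le> d j \<and> d j < u (Suc i) \<longrightarrow> d j = l i)" by metis
  have ul: "u i \<le> l i" if "i < N" for i
    using l[OF that] gridD(2) by (cases "i = 0") auto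
  have low_Suc: "low J (u (Suc i)) = low J (u i) \<union> bits J (l i)" if "i < N" for i
    using l[OF that] ul[OF that] gridD(3)[OF that] unfolding low_def bits_def by auto
  have low_bits: "bits J (l i) \<inter> low J (u i) = {}" if "i < N" for i
    using ul[OF that] unfolding low_def bits_def by auto
  define M where "M n = u (fst (dec n))" for n
  define L where "L n = (if fst (dec n) = N then 1 else l (fst (dec n)))" for n
  define \<sigma> where "\<sigma> n S = enc (Suc (fst (dec n)), snd (dec n) \<union> (S \<inter> bits J (l (fst (dec n)))))" for n S
  have dec: "dec (enc (i, S)) = (i, S)" if "i \<le> N" "S \<subseteq> low J (u i)" for i S
    using that by (intro dec_enc_grid) (auto simp: grid_verts_def)
  have vertsE: "\<exists>i S. b = enc (i, S) \<and> i \<le> N \<and> S \<subseteq> low J (u i)" if "b \<in> verts ?T" for b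
    using that unfolding verts_grid_tree grid_verts_def by auto
  have innerE: "\<exists>i S. b = enc (i, S) \<and> i < N \<and> S \<subseteq> low J (u i)" if "inner ?T b" for b
    using that unfolding inner_def tcov_grid_tree by blast
  have n: "nice ?T M L J \<sigma>"
    unfolding nice_def
  proof (intro conjI allI impI ballI)
    show "is_rtree ?T" by (rule is_rtree_grid)
    show "finite J" "J \<subseteq> {1..}" using gridD by auto
    have "0 < N" using gridD(1) by simp
    then show "inner ?T (root ?T)"
      unfolding root_grid_tree using inner_grid_tree[of 0 "{}"] by (auto simp: grid_verts_def)
    show "M (root ?T) = 0" "L (root ?T) = 0"
      using dec[of 0 "{}"] gridD(2) l[OF \<open>0 < N\<close>] \<open>0 < N\<close> by (auto simp: M_def L_def root_grid_tree)
    fix b assume "b \<in> verts ?T"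
    then obtain i S where b: "b = enc (i, S)" "i \<le> N" "S \<subseteq> low J (u i)" using vertsE by blast
    have "inner ?T b \<longleftrightarrow> i < N" unfolding b(1) using b by (intro inner_grid_tree) (auto simp: grid_verts_def)
    then show "if inner ?T b then L b \<in> D else L b = 1"
      using b l[of i] by (auto simp: L_def dec)
    assume "b \<noteq> root ?T"
    then have "1 \<le> i" using b low_zero by (cases "i = 0") (auto simp: root_grid_tree)
    then show "M b \<notin> D" "0 < M b" "M b < L b"
      using b gridD(6)[of i] gridD(2) grid_less[of 0 i] l[of i] by (auto simp: M_def L_def dec)
  next
    fix a b assume "tcov ?T a b"
    then obtain i S where ab: "i < N" "S \<subseteq> low J (u (Suc i))" "a = enc (i, S \<inter> low J (u i))" "b = enc (Suc i, S)"
      unfolding tcov_grid_tree by blast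
    then show "L a < M b" using l[of i] by (simp add: L_def M_def dec)
    have "\<sigma> a (S \<inter> bits J (l i)) = b"
      using ab low_Suc[OF ab(1)] by (auto simp: \<sigma>_def dec intro!: arg_cong[where f = enc])
    then show "\<exists>S\<subseteq>bits J (L a). \<sigma> a S = b"
      using ab by (intro exI[of _ "S \<inter> bits J (l i)"]) (auto simp: L_def dec)
  next
    fix b S assume "inner ?T b"
    then obtain i R where b: "b = enc (i, R)" "i < N" "R \<subseteq> low J (u i)" using innerE by blast
    let ?Q = "R \<union> (S \<inter> bits J (l i))"
    have "?Q \<subseteq> low J (u (Suc i))" "?Q \<inter> low J (u i) = R"
      using low_Suc[OF b(2)] low_bits[OF b(2)] b by auto
    then show "tcov ?T b (\<sigma> b S)"
      unfolding tcov_grid_tree using b by (intro exI[of _ i] exI[of _ ?Q]) (auto simp: \<sigma>_def dec)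
    show "\<sigma> b S = \<sigma> b (S \<inter> bits J (L b))" using b by (simp add: \<sigma>_def L_def dec Int_assoc)
  qed
  have br: "on_branch ?T \<sigma> S (enc (i, S \<inter> low J (u i)))" if "i \<le> N" for i S
    using that
  proof (induction i)
    case 0
    then show ?case using on_branch.root[of ?T \<sigma> S] by (simp add: low_zero root_grid_tree)
  next
    case (Suc i)
    let ?b = "enc (i, S \<inter> low J (u i))"
    have "inner ?T ?b" using Suc by (subst inner_grid_tree) (auto simp: grid_verts_def)
    then have "on_branch ?T \<sigma> S (\<sigma> ?b S)" using Suc by (intro on_branch.step) auto
    moreover have "\<sigma> ?b S = enc (Suc i, S \<inter> low J (u (Suc i)))"
      using Suc low_Suc[of i] by (auto simp: \<sigma>_def dec intro!: arg_cong[where f = enc])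
    ultimately show ?case by simp
  qed
  have "vertex_at ?T M \<sigma> t S = grid_point u N J t S" if t: "0 \<le> t" for t S
  proof (rule vertex_at_eqI[OF n])
    let ?i = "level u N t"
    note i = level_props[OF t]
    have "inner ?T (grid_point u N J t S) \<longleftrightarrow> ?i < N"
      unfolding grid_point_def using i by (intro inner_grid_tree) (auto simp: grid_verts_def)
    moreover have "M (\<sigma> (grid_point u N J t S) S) = u (Suc ?i)" if "?i < N"
      using i that low_Suc[OF that] by (simp add: M_def \<sigma>_def grid_point_def dec flip: Int_Un_distrib)
    ultimately show "at_height ?T M \<sigma> t S (grid_point u N J t S)"
      unfolding at_height_def using br[OF i(1), of S] i by (auto simp: M_def grid_point_def dec)
  qed
  then show ?thesis using n by blast
qed

end

end

lemma coversI:
  "\<lbrakk>x \<in> V; y \<in> V; x \<noteq> y; le x y; \<And>z. z \<in> V \<Longrightarrow> le x z \<Longrightarrow> le z y \<Longrightarrow> z = x \<or> z = y\<rbrakk>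
    \<Longrightarrow> covers V le x y"
  unfolding covers_def by blast

section \<open>Nice trees are images of grid trees\<close>

text \<open>
  Vertices \<open>(b, i)\<close> subdivide the edge below \<open>b\<close>. The full subdivision has all its leaves on the
  level \<open>N\<close>, like the grid tree that covers it.
\<close>

definition pair_le :: "rtree \<Rightarrow> nat \<times> nat \<Rightarrow> nat \<times> nat \<Rightarrow> bool" where
  "pair_le T x y \<longleftrightarrow> tree_le T (fst x) (fst y) \<and> snd x \<le> snd y"

definition pair_tree :: "rtree \<Rightarrow> (nat \<times> nat) set \<Rightarrow> rtree" where
  "pair_tree T W = order_tree (prod_encode ` W)
     (\<lambda>x y. pair_le T (prod_decode x) (prod_decode y)) (prod_encode (root T, 0))"

lemma tcov_pair_tree:
  assumes "tree_order W (pair_le T) (root T, 0)"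
  shows "tcov (pair_tree T W) x y \<longleftrightarrow> covers W (pair_le T) (prod_decode x) (prod_decode y)"
proof -
  let ?le = "\<lambda>x y. pair_le T (prod_decode x) (prod_decode y)"
  have "tree_order (prod_encode ` W) ?le (prod_encode (root T, 0))"
    by (rule tree_order_image[OF assms]) simp
  then have tc: "tcov (pair_tree T W) = covers (prod_encode ` W) ?le"
    unfolding pair_tree_def by (rule tcov_order_tree)
  moreover have "prod_encode ` W = prod_decode -` W"
    by (metis bij_betw_def bij_prod_decode bij_vimage_eq_inv_image inv_equality prod_decode_inverse prod_encode_inverse)
  ultimately have mem: "z \<in> prod_encode ` W \<longleftrightarrow> prod_decode z \<in> W" for z by simp
  show ?thesis
  proof (cases "prod_decode x \<in> W \<and> prod_decode y \<in> W")
    case True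
    then show ?thesis
      using covers_image[of W prod_decode prod_encode "prod_decode x" "prod_decode y" "pair_le T"]
      by (simp add: tc)
  next
    case False
    then show ?thesis unfolding tc covers_def mem by blast
  qed
qed

context MN_seq
begin

context
  fixes T M L J0 \<sigma> u N J
  assumes nice: "nice T M L J0 \<sigma>" and grid: "grid u N J"
    and M_grid: "M ` verts T \<subseteq> u ` {..N}" and J0: "J0 \<subseteq> J"
begin

interpretation tree_order "verts T" "tree_le T" "root T"
  by (rule tree_order_rtree[OF nice_rtree(1)[OF nice]])

text \<open>\<open>(b, i)\<close> marks the grid level \<open>i\<close> on the stretch of
  \<open>b\<close>: the heights from \<open>L\<close> of the parent, excluded, to
  \<open>L b\<close>. The ends are given by \<open>L\<close> and not by \<open>M\<close> because the
  siblings of \<open>b\<close> part at the lower end and the children of \<open>b\<close> at the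
  upper one.\<close>

abbreviation "subdiv \<equiv> {(b, i). b \<in> verts T \<and> i \<le> N \<and> (\<forall>a. tcov T a b \<longrightarrow> L a < u i) \<and> u i \<le> L b}"

lemma subdiv_strict:
  assumes "(b, i) \<in> subdiv" "(b', i') \<in> subdiv" "tree_le T b b'" "b \<noteq> b'"
  shows "i < i'"
proof -
  obtain p where p: "tcov T p b'" "tree_le T b p" using ex_parent_above assms by blast
  have "u i \<le> L b" "L p < u i'" using assms p by auto
  moreover have "L b \<le> L p" using nice_le_mono[OF nice covD(1)[OF p(1)]] p(2) by blast
  ultimately have "u i < u i'" by linarith
  then show ?thesis using grid_le_iff[OF grid, of i' i] assms by auto
qed

text \<open>This is where \<open>L (root T) = 0\<close> matters: further vertices on the stretch of
  the root could not be contracted, since a splitting edge map does not remove the root.\<close>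

lemma subdiv_root: "(root T, 0) \<in> subdiv" "(root T, i) \<in> subdiv \<Longrightarrow> i = 0"
proof -
  show "(root T, 0) \<in> subdiv" using root_in not_cov_root nice_rtree(6)[OF nice] gridD(2)[OF grid] by auto
  show "i = 0" if "(root T, i) \<in> subdiv"
    using that nice_rtree(6)[OF nice] gridD(2)[OF grid] grid_less[OF grid, of 0 i] by (cases "i = 0") auto
qed

text \<open>Every \<open>M b\<close> is a grid point, and \<open>L a < M b \<le> L b\<close>. So
  going up one level from the stretch of \<open>a\<close> cannot jump over the whole stretch of
  \<open>b\<close>.\<close>

lemma M_index:
  assumes "tcov T a b" "i \<le> N" "u i \<le> L a"
  shows "\<exists>k. i < k \<and> k \<le> N \<and> u k = M b"
proof -
  obtain k where k: "k \<le> N" "u k = M b" using M_grid covD(2)[OF assms(1)] by force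
  then have "u i < u k" using nice_LM[OF nice assms(1)] assms by simp
  then have "i < k" using grid_le_iff[OF grid, of k i] k assms by auto
  then show ?thesis using k by blast
qed

lemma subdiv_ex:
  assumes "b \<in> verts T" "i \<le> N" "u i \<le> L b"
  shows "\<exists>b'. tree_le T b' b \<and> (b', i) \<in> subdiv"
  using assms(1,3)
proof (induction rule: tree_induct)
  case root
  then have "i = 0" using nice_rtree(6)[OF nice] gridD(2)[OF grid] grid_less[OF grid, of 0 i] assms(2)
    by (cases "i = 0") auto
  then show ?case using subdiv_root(1) root_le root_in by blast
next
  case (child p b)
  note p = covD[OF child(1)]
  show ?case
  proof (cases "u i \<le> L p")
    case True
    then show ?thesis using child(2) le_trans[of _ p b] p by auto
  next
    case False
    have "L a < u i" if "tcov T a b" for a using parent_unique[OF child(1) that] False by simp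
    then show ?thesis using child p assms(2) le_refl by auto
  qed
qed

text \<open>The last level on the stretch of \<open>b\<close>, just before its children part. At a
  leaf \<open>L b = 1\<close> exceeds all grid points, so it is \<open>N\<close>.\<close>

definition top_index :: "nat \<Rightarrow> nat" where
  "top_index b = Max {i. i \<le> N \<and> u i \<le> L b}"

lemma top_index:
  assumes "b \<in> verts T"
  shows "top_index b \<le> N" "u (top_index b) \<le> L b" "\<And>i. i \<le> N \<Longrightarrow> u i \<le> L b \<Longrightarrow> i \<le> top_index b"
    "M b \<le> u (top_index b)" "(b, top_index b) \<in> subdiv"
proof -
  let ?A = "{i. i \<le> N \<and> u i \<le> L b}"
  have "0 \<in> ?A" using nice_L_range[OF nice assms] gridD(2)[OF grid] by simp
  then have ne: "?A \<noteq> {}" by blast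
  have m: "top_index b \<in> ?A" unfolding top_index_def by (rule Max_in[OF _ ne]) simp
  show max: "i \<le> top_index b" if "i \<le> N" "u i \<le> L b" for i
    unfolding top_index_def using that by (intro Max_ge) auto
  show 1: "top_index b \<le> N" "u (top_index b) \<le> L b" using m by auto
  obtain k where k: "k \<le> N" "u k = M b" using M_grid assms by force
  then have "k \<le> top_index b" using max nice_M_le_L[OF nice assms] by simp
  then show 2: "M b \<le> u (top_index b)" using grid_mono[OF grid _ 1(1)] k by metis
  show "(b, top_index b) \<in> subdiv"
    using assms 1 2 nice_LM[OF nice] by force
qed

text \<open>Stated for all subsets of \<open>subdiv\<close> containing the root, because the
  subdivision is contracted vertex by vertex. For down-sets to be chains,
  \<open>subdiv_strict\<close> carries the order of the first components over to the levels.\<close>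

lemma tree_order_subdiv:
  assumes "W \<subseteq> subdiv" "(root T, 0) \<in> W"
  shows "tree_order W (pair_le T) (root T, 0)"
proof
  have "subdiv \<subseteq> verts T \<times> {..N}" by auto
  then show "finite W" using assms(1) finite_V by (meson finite_SigmaI finite_atMost finite_subset)
  show "(root T, 0) \<in> W" by fact
  fix x y z
  assume x: "x \<in> W"
  then have xV: "fst x \<in> verts T" using assms by auto
  then show "pair_le T x x" "pair_le T (root T, 0) x"
    using le_refl root_le by (auto simp: pair_le_def)
  assume y: "y \<in> W"
  then have yV: "fst y \<in> verts T" using assms by auto
  show "x = y" if "pair_le T x y" "pair_le T y x"
    using that le_antisym xV yV by (auto simp: pair_le_def prod_eq_iff)
  assume z: "z \<in> W"
  then have zV: "fst z \<in> verts T" using assms by auto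
  show "pair_le T x z" if "pair_le T x y" "pair_le T y z"
    using that le_trans[OF xV yV zV] by (auto simp: pair_le_def)
  show "pair_le T x y \<or> pair_le T y x" if "pair_le T x z" "pair_le T y z"
  proof (cases "fst x = fst y")
    case True
    then show ?thesis using le_refl xV by (auto simp: pair_le_def)
  next
    case False
    have "tree_le T (fst x) (fst y) \<or> tree_le T (fst y) (fst x)"
      using that down_chain[OF xV yV zV] by (auto simp: pair_le_def)
    moreover have "snd v < snd w" if "v \<in> W" "w \<in> W" "fst v \<noteq> fst w" "tree_le T (fst v) (fst w)" for v w
      using that subdiv_strict[of "fst v" "snd v" "fst w" "snd w"] assms(1) by auto
    ultimately show ?thesis using x y False by (fastforce simp: pair_le_def)
  qed
qed

definition par :: "nat \<Rightarrow> nat" where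
  "par b = (THE a. tcov T a b)"

lemma par_eq: "tcov T a b \<Longrightarrow> par b = a"
  unfolding par_def using parent_unique by blast

text \<open>Levels on the stretch of \<open>b\<close> below \<open>M b\<close> still carry heights
  of the parent: the siblings have parted, but \<open>b\<close> has not begun.\<close>

definition collapse :: "nat \<times> nat \<Rightarrow> nat" where
  "collapse x = (if M (fst x) \<le> u (snd x) then fst x else par (fst x))"

abbreviation "tops \<equiv> (\<lambda>b. (b, top_index b)) ` verts T"

lemma collapse_top: "b \<in> verts T \<Longrightarrow> collapse (b, top_index b) = b"
  using top_index by (simp add: collapse_def)

lemma root_top: "(root T, 0) \<in> tops"
proof -
  have "top_index (root T) = 0" using subdiv_root(2) top_index(5)[OF root_in] by blast
  then show ?thesis using root_in by force
qed

lemma tops_subdiv: "tops \<subseteq> subdiv"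
  using top_index(5) by blast

text \<open>With one vertex per stretch the subdivision is a copy of \<open>T\<close>, and an
  isomorphism is light and confluent.\<close>

lemma simple_confluent_tops: "simple_confluent (pair_tree T tops) T (collapse \<circ> prod_decode)"
proof -
  have tro: "tree_order tops (pair_le T) (root T, 0)"
    by (rule tree_order_subdiv[OF tops_subdiv root_top])
  have "top_index a \<le> top_index b" if "a \<in> verts T" "b \<in> verts T" "tree_le T a b" for a b
    using subdiv_strict[of a "top_index a" b "top_index b"] top_index(5) that
    by (cases "a = b") (auto intro: less_imp_le)
  then have le: "pair_le T (a, top_index a) (b, top_index b) \<longleftrightarrow> tree_le T a b"
    if "a \<in> verts T" "b \<in> verts T" for a b
    using that by (auto simp: pair_le_def)
  have cov_tops: "covers tops (pair_le T) (a, top_index a) (b, top_index b) \<longleftrightarrow> tcov T a b"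
    if "a \<in> verts T" "b \<in> verts T" for a b
    using that le unfolding covers_def by auto
  have A: "is_rtree (pair_tree T tops)"
    unfolding pair_tree_def
    by (rule is_rtree_order_tree, rule tree_order_image[OF tro]) simp
  have "tree_covering (pair_tree T tops) T (collapse \<circ> prod_decode)"
    unfolding tree_covering_def tcov_pair_tree[OF tro]
  proof (intro conjI allI impI ballI)
    have "M (root T) \<le> u 0" using nice_rtree(5)[OF nice] gridD(2)[OF grid] by simp
    then show "(collapse \<circ> prod_decode) (root (pair_tree T tops)) = root T"
      by (simp add: pair_tree_def collapse_def)
  next
    fix x y assume c: "covers tops (pair_le T) (prod_decode x) (prod_decode y)"
    then obtain a b where "a \<in> verts T" "b \<in> verts T" "prod_decode x = (a, top_index a)"
      "prod_decode y = (b, top_index b)" unfolding covers_def by auto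
    then show "tcov T ((collapse \<circ> prod_decode) x) ((collapse \<circ> prod_decode) y)"
      using c cov_tops collapse_top by simp
  next
    fix x c assume x: "x \<in> verts (pair_tree T tops)" and c: "tcov T ((collapse \<circ> prod_decode) x) c"
    then obtain a where a: "a \<in> verts T" "prod_decode x = (a, top_index a)"
      unfolding pair_tree_def by auto
    then have "tcov T a c" using c collapse_top by simp
    then have "covers tops (pair_le T) (a, top_index a) (c, top_index c)"
      using cov_tops covD by blast
    then show "\<exists>y. covers tops (pair_le T) (prod_decode x) (prod_decode y) \<and> (collapse \<circ> prod_decode) y = c"
      using a collapse_top[OF covD(2)[OF \<open>tcov T a c\<close>]]
      by (intro exI[of _ "prod_encode (c, top_index c)"]) simp
  qed
  then show ?thesis
    using tree_covering_imp_light_confluent[OF A nice_rtree(1)[OF nice]] simple_confluent.light_confluent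
    by blast
qed

text \<open>One vertex \<open>x\<close> is added at a time. The top of its stretch is present
  already, so \<open>x\<close> has a unique child; and \<open>collapse\<close> takes at
  \<open>x\<close> the value it has at one of the two neighbours, so it factors through a splitting
  edge map.\<close>

lemma simple_confluent_subdiv:
  assumes "finite X" "X \<subseteq> subdiv - tops"
  shows "simple_confluent (pair_tree T (tops \<union> X)) T (collapse \<circ> prod_decode)"
  using assms
proof (induction X)
  case empty
  show ?case unfolding Un_empty_right by (rule simple_confluent_tops)
next
  case (insert x X)
  let ?W = "tops \<union> X" and ?W' = "tops \<union> insert x X"
  have W': "?W' \<subseteq> subdiv" "(root T, 0) \<in> ?W'" using insert.prems tops_subdiv root_top by auto
  have "?W' = insert x ?W" "x \<notin> ?W" using insert by auto
  then have W: "?W' - {x} = ?W" by auto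
  interpret W: tree_order ?W' "pair_le T" "(root T, 0)" by (rule tree_order_subdiv[OF W'])
  obtain b i where x: "x = (b, i)" by (cases x)
  have xb: "(b, i) \<in> subdiv" "(b, i) \<notin> tops" using insert.prems x by auto
  then have bV: "b \<in> verts T" by simp
  have xr: "x \<noteq> (root T, 0)" using xb(2) root_top x by auto
  have "i \<le> top_index b" using top_index(3)[OF bV] xb by auto
  moreover have "i \<noteq> top_index b" using xb bV by auto
  ultimately have it: "i < top_index b" by simp
  let ?I = "{k. i < k \<and> (b, k) \<in> ?W'}"
  have tI: "top_index b \<in> ?I" using it bV by auto
  \<comment> \<open>The unique child of \<open>x\<close> is the next vertex on the same
    stretch.\<close>
  define k where "k = (LEAST k. k \<in> ?I)"
  have kI: "k \<in> ?I" unfolding k_def using tI by (rule LeastI)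
  have kle: "k \<le> k'" if "k' \<in> ?I" for k' unfolding k_def using that by (rule Least_le)
  let ?y = "(b, k)"
  have y: "?y \<in> ?W'" "x \<noteq> ?y" "pair_le T x ?y" using kI x le_refl[OF bV] by (auto simp: pair_le_def)
  have ymin: "pair_le T ?y z" if z: "z \<in> ?W'" "pair_le T x z" "z \<noteq> x" for z
  proof (cases "fst z = b")
    case True
    then have "snd z \<in> ?I" using z unfolding x pair_le_def by (auto simp: prod_eq_iff)
    then show ?thesis using kle True le_refl[OF bV] by (simp add: pair_le_def)
  next
    case False
    then have "top_index b < snd z"
      using subdiv_strict[OF top_index(5)[OF bV], of "fst z" "snd z"] z W' unfolding x pair_le_def by auto
    then show ?thesis using kle[OF tI] z unfolding x pair_le_def by auto
  qed
  obtain p where p: "W.cov p x" using W.ex_parent[of x] xr by blast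
  note pV = W.covD[OF p]
  \<comment> \<open>If \<open>M b \<le> u i\<close>, the child has the value \<open>b\<close> too.
    Otherwise the value is the parent of \<open>b\<close>, which is also the value at
    \<open>p\<close>: either \<open>p\<close> is on the same stretch, or it is the top of the
    stretch below.\<close>
  have "collapse x = collapse p \<or> collapse x = collapse ?y"
  proof (cases "M b \<le> u i")
    case True
    have "k \<le> N" using kI W' by auto
    then have "u i \<le> u k" using grid_mono[OF grid, of i k] kI by simp
    then show ?thesis using True by (simp add: collapse_def x)
  next
    case False
    then have xpar: "collapse x = par b" by (simp add: collapse_def x)
    obtain b'' i'' where pp: "p = (b'', i'')" by (cases p)
    have le: "tree_le T b'' b" "i'' \<le> i" using pV unfolding x pp by (auto simp: pair_le_def)
    show ?thesis
    proof (cases "b'' = b")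
      case True
      have "u i'' \<le> u i" using grid_mono[OF grid le(2)] xb by simp
      then show ?thesis using False True xpar by (simp add: collapse_def pp)
    next
      case ne: False
      have b''V: "b'' \<in> verts T" using pV W' pp by auto
      obtain a where a: "tcov T a b" "tree_le T b'' a" using ex_parent_above[OF b''V bV le(1) ne] by blast
      note aV = covD[OF a(1)]
      have ta: "(a, top_index a) \<in> ?W'" using aV by auto
      have "top_index a < i" using subdiv_strict[OF top_index(5)[OF aV(1)] xb(1)] aV by blast
      then have "pair_le T (a, top_index a) x" using aV by (simp add: pair_le_def x)
      moreover have "pair_le T p (a, top_index a)"
      proof -
        have "i'' \<le> top_index a"
        proof (cases "b'' = a")
          case True
          then show ?thesis using top_index(3)[OF aV(1), of i''] pV W' pp by auto
        next
          case False
          then show ?thesis using subdiv_strict[OF _ top_index(5)[OF aV(1)], of b'' i''] pV W' pp a by auto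
        qed
        then show ?thesis using a by (simp add: pair_le_def pp)
      qed
      ultimately have "p = (a, top_index a)"
        using W.cov_between[OF p ta] aV by (auto simp: x)
      then show ?thesis using xpar par_eq[OF a(1)] collapse_top[OF aV(1)] by simp
    qed
  qed
  then obtain q where q: "q = p \<or> q = ?y" "collapse x = collapse q" by blast
  define f where "f v = (if v = prod_encode x then prod_encode q else v)" for v
  let ?le = "\<lambda>x y. pair_le T (prod_decode x) (prod_decode y)"
  have V': "prod_encode ` ?W' - {prod_encode x} = prod_encode ` ?W"
    unfolding W[symmetric] by (auto simp: image_set_diff[OF inj_prod_encode])
  have enc_tro: "tree_order (prod_encode ` ?W') ?le (prod_encode (root T, 0))"
    by (rule tree_order_image[OF W.tree_order_axioms]) simp
  have "splitting_edge_map (pair_tree T ?W') (pair_tree T ?W) f"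
    unfolding pair_tree_def V'[symmetric]
  proof (rule splitting_edge_map_order_tree(2)[OF enc_tro, where p = "prod_encode p" and y = "prod_encode ?y"])
    show "covers (prod_encode ` ?W') ?le (prod_encode p) (prod_encode x)"
      using covers_image[where V = "?W'" and enc = prod_encode and dec = prod_decode and le = "pair_le T"] p pV by auto
    show "f (prod_encode x) = prod_encode p \<or> f (prod_encode x) = prod_encode ?y"
      using q(1) by (auto simp: f_def)
  qed (use xr y ymin in \<open>auto simp: f_def prod_encode_eq\<close>)
  moreover have "simple_confluent (pair_tree T ?W) T (collapse \<circ> prod_decode)"
    using insert.IH insert.prems by blast
  moreover have "\<forall>v\<in>verts (pair_tree T ?W'). (collapse \<circ> prod_decode) v = (collapse \<circ> prod_decode) (f v)"
    using q(2) by (auto simp: f_def)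
  ultimately show ?case using simple_confluent.splitting simple_confluent.comp by blast
qed

lemma on_branch_subdiv_unique:
  assumes "on_branch T \<sigma> S b" "(b, i) \<in> subdiv" "on_branch T \<sigma> S b'" "(b', i) \<in> subdiv"
  shows "b = b'"
  using on_branch_linear[OF nice assms(1,3)] subdiv_strict[OF assms(2,4)] subdiv_strict[OF assms(4,2)]
  by auto

lemma on_branch_subdiv_Suc:
  assumes b: "on_branch T \<sigma> S b" "(b, i) \<in> subdiv" and i: "Suc i \<le> N"
  shows "\<exists>b'. on_branch T \<sigma> S b' \<and> (b', Suc i) \<in> subdiv \<and> (b' = b \<or> inner T b \<and> b' = \<sigma> b S)"
proof (cases "u (Suc i) \<le> L b")
  case True
  have "u i < u (Suc i)" using gridD(3)[OF grid] i by simp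
  then have "(b, Suc i) \<in> subdiv" using b True i by fastforce
  then show ?thesis using b by blast
next
  case False
  \<comment> \<open>A leaf has \<open>L b = 1\<close>, above all levels; so leaving the stretch of
    \<open>b\<close> means that \<open>b\<close> has children.\<close>
  have "u (Suc i) < 1" using gridD(6)[OF grid] i by simp
  then have "inner T b" using nice_L[OF nice, of b] b False by (auto split: if_splits)
  then have c: "tcov T b (\<sigma> b S)" by (rule nice_\<sigma>(1)[OF nice])
  obtain k where k: "i < k" "k \<le> N" "u k = M (\<sigma> b S)" using M_index[OF c, of i] b by auto
  then have "u (Suc i) \<le> M (\<sigma> b S)" using grid_mono[OF grid, of "Suc i" k] by simp
  also have "\<dots> \<le> L (\<sigma> b S)" using nice_M_le_L[OF nice covD(2)[OF c]] .
  finally have "(\<sigma> b S, Suc i) \<in> subdiv"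
    using c covD(2) i False parent_unique by fastforce
  then show ?thesis using on_branch.step[OF b(1) \<open>inner T b\<close>] \<open>inner T b\<close> by blast
qed

definition edge_at :: "nat \<Rightarrow> nat set \<Rightarrow> nat" where
  "edge_at i S = (THE b. on_branch T \<sigma> S b \<and> (b, i) \<in> subdiv)"

lemma edge_at_eqI: "on_branch T \<sigma> S b \<Longrightarrow> (b, i) \<in> subdiv \<Longrightarrow> edge_at i S = b"
  unfolding edge_at_def using on_branch_subdiv_unique by blast

lemma edge_at: "i \<le> N \<Longrightarrow> on_branch T \<sigma> S (edge_at i S) \<and> (edge_at i S, i) \<in> subdiv"
proof (induction i)
  case 0
  then show ?case using edge_at_eqI[OF on_branch.root subdiv_root(1)] on_branch.root subdiv_root(1) by metis
next
  case (Suc i)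
  then obtain b where b: "on_branch T \<sigma> S b" "(b, Suc i) \<in> subdiv"
    using on_branch_subdiv_Suc[of S "edge_at i S" i] by auto
  then show ?case unfolding edge_at_eqI[OF b] by blast
qed

lemma edge_at_Suc:
  assumes "Suc i \<le> N"
  shows "edge_at (Suc i) S = edge_at i S \<or> tcov T (edge_at i S) (edge_at (Suc i) S)"
proof -
  have "on_branch T \<sigma> S (edge_at i S)" "(edge_at i S, i) \<in> subdiv"
    using edge_at[of i S] assms by auto
  from on_branch_subdiv_Suc[OF this assms] obtain b' where b': "on_branch T \<sigma> S b'"
    "(b', Suc i) \<in> subdiv" "b' = edge_at i S \<or> inner T (edge_at i S) \<and> b' = \<sigma> (edge_at i S) S"
    by blast
  show ?thesis unfolding edge_at_eqI[OF b'(1,2)] using b'(3) nice_\<sigma>(1)[OF nice] by blast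
qed

text \<open>All indices read by \<open>\<sigma>\<close> belong to \<open>J\<close>, and a choice
  made before level \<open>i\<close> reads only values below \<open>u i\<close>. So the grid vertex
  records enough to determine its image, and \<open>trace\<close> may use the recorded set in place
  of \<open>S\<close>.\<close>

lemma edge_at_low:
  assumes "i \<le> N" "S \<inter> low J (u i) = S' \<inter> low J (u i)"
  shows "edge_at i S = edge_at i S'"
proof -
  note e = edge_at[OF assms(1), of S]
  have "on_branch T \<sigma> S' (edge_at i S)"
    by (rule on_branch_cong[OF nice, of S _ "u i"]) (use e assms J0 in \<open>auto simp: low_def\<close>)
  from edge_at_eqI[OF this conjunct2[OF e]] show ?thesis by (rule sym)
qed

definition trace :: "nat \<Rightarrow> nat" where
  "trace n = prod_encode (edge_at (fst (dec n)) (snd (dec n)), fst (dec n))"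

lemma trace_enc:
  assumes "i \<le> N"
  shows "trace (enc (i, S \<inter> low J (u i))) = prod_encode (edge_at i S, i)"
proof -
  have "dec (enc (i, S \<inter> low J (u i))) = (i, S \<inter> low J (u i))"
    by (rule dec_enc_grid[OF grid]) (use assms in \<open>auto simp: grid_verts_def\<close>)
  moreover have "edge_at i (S \<inter> low J (u i)) = edge_at i S" using assms by (intro edge_at_low) auto
  ultimately show ?thesis by (simp add: trace_def)
qed

lemma covers_subdiv_Suc:
  assumes "(b, i) \<in> subdiv" "(b', Suc i) \<in> subdiv" "tree_le T b b'"
  shows "covers subdiv (pair_le T) (b, i) (b', Suc i)"
proof (rule coversI)
  fix z assume z: "z \<in> subdiv" "pair_le T (b, i) z" "pair_le T z (b', Suc i)"
  obtain c k where ck: "z = (c, k)" by (cases z)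
  have le: "tree_le T b c" "tree_le T c b'" "k = i \<or> k = Suc i"
    using z unfolding ck pair_le_def by auto
  have "k = i \<Longrightarrow> c = b" "k = Suc i \<Longrightarrow> c = b'"
    using subdiv_strict[OF assms(1), of c k] subdiv_strict[OF _ assms(2), of c k] le z unfolding ck by auto
  then show "z = (b, i) \<or> z = (b', Suc i)" using le ck by auto
qed (use assms in \<open>auto simp: pair_le_def\<close>)

lemma edge_at_verts: "i \<le> N \<Longrightarrow> edge_at i S \<in> verts T"
  using edge_at by blast

text \<open>\<open>trace\<close> keeps levels, so it collapses no edge. A child of the image lies
  one level up, on the same stretch or on that of a child \<open>b'\<close> of \<open>b\<close>. In
  the second case the indices selecting \<open>b'\<close> have the value \<open>L b\<close>, which
  lies between the two grid heights, so they can be added without changing what level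
  \<open>i\<close> records.\<close>

lemma tree_covering_trace: "tree_covering (grid_tree u N J) (pair_tree T subdiv) trace"
proof -
  have tro: "tree_order subdiv (pair_le T) (root T, 0)"
    by (rule tree_order_subdiv[OF order_refl subdiv_root(1)])
  show ?thesis
    unfolding tree_covering_def tcov_pair_tree[OF tro] tcov_grid_tree[OF grid]
  proof (intro conjI allI impI ballI)
    have "edge_at 0 {} = root T" by (rule edge_at_eqI[OF on_branch.root subdiv_root(1)])
    then show "trace (root (grid_tree u N J)) = root (pair_tree T subdiv)"
      using trace_enc[of 0 "{}"] by (simp add: root_grid_tree[OF grid] pair_tree_def)
  next
    fix x y assume "\<exists>i S. i < N \<and> S \<subseteq> low J (u (Suc i)) \<and> x = enc (i, S \<inter> low J (u i)) \<and> y = enc (Suc i, S)"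
    then obtain i S where *: "i < N" "S \<subseteq> low J (u (Suc i))" "x = enc (i, S \<inter> low J (u i))" "y = enc (Suc i, S)"
      by blast
    then have x: "trace x = prod_encode (edge_at i S, i)"
      and y: "trace y = prod_encode (edge_at (Suc i) S, Suc i)"
      using trace_enc[of i S] trace_enc[of "Suc i" S] by (auto simp: Int_absorb2)
    have "edge_at i S = edge_at (Suc i) S \<or> tcov T (edge_at i S) (edge_at (Suc i) S)"
      using edge_at_Suc[of i S] * by auto
    then have "tree_le T (edge_at i S) (edge_at (Suc i) S)"
      using covD(4) le_refl edge_at_verts[of i S] * by auto
    then have "covers subdiv (pair_le T) (edge_at i S, i) (edge_at (Suc i) S, Suc i)"
      using edge_at[of i S] edge_at[of "Suc i" S] * by (intro covers_subdiv_Suc) auto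
    then show "covers subdiv (pair_le T) (prod_decode (trace x)) (prod_decode (trace y))"
      unfolding x y by simp
  next
    interpret B: tree_order subdiv "pair_le T" "(root T, 0)" by (rule tro)
    fix x c assume x: "x \<in> verts (grid_tree u N J)"
      and c: "covers subdiv (pair_le T) (prod_decode (trace x)) (prod_decode c)"
    from x obtain i S where iS: "x = enc (i, S)" "i \<le> N" "S \<subseteq> low J (u i)"
      unfolding verts_grid_tree[OF grid] grid_verts_def by auto
    define b where "b = edge_at i S"
    have tx: "prod_decode (trace x) = (b, i)"
      using trace_enc[OF iS(2), of S] iS by (simp add: b_def Int_absorb2)
    have b: "on_branch T \<sigma> S b" "(b, i) \<in> subdiv" using edge_at[OF iS(2), of S] unfolding b_def by auto
    obtain b' i' where c': "prod_decode c = (b', i')" by (cases "prod_decode c")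
    note cD = B.covD[OF c[unfolded tx c']]
    have bb': "tree_le T b b'" "i \<le> i'" using cD by (auto simp: pair_le_def)
    have b'V: "b' \<in> verts T" "i' \<le> N" "u i' \<le> L b'" using cD by auto
    have bV: "b \<in> verts T" using b by auto
    have "i \<noteq> i'" using subdiv_strict[OF cD(1,2)] bb' cD(3) by auto
    then have ii': "i < i'" using bb' by simp
    then have SN: "Suc i \<le> N" using b'V by simp
    have "u (Suc i) \<le> L b'" using grid_mono[OF grid, of "Suc i" i'] ii' b'V by simp
    \<comment> \<open>The vertex of level \<open>Suc i\<close> below \<open>(b', i')\<close> also
      lies above \<open>(b, i)\<close>, so the cover leaves only \<open>i' = Suc i\<close>.\<close>
    then obtain b'' where b'': "tree_le T b'' b'" "(b'', Suc i) \<in> subdiv"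
      using subdiv_ex[OF b'V(1) SN] by blast
    have "tree_le T b b''"
    proof (rule ccontr)
      assume n: "\<not> tree_le T b b''"
      then have "tree_le T b'' b" using down_chain[OF bV _ b'V(1) bb'(1) b''(1)] b'' by auto
      moreover have "b'' \<noteq> b" using n le_refl bV by auto
      ultimately show False using subdiv_strict[OF b''(2) b(2)] by auto
    qed
    then have "(b'', Suc i) = (b, i) \<or> (b'', Suc i) = (b', i')"
      using B.cov_between[OF c[unfolded tx c'] b''(2)] b''(1) ii' by (auto simp: pair_le_def)
    then have i': "i' = Suc i" and b'Suc: "(b', Suc i) \<in> subdiv" using b'' by auto
    have "\<exists>S'. S' \<subseteq> low J (u (Suc i)) \<and> S' \<inter> low J (u i) = S \<and> on_branch T \<sigma> S' b'"
    proof (cases "b' = b")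
      case True
      have "low J (u i) \<subseteq> low J (u (Suc i))" using low_mono[OF grid] grid_mono[OF grid, of i "Suc i"] SN by simp
      then show ?thesis using True b iS by (intro exI[of _ S]) auto
    next
      case False
      obtain e where e: "tcov T b e" "tree_le T e b'"
        using ex_child_below[OF bV b'V(1) bb'(1)] False by metis
      note eV = covD[OF e(1)]
      \<comment> \<open>If \<open>e\<close> were skipped, its stretch would end below
        \<open>u (Suc i)\<close>, although by \<open>M_index\<close> it contains a grid point of a
        level above \<open>i\<close>.\<close>
      have "e = b'"
      proof (rule ccontr)
        assume "e \<noteq> b'"
        then obtain q where q: "tcov T q b'" "tree_le T e q"
          using ex_parent_above[OF eV(2) b'V(1) e(2)] by blast
        have "L e \<le> L q" using nice_le_mono[OF nice covD(1)[OF q(1)]] q(2) by blast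
        also have "L q < u (Suc i)" using b'Suc q(1) by auto
        finally have "L e < u (Suc i)" .
        obtain k where k: "i < k" "k \<le> N" "u k = M e" using M_index[OF e(1) iS(2)] b by auto
        then have "u (Suc i) \<le> M e" using grid_mono[OF grid, of "Suc i" k] by simp
        then show False using \<open>L e < u (Suc i)\<close> nice_M_le_L[OF nice eV(2)] by simp
      qed
      then have bb': "tcov T b b'" using e by simp
      then have inn: "inner T b" by (auto simp: inner_def)
      have Lb: "u i \<le> L b" "L b < u (Suc i)" using b b'Suc bb' by auto
      obtain S0 where S0: "S0 \<subseteq> bits J0 (L b)" "\<sigma> b S0 = b'" using nice_\<sigma>(2)[OF nice bb'] by blast
      define S' where "S' = S \<union> S0"
      have "S0 \<subseteq> low J (u (Suc i))" using S0 Lb J0 by (auto simp: bits_def low_def)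
      moreover have "S \<subseteq> low J (u (Suc i))" using iS Lb by (force simp: low_def)
      moreover have S': "S' \<inter> low J (u i) = S"
        using S0 Lb iS unfolding S'_def by (fastforce simp: bits_def low_def)
      moreover have "on_branch T \<sigma> S' b"
        by (rule on_branch_cong[OF nice b(1), of "u i"])
          (use b S' S0 Lb in \<open>auto simp: S'_def bits_def\<close>)
      then have "on_branch T \<sigma> S' (\<sigma> b S')" using inn by (rule on_branch.step)
      moreover have "S' \<inter> bits J0 (L b) = S0 \<inter> bits J0 (L b)"
        using iS Lb unfolding S'_def by (auto simp: bits_def low_def)
      then have "\<sigma> b S' = b'" using nice_\<sigma>(3)[OF nice inn] S0(2) by metis
      ultimately show ?thesis by (intro exI[of _ S']) (auto simp: S'_def)
    qed
    then obtain S' where S': "S' \<subseteq> low J (u (Suc i))" "S' \<inter> low J (u i) = S" "on_branch T \<sigma> S' b'" by blast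
    have "trace (enc (Suc i, S')) = prod_encode (b', Suc i)"
      using trace_enc[OF SN, of S'] edge_at_eqI[OF S'(3) b'Suc] S'(1) by (simp add: Int_absorb2)
    also have "\<dots> = c" using c' i' by (metis prod_decode_inverse)
    finally have "trace (enc (Suc i, S')) = c" .
    moreover have "i < N" "x = enc (i, S' \<inter> low J (u i))" using SN S' iS by auto
    ultimately show "\<exists>y. (\<exists>i S. i < N \<and> S \<subseteq> low J (u (Suc i)) \<and> x = enc (i, S \<inter> low J (u i)) \<and>
        y = enc (Suc i, S)) \<and> trace y = c"
      using S'(1) by blast
  qed
qed

text \<open>\<open>trace\<close> followed by the contraction of the subdivision. The map respects
  the pairs \<open>(t, S)\<close> because every \<open>M b\<close> is a grid point: whether
  \<open>M b \<le> t\<close> depends only on the cell of \<open>t\<close>.\<close>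

lemma grid_projection:
  "\<exists>p. TCE_map (grid_tree u N J) T p \<and> (\<forall>t\<ge>0. \<forall>S. p (grid_point u N J t S) = vertex_at T M \<sigma> t S)"
proof (intro exI conjI allI impI)
  let ?p = "(collapse \<circ> prod_decode) \<circ> trace"
  have "finite subdiv"
    using tree_order.finite_V[OF tree_order_subdiv[OF order_refl subdiv_root(1)]] .
  then have "simple_confluent (pair_tree T (tops \<union> (subdiv - tops))) T (collapse \<circ> prod_decode)"
    by (intro simple_confluent_subdiv) auto
  then have sub: "simple_confluent (pair_tree T subdiv) T (collapse \<circ> prod_decode)"
    unfolding Un_Diff_cancel Un_absorb1[OF tops_subdiv] .
  have "is_rtree (pair_tree T subdiv)"
    unfolding pair_tree_def
    by (rule is_rtree_order_tree,
        rule tree_order_image[OF tree_order_subdiv[OF order_refl subdiv_root(1)]]) simp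
  then have "simple_confluent (grid_tree u N J) (pair_tree T subdiv) trace"
    using tree_covering_imp_light_confluent[OF is_rtree_grid[OF grid] _ tree_covering_trace]
      simple_confluent.light_confluent by blast
  then have "simple_confluent (grid_tree u N J) T ?p"
    by (rule simple_confluent.comp[OF _ sub]) simp
  moreover have "in_TCE T"
  proof -
    obtain c where c: "tcov T (root T) c" using nice_rtree(4)[OF nice] by (auto simp: inner_def)
    then have "{root T, c} \<subseteq> verts T" "card {root T, c} = 2" using covD by auto
    then have "2 \<le> card (verts T)" using card_mono[OF finite_V] by metis
    then show ?thesis using nice_rtree(1)[OF nice] by (simp add: in_TCE_def)
  qed
  ultimately show "TCE_map (grid_tree u N J) T ?p"
    using in_TCE_grid_tree[OF grid] by (simp add: TCE_map_def)
  fix t :: real and S assume t: "0 \<le> t"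
  define i where "i = level u N t"
  define b where "b = edge_at i S"
  note i = level_props[OF grid t, folded i_def]
  have b: "on_branch T \<sigma> S b" "(b, i) \<in> subdiv" using edge_at[OF i(1), of S] unfolding b_def by auto
  have bV: "b \<in> verts T" "u i \<le> L b" using b by auto
  have above: "t < v" if "k \<le> N" "u k = v" "i < k" for k v
    using i(3) grid_mono[OF grid, of "Suc i" k] that by fastforce
  have "?p (grid_point u N J t S) = collapse (b, i)"
    using trace_enc[OF i(1), of S] by (simp add: grid_point_def b_def flip: i_def)
  also have "at_height T M \<sigma> t S (collapse (b, i))"
  proof (cases "M b \<le> u i")
    case True
    have "t < M (\<sigma> b S)" if "inner T b"
      using M_index[OF nice_\<sigma>(1)[OF nice that] i(1) bV(2), of S] above by blast
    then show ?thesis using b(1) True i by (simp add: collapse_def at_height_def)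
  next
    case False
    have "0 \<le> u i" using grid_mono[OF grid, of 0 i] gridD(2)[OF grid] i(1) by simp
    then have "b \<noteq> root T" using False nice_rtree(5)[OF nice] by auto
    then obtain a where a: "tcov T a b" using ex_parent bV by blast
    note aV = covD[OF a]
    have o: "on_branch T \<sigma> S a" "inner T a" "tree_le T (\<sigma> a S) b"
      using on_branch_le[OF nice b(1) aV(1,4,3)] by auto
    note c = covD[OF nice_\<sigma>(1)[OF nice o(2), of S]]
    have "\<sigma> a S = b" using cov_between[OF a c(2) c(4) o(3)] c(3) by auto
    moreover have "M a \<le> t" using nice_M_le_L[OF nice aV(1)] a b(2) i(2) by fastforce
    moreover have "t < M b"
    proof -
      obtain k where k: "k \<le> N" "u k = M b" using M_grid bV by force
      then have "i < k" using False grid_le_iff[OF grid, of k i] i(1) by auto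
      then show ?thesis using above k by blast
    qed
    ultimately show ?thesis using o False par_eq[OF a] by (simp add: collapse_def at_height_def)
  qed
  then have "collapse (b, i) = vertex_at T M \<sigma> t S" using vertex_at_eqI[OF nice] by metis
  finally show "?p (grid_point u N J t S) = vertex_at T M \<sigma> t S" .
qed

end

end

section \<open>Quotient topologies\<close>

lemma istopology_quotient:
  assumes R: "equiv (topspace X) R"
  shows "istopology (\<lambda>U. U \<subseteq> topspace X // R \<and> openin X (\<Union>U))"
  unfolding istopology_def
proof (intro conjI allI impI)
  fix U V assume U: "U \<subseteq> topspace X // R \<and> openin X (\<Union>U)" and V: "V \<subseteq> topspace X // R \<and> openin X (\<Union>V)"
  then show "U \<inter> V \<subseteq> topspace X // R" by blast
  have "\<Union>(U \<inter> V) = \<Union>U \<inter> \<Union>V" using U V quotient_disj[OF R] by blast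
  then show "openin X (\<Union>(U \<inter> V))" using U V by auto
next
  fix K assume K: "\<forall>U\<in>K. U \<subseteq> topspace X // R \<and> openin X (\<Union>U)"
  then show "\<Union>K \<subseteq> topspace X // R" by blast
  have "\<Union>(\<Union>K) = \<Union>(\<Union> ` K)" by blast
  then show "openin X (\<Union>(\<Union>K))" using K by auto
qed

context
  fixes X :: "'a topology" and R
  assumes R: "equiv (topspace X) R"
begin

lemma openin_quotient_topology:
  "openin (quotient_topology X R) U \<longleftrightarrow> U \<subseteq> topspace X // R \<and> openin X (\<Union>U)"
  unfolding quotient_topology_def topology_inverse'[OF istopology_quotient[OF R]] ..

lemma topspace_quotient_topology: "topspace (quotient_topology X R) = topspace X // R"
proof -
  have "openin (quotient_topology X R) (topspace X // R)"
    unfolding openin_quotient_topology Union_quotient[OF R] by simp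
  moreover have "topspace (quotient_topology X R) \<subseteq> topspace X // R"
    using openin_topspace[of "quotient_topology X R"] unfolding openin_quotient_topology by blast
  ultimately show ?thesis using openin_subset by blast
qed

lemma Union_quotient_saturated:
  assumes "A \<subseteq> topspace X" "\<And>p q. (p, q) \<in> R \<Longrightarrow> p \<in> A \<Longrightarrow> q \<in> A"
  shows "\<Union>(A // R) = A"
proof (intro equalityI subsetI)
  fix p assume "p \<in> \<Union>(A // R)"
  then show "p \<in> A" using assms(2) unfolding quotient_def by blast
next
  fix p assume "p \<in> A"
  then have "p \<in> R `` {p}" "R `` {p} \<in> A // R"
    using assms(1) equiv_class_self[OF R] by (auto intro: quotientI)
  then show "p \<in> \<Union>(A // R)" by blast
qed

lemma openin_quotient_saturated:
  assumes "openin X A" "\<And>p q. (p, q) \<in> R \<Longrightarrow> p \<in> A \<Longrightarrow> q \<in> A"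
  shows "openin (quotient_topology X R) (A // R)"
proof -
  have "A \<subseteq> topspace X" using assms openin_subset by blast
  moreover from this have "A // R \<subseteq> topspace X // R" unfolding quotient_def by blast
  ultimately show ?thesis
    unfolding openin_quotient_topology using Union_quotient_saturated assms by simp
qed

lemma continuous_map_quotient_class: "continuous_map X (quotient_topology X R) (\<lambda>x. R `` {x})"
  unfolding continuous_map_def topspace_quotient_topology
proof (intro conjI allI impI)
  show "(\<lambda>x. R `` {x}) \<in> topspace X \<rightarrow> topspace X // R" by (auto simp: quotientI)
  fix U assume "openin (quotient_topology X R) U"
  then have U: "U \<subseteq> topspace X // R" "openin X (\<Union>U)" by (auto simp: openin_quotient_topology)
  have "{x \<in> topspace X. R `` {x} \<in> U} = \<Union>U"
  proof (intro equalityI subsetI)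
    fix x assume "x \<in> {x \<in> topspace X. R `` {x} \<in> U}"
    then show "x \<in> \<Union>U" using equiv_class_self[OF R] by blast
  next
    fix x assume "x \<in> \<Union>U"
    then obtain C where C: "C \<in> U" "x \<in> C" by blast
    then obtain z where z: "z \<in> topspace X" "C = R `` {z}" using U by (auto elim!: quotientE)
    then have "R `` {x} = C" using C equiv_class_eq[OF R, of z x] by auto
    then show "x \<in> {x \<in> topspace X. R `` {x} \<in> U}" using C openin_subset[OF U(2)] by auto
  qed
  then show "openin X {x \<in> topspace X. R `` {x} \<in> U}" using U by simp
qed

text \<open>A continuous surjection from a compact to a Hausdorff space is closed, hence a quotient
  map. The induced map on classes is then a quotient map as well, and it is injective by
  \<open>ker\<close>.\<close>

lemma quotient_topology_homeomorphic:
  assumes X: "compact_space X" and Y: "Hausdorff_space Y" and f: "continuous_map X Y f"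
    and surj: "f ` topspace X = topspace Y"
    and ker: "\<And>x y. x \<in> topspace X \<Longrightarrow> y \<in> topspace X \<Longrightarrow> (x, y) \<in> R \<longleftrightarrow> f x = f y"
  shows "quotient_topology X R homeomorphic_space Y"
proof -
  let ?Q = "quotient_topology X R" and ?q = "\<lambda>x. R `` {x}"
  define g where "g C = f (SOME x. x \<in> C)" for C
  have gq: "g (?q x) = f x" if x: "x \<in> topspace X" for x
  proof -
    have "x \<in> ?q x" using equiv_class_self[OF R x] .
    then have "(SOME z. z \<in> ?q x) \<in> ?q x" by (rule someI)
    then have xz: "(x, SOME z. z \<in> ?q x) \<in> R" by blast
    moreover have "(SOME z. z \<in> ?q x) \<in> topspace X" using xz equiv_type[OF R] by blast
    ultimately show ?thesis using ker x unfolding g_def by metis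
  qed
  have img: "?q ` topspace X = topspace ?Q"
    unfolding topspace_quotient_topology quotient_def by blast
  have cf: "closed_map X Y f" using continuous_imp_closed_map X Y f by blast
  have qf: "quotient_map X Y f" using continuous_closed_imp_quotient_map[OF f cf surj] .
  have "quotient_map X Y (g \<circ> ?q)"
    using qf by (rule quotient_map_eq) (simp add: gq)
  moreover have cg: "continuous_map ?Q Y g"
    unfolding continuous_map_def topspace_quotient_topology
  proof (intro conjI allI impI)
    show "g \<in> topspace X // R \<rightarrow> topspace Y" using gq surj by (auto elim!: quotientE)
    fix U assume U: "openin Y U"
    have "{C \<in> topspace X // R. g C \<in> U} = {x \<in> topspace X. f x \<in> U} // R"
      unfolding quotient_def using gq by auto
    moreover have "openin ?Q ({x \<in> topspace X. f x \<in> U} // R)"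
    proof (rule openin_quotient_saturated)
      show "openin X {x \<in> topspace X. f x \<in> U}" using f U openin_continuous_map_preimage by blast
      fix p q assume "(p, q) \<in> R" "p \<in> {x \<in> topspace X. f x \<in> U}"
      moreover from this have "q \<in> topspace X" using equiv_type[OF R] by blast
      ultimately show "q \<in> {x \<in> topspace X. f x \<in> U}" using ker by auto
    qed
    ultimately show "openin ?Q {C \<in> topspace X // R. g C \<in> U}" by simp
  qed
  ultimately have "quotient_map ?Q Y g"
    using quotient_map_from_composition continuous_map_quotient_class by blast
  moreover have "inj_on g (topspace ?Q)"
  proof (rule inj_onI)
    fix C C' assume "C \<in> topspace ?Q" "C' \<in> topspace ?Q" and e: "g C = g C'"
    then obtain x y where "x \<in> topspace X" "C = ?q x" "y \<in> topspace X" "C' = ?q y"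
      unfolding img[symmetric] by blast
    then show "C = C'" using e gq ker equiv_class_eq[OF R] by metis
  qed
  ultimately have "homeomorphic_map ?Q Y g" by (simp add: homeomorphic_map_def)
  then show ?thesis using homeomorphic_map_imp_homeomorphic_space by blast
qed

end

section \<open>The Mohler-Nikiel dendroid\<close>

lemma MN_rel_iff:
  "((t, s), (t', s')) \<in> MN_rel d n \<longleftrightarrow> t = t' \<and> t \<in> {0..1} \<and> length s = n \<and> length s' = n \<and>
     (\<forall>j<n. s ! j = s' ! j \<or> t \<le> d (Suc j))"
proof (induction n arbitrary: s s')
  case 0
  then show ?case by auto
next
  case (Suc n)
  show ?case
  proof (cases "length s = Suc n \<and> length s' = Suc n")
    case True
    then obtain r i r' i' where s: "s = r @ [i]" "s' = r' @ [i']" "length r = n" "length r' = n"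
      by (metis length_Suc_conv_rev)
    have "((t, s), (t', s')) \<in> MN_rel d (Suc n) \<longleftrightarrow>
        ((t, r), (t', r')) \<in> MN_rel d n \<and> (i = i' \<or> t \<le> d (Suc n))"
      unfolding s by auto
    then show ?thesis unfolding Suc.IH s using s(3,4) by (auto simp: nth_append less_Suc_eq)
  next
    case False
    have "((t, s), (t', s')) \<notin> MN_rel d (Suc n)"
    proof
      assume "((t, s), (t', s')) \<in> MN_rel d (Suc n)"
      then obtain r i r' i' where "s = r @ [i]" "s' = r' @ [i']" "((t, r), (t', r')) \<in> MN_rel d n" by auto
      then show False using False unfolding Suc.IH by simp
    qed
    then show ?thesis using False by blast
  qed
qed

declare MN_rel.simps [simp del]

lemma topspace_MN_pre: "topspace (MN_pre n) = {0..1} \<times> {s. length s = n}"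
  by (auto simp: MN_pre_def)

lemma equiv_MN_rel: "equiv (topspace (MN_pre n)) (MN_rel d n)"
proof (rule equivI)
  show "MN_rel d n \<subseteq> topspace (MN_pre n) \<times> topspace (MN_pre n)"
    by (auto simp: topspace_MN_pre MN_rel_iff)
  show "refl_on (topspace (MN_pre n)) (MN_rel d n)"
    by (auto simp: refl_on_def topspace_MN_pre MN_rel_iff)
  show "sym (MN_rel d n)" by (rule symI) (auto simp: MN_rel_iff)
  show "trans (MN_rel d n)" by (rule transI, clarsimp simp: MN_rel_iff, metis)
qed

text \<open>The second factor is discrete, so openness is tested on each slice with \<open>s\<close>
  fixed.\<close>

lemma openin_MN_pre:
  "openin (MN_pre n) A \<longleftrightarrow> A \<subseteq> topspace (MN_pre n) \<and>
    (\<forall>t s. (t, s) \<in> A \<longrightarrow> (\<exists>e>0. \<forall>t'\<in>{0..1}. \<bar>t' - t\<bar> < e \<longrightarrow> (t', s) \<in> A))"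
proof (intro iffI conjI allI impI)
  assume A: "openin (MN_pre n) A"
  show "A \<subseteq> topspace (MN_pre n)" using A openin_subset by blast
  fix t s assume ts: "(t, s) \<in> A"
  obtain B where B: "openin (prod_topology euclideanreal (discrete_topology UNIV)) B"
    "A = B \<inter> {(t, s). t \<in> {0..1} \<and> length s = n}"
    using A unfolding MN_pre_def openin_subtopology by blast
  obtain U V where UV: "open U" "t \<in> U" "s \<in> V" "U \<times> V \<subseteq> B"
    using B ts unfolding openin_prod_topology_alt by (metis IntD1 open_openin)
  then obtain e where "e > 0" "\<And>t'. dist t' t < e \<Longrightarrow> t' \<in> U" unfolding open_dist by blast
  then show "\<exists>e>0. \<forall>t'\<in>{0..1}. \<bar>t' - t\<bar> < e \<longrightarrow> (t', s) \<in> A"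
    using UV ts unfolding B(2) by (intro exI[of _ e]) (auto simp: dist_real_def)
next
  assume A: "A \<subseteq> topspace (MN_pre n) \<and>
    (\<forall>t s. (t, s) \<in> A \<longrightarrow> (\<exists>e>0. \<forall>t'\<in>{0..1}. \<bar>t' - t\<bar> < e \<longrightarrow> (t', s) \<in> A))"
  then obtain e where e: "\<And>t s. (t, s) \<in> A \<Longrightarrow> e t s > 0"
    "\<And>t s t'. (t, s) \<in> A \<Longrightarrow> t' \<in> {0..1} \<Longrightarrow> \<bar>t' - t\<bar> < e t s \<Longrightarrow> (t', s) \<in> A" by metis
  define B where "B = (\<Union>(t, s)\<in>A. ball t (e t s) \<times> {s})"
  have "openin (prod_topology euclideanreal (discrete_topology UNIV)) B"
    unfolding B_def by (intro openin_Union) (auto simp: openin_prod_Times_iff)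
  moreover have "A = B \<inter> {(t, s). t \<in> {0..1} \<and> length s = n}"
  proof (intro equalityI subsetI)
    fix p assume p: "p \<in> A"
    obtain t s where ts: "p = (t, s)" by (cases p)
    have "p \<in> ball t (e t s) \<times> {s}" using p e(1)[of t s] ts by simp
    then have "p \<in> B" using p ts unfolding B_def by blast
    then show "p \<in> B \<inter> {(t, s). t \<in> {0..1} \<and> length s = n}"
      using A p unfolding topspace_MN_pre by auto
  next
    fix p assume "p \<in> B \<inter> {(t, s). t \<in> {0..1} \<and> length s = n}"
    then show "p \<in> A" using e(2) unfolding B_def
      by (auto simp: dist_real_def abs_minus_commute)
  qed
  ultimately show "openin (MN_pre n) A" unfolding MN_pre_def openin_subtopology by blast
qed

text \<open>Two classes differ in height or, at a common height \<open>t\<close>, in a bit with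
  \<open>d (Suc j) < t\<close>. The sets of points below or above a height, and of points above
  \<open>d (Suc j)\<close> with a prescribed bit, are open and saturated, because gluing keeps
  heights and changes that bit only up to \<open>d (Suc j)\<close>.\<close>

lemma Hausdorff_MN_Y: "Hausdorff_space (MN_Y d n)"
  unfolding Hausdorff_space_def
proof (intro allI impI)
  let ?R = "MN_rel d n"
  note R = equiv_MN_rel[of n d]
  fix C C' assume C: "C \<in> topspace (MN_Y d n) \<and> C' \<in> topspace (MN_Y d n) \<and> C \<noteq> C'"
  obtain t s where ts: "(t, s) \<in> topspace (MN_pre n)" "C = ?R `` {(t, s)}"
    using C unfolding MN_Y_def topspace_quotient_topology[OF R] by (auto elim!: quotientE)
  obtain t' s' where ts': "(t', s') \<in> topspace (MN_pre n)" "C' = ?R `` {(t', s')}"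
    using C unfolding MN_Y_def topspace_quotient_topology[OF R] by (auto elim!: quotientE)
  have sep: "\<exists>U V. openin (MN_Y d n) U \<and> openin (MN_Y d n) V \<and> C \<in> U \<and> C' \<in> V \<and> disjnt U V"
    if A: "openin (MN_pre n) A" "\<And>p q. (p, q) \<in> ?R \<Longrightarrow> p \<in> A \<Longrightarrow> q \<in> A" "(t, s) \<in> A"
      and B: "openin (MN_pre n) B" "\<And>p q. (p, q) \<in> ?R \<Longrightarrow> p \<in> B \<Longrightarrow> q \<in> B" "(t', s') \<in> B"
      and AB: "A \<inter> B = {}" for A B
  proof (intro exI conjI)
    show "openin (MN_Y d n) (A // ?R)" "openin (MN_Y d n) (B // ?R)"
      unfolding MN_Y_def using openin_quotient_saturated[OF R] A B by blast+
    show "C \<in> A // ?R" "C' \<in> B // ?R" using A B ts ts' by (auto intro: quotientI)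
    have "A \<subseteq> topspace (MN_pre n)" "B \<subseteq> topspace (MN_pre n)" using A B openin_subset by blast+
    then have "\<Union>(A // ?R) = A" "\<Union>(B // ?R) = B" using Union_quotient_saturated[OF R] A B by blast+
    moreover have "E \<noteq> {}" if "E \<in> A // ?R" for E
      using that \<open>A \<subseteq> topspace (MN_pre n)\<close> equiv_class_self[OF R] by (fastforce elim!: quotientE)
    ultimately show "disjnt (A // ?R) (B // ?R)" using AB unfolding disjnt_iff by blast
  qed
  have half: "openin (MN_pre n) {(t, s). (t, s) \<in> topspace (MN_pre n) \<and> t < c}"
    "openin (MN_pre n) {(t, s). (t, s) \<in> topspace (MN_pre n) \<and> c < t \<and> P s}" for c P
  proof -
    show "openin (MN_pre n) {(t, s). (t, s) \<in> topspace (MN_pre n) \<and> t < c}"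
      unfolding openin_MN_pre
    proof (intro conjI allI impI)
      fix t s assume "(t, s) \<in> {(t, s). (t, s) \<in> topspace (MN_pre n) \<and> t < c}"
      then show "\<exists>e>0. \<forall>t'\<in>{0..1}. \<bar>t' - t\<bar> < e \<longrightarrow> (t', s) \<in> {(t, s). (t, s) \<in> topspace (MN_pre n) \<and> t < c}"
        by (intro exI[of _ "c - t"]) (auto simp: topspace_MN_pre)
    qed auto
    show "openin (MN_pre n) {(t, s). (t, s) \<in> topspace (MN_pre n) \<and> c < t \<and> P s}"
      unfolding openin_MN_pre
    proof (intro conjI allI impI)
      fix t s assume "(t, s) \<in> {(t, s). (t, s) \<in> topspace (MN_pre n) \<and> c < t \<and> P s}"
      then show "\<exists>e>0. \<forall>t'\<in>{0..1}. \<bar>t' - t\<bar> < e \<longrightarrow>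
          (t', s) \<in> {(t, s). (t, s) \<in> topspace (MN_pre n) \<and> c < t \<and> P s}"
        by (intro exI[of _ "t - c"]) (auto simp: topspace_MN_pre)
    qed auto
  qed
  have "((t, s), (t', s')) \<notin> ?R" using C ts ts' equiv_class_eq[OF R] by metis
  then consider "t < t'" | "t' < t" | j where "t = t'" "j < n" "s ! j \<noteq> s' ! j" "d (Suc j) < t"
    using ts(1) ts'(1) unfolding MN_rel_iff topspace_MN_pre by fastforce
  then show "\<exists>U V. openin (MN_Y d n) U \<and> openin (MN_Y d n) V \<and> C \<in> U \<and> C' \<in> V \<and> disjnt U V"
  proof cases
    case 1
    then obtain c where "t < c" "c < t'" using dense by blast
    then show ?thesis using ts ts'
      by (intro sep[OF half(1)[of c] _ _ half(2)[of c "\<lambda>_. True"]]) (auto simp: MN_rel_iff topspace_MN_pre)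
  next
    case 2
    then obtain c where "t' < c" "c < t" using dense by blast
    then show ?thesis using ts ts'
      by (intro sep[OF half(2)[of c "\<lambda>_. True"] _ _ half(1)[of c]]) (auto simp: MN_rel_iff topspace_MN_pre)
  next
    case 3
    then show ?thesis using ts ts'
      by (intro sep[OF half(2)[of "d (Suc j)" "\<lambda>r. r ! j = s ! j"] _ _
            half(2)[of "d (Suc j)" "\<lambda>r. r ! j = s' ! j"]])
        (fastforce simp: MN_rel_iff topspace_MN_pre)+
  qed
qed

text \<open>The sequence starts at index \<open>1\<close> and lists at position \<open>0\<close>, so
  position \<open>j\<close> stores the index \<open>Suc j\<close>.\<close>

definition bit_list :: "nat \<Rightarrow> nat set \<Rightarrow> bool list" where
  "bit_list n S = map (\<lambda>j. Suc j \<in> S) [0..<n]"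

lemma bit_list_simps [simp]: "length (bit_list n S) = n" "j < n \<Longrightarrow> bit_list n S ! j \<longleftrightarrow> Suc j \<in> S"
  by (auto simp: bit_list_def)

definition MN_point :: "(nat \<Rightarrow> real) \<Rightarrow> real \<Rightarrow> nat set \<Rightarrow> nat \<Rightarrow> (real \<times> bool list) set" where
  "MN_point d t S n = MN_rel d n `` {(t, bit_list n S)}"

lemma MN_point_eq_iff:
  assumes "t \<in> {0..1}" "t' \<in> {0..1}"
  shows "MN_point d t S = MN_point d t' S' \<longleftrightarrow> t = t' \<and> (\<forall>j\<ge>1. d j < t \<longrightarrow> (j \<in> S \<longleftrightarrow> j \<in> S'))"
proof -
  have "MN_point d t S n = MN_point d t' S' n \<longleftrightarrow> ((t, bit_list n S), (t', bit_list n S')) \<in> MN_rel d n" for n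
    unfolding MN_point_def using assms
    by (intro eq_equiv_class_iff[OF equiv_MN_rel]) (auto simp: topspace_MN_pre)
  then have "MN_point d t S = MN_point d t' S' \<longleftrightarrow>
      t = t' \<and> (\<forall>n. \<forall>j<n. (Suc j \<in> S) = (Suc j \<in> S') \<or> t \<le> d (Suc j))"
    using assms by (auto simp: fun_eq_iff MN_rel_iff)
  also have "\<dots> \<longleftrightarrow> t = t' \<and> (\<forall>j. (Suc j \<in> S) = (Suc j \<in> S') \<or> t \<le> d (Suc j))" by blast
  also have "\<dots> \<longleftrightarrow> t = t' \<and> (\<forall>j\<ge>1. d j < t \<longrightarrow> (j \<in> S \<longleftrightarrow> j \<in> S'))"
    by (metis One_nat_def Suc_le_D Suc_le_eq linorder_not_less zero_less_Suc)
  finally show ?thesis .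
qed

lemma topspace_MN_dendroid:
  "topspace (MN_dendroid d) = {MN_point d t S | t S. t \<in> {0..1}}"
proof -
  have top: "topspace (MN_Y d n) = topspace (MN_pre n) // MN_rel d n" for n
    unfolding MN_Y_def by (rule topspace_quotient_topology[OF equiv_MN_rel])
  have T: "topspace (MN_dendroid d) = {y. \<forall>n. y n \<in> topspace (MN_Y d n) \<and> MN_g n (y (Suc n)) = y n}"
    unfolding MN_dendroid_def by auto
  show ?thesis
  proof (intro equalityI subsetI)
    fix y assume "y \<in> topspace (MN_dendroid d)"
    then have y: "y n \<in> topspace (MN_Y d n)" "MN_g n (y (Suc n)) = y n" for n unfolding T by auto
    have "\<exists>t s. t \<in> {0..1} \<and> length s = n \<and> y n = MN_rel d n `` {(t, s)}" for n
      using y(1)[of n] unfolding top topspace_MN_pre by (auto elim!: quotientE)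
    then obtain t s where ts: "\<And>n. t n \<in> {0..1}" "\<And>n. length (s n) = n"
      "\<And>n. y n = MN_rel d n `` {(t n, s n)}" by metis
    have step: "((t n, s n), (t (Suc n), take n (s (Suc n)))) \<in> MN_rel d n" for n
    proof -
      have "(t (Suc n), s (Suc n)) \<in> y (Suc n)"
        unfolding ts(3)[of "Suc n"] using ts(1,2)[of "Suc n"] by (simp add: MN_rel_iff)
      then have "(t (Suc n), take n (s (Suc n))) \<in> y n"
        unfolding y(2)[of n, symmetric] MN_g_def by force
      then show ?thesis unfolding ts(3)[of n] by simp
    qed
    have t0: "t n = t 0" for n
    proof (induction n)
      case (Suc n)
      then show ?case using step[of n] unfolding MN_rel_iff by simp
    qed simp
    \<comment> \<open>The representatives \<open>s n\<close> are chosen independently of each other;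
      only bits with \<open>d (Suc j) < t 0\<close> are forced to agree.\<close>
    have stable: "s n ! j = s (Suc j) ! j" if "j < n" "d (Suc j) < t 0" for n j
      using that(1)
    proof (induction n)
      case (Suc n)
      show ?case
      proof (cases "j = n")
        case False
        then have "j < n" using Suc by simp
        then have "s n ! j = take n (s (Suc n)) ! j"
          using step[of n] that(2) t0[of n] unfolding MN_rel_iff by fastforce
        then show ?thesis using Suc \<open>j < n\<close> by simp
      qed simp
    qed simp
    \<comment> \<open>Index \<open>j\<close> sits at position \<open>j - 1\<close>, and
      \<open>s j\<close> is the first list long enough to contain it.\<close>
    define S where "S = {j. 1 \<le> j \<and> s j ! (j - 1)}"
    have "y n = MN_point d (t 0) S n" for n
      unfolding MN_point_def ts(3) t0[of n]
    proof (rule equiv_class_eq[OF equiv_MN_rel])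
      show "((t 0, s n), (t 0, bit_list n S)) \<in> MN_rel d n"
        unfolding MN_rel_iff using ts stable[of _ n] by (fastforce simp: S_def)
    qed
    then show "y \<in> {MN_point d t S | t S. t \<in> {0..1}}" using ts(1)[of 0] by blast
  next
    fix y assume "y \<in> {MN_point d t S | t S. t \<in> {0..1}}"
    then obtain t S where y: "y = MN_point d t S" "t \<in> {0..1}" by blast
    show "y \<in> topspace (MN_dendroid d)"
      unfolding T mem_Collect_eq
    proof (intro allI conjI)
      fix n
      show "y n \<in> topspace (MN_Y d n)"
        unfolding top y MN_point_def using y by (intro quotientI) (simp add: topspace_MN_pre)
      show "MN_g n (y (Suc n)) = y n"
      proof (intro equalityI subsetI)
        fix p assume "p \<in> MN_g n (y (Suc n))"
        then obtain q where q: "q \<in> y (Suc n)" "p = (fst q, take n (snd q))"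
          unfolding MN_g_def by (auto simp: case_prod_beta)
        obtain t' r where "q = (t', r)" by (cases q)
        then have r: "((t, bit_list (Suc n) S), (t, r)) \<in> MN_rel d (Suc n)" "p = (t, take n r)"
          using q unfolding y MN_point_def by (auto simp: MN_rel_iff)
        then show "p \<in> y n" unfolding y MN_point_def by (auto simp: MN_rel_iff)
      next
        fix p assume "p \<in> y n"
        moreover obtain t' r where "p = (t', r)" by (cases p)
        ultimately have r: "((t, bit_list n S), (t, r)) \<in> MN_rel d n" "p = (t, r)"
          unfolding y MN_point_def by (auto simp: MN_rel_iff)
        then have "(t, r @ [Suc n \<in> S]) \<in> y (Suc n)"
          unfolding y MN_point_def by (auto simp: MN_rel_iff nth_append less_Suc_eq)
        moreover have "p = (\<lambda>(t, s). (t, take n s)) (t, r @ [Suc n \<in> S])"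
          using r by (auto simp: MN_rel_iff)
        ultimately show "p \<in> MN_g n (y (Suc n))" unfolding MN_g_def by (rule image_eqI[rotated])
      qed
    qed
  qed
qed

lemma Hausdorff_MN_dendroid: "Hausdorff_space (MN_dendroid d)"
  unfolding MN_dendroid_def
  by (intro Hausdorff_space_subtopology) (simp add: Hausdorff_space_product_topology Hausdorff_MN_Y)

text \<open>A criterion that separates the topology from the trees: a height and a set of bits, of
  which only those with \<open>d j < ht x\<close> count, suffice to recognize the dendroid as a
  quotient of a compact space.\<close>

lemma quotient_homeomorphic_MN_dendroid:
  fixes X :: "'a topology" and ht :: "'a \<Rightarrow> real" and bs :: "'a \<Rightarrow> nat set"
  assumes X: "compact_space X"
    and ht: "\<And>x. x \<in> topspace X \<Longrightarrow> ht x \<in> {0..1}"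
    and surj: "\<And>t S. t \<in> {0..1} \<Longrightarrow>
      \<exists>x\<in>topspace X. ht x = t \<and> (\<forall>j\<ge>1. d j < t \<longrightarrow> (j \<in> bs x \<longleftrightarrow> j \<in> S))"
    and cont: "\<And>x e n. x \<in> topspace X \<Longrightarrow> 0 < e \<Longrightarrow> \<exists>W. openin X W \<and> x \<in> W \<and>
      (\<forall>y\<in>W. \<bar>ht y - ht x\<bar> < e \<and> (\<forall>j. 1 \<le> j \<and> j \<le> n \<and> d j < ht x \<longrightarrow> (j \<in> bs y \<longleftrightarrow> j \<in> bs x)))"
    and R: "\<And>x y. (x, y) \<in> R \<longleftrightarrow> x \<in> topspace X \<and> y \<in> topspace X \<and> ht x = ht y \<and>
      (\<forall>j\<ge>1. d j < ht x \<longrightarrow> (j \<in> bs x \<longleftrightarrow> j \<in> bs y))"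
  shows "quotient_topology X R homeomorphic_space MN_dendroid d"
proof -
  define f where "f x = MN_point d (ht x) (bs x)" for x
  have ker: "(x, y) \<in> R \<longleftrightarrow> f x = f y" if "x \<in> topspace X" "y \<in> topspace X" for x y
    unfolding f_def R MN_point_eq_iff[OF ht[OF that(1)] ht[OF that(2)]] using that by simp
  have "equiv (topspace X) R"
  proof (rule equivI)
    show "R \<subseteq> topspace X \<times> topspace X" using R by auto
    show "refl_on (topspace X) R" using R by (auto simp: refl_on_def)
    show "sym R" by (rule symI) (auto simp: R)
    show "trans R" by (rule transI) (auto simp: R)
  qed
  then show ?thesis
  proof (rule quotient_topology_homeomorphic[OF _ X Hausdorff_MN_dendroid])
    show "f ` topspace X = topspace (MN_dendroid d)"
      unfolding topspace_MN_dendroid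
    proof (intro equalityI subsetI)
      fix y assume "y \<in> {MN_point d t S | t S. t \<in> {0..1}}"
      then obtain t S where y: "y = MN_point d t S" "t \<in> {0..1}" by blast
      then obtain x where x: "x \<in> topspace X" "ht x = t" "\<forall>j\<ge>1. d j < t \<longrightarrow> (j \<in> bs x \<longleftrightarrow> j \<in> S)"
        using surj by blast
      then have "f x = y" unfolding f_def y using y(2) by (subst MN_point_eq_iff) auto
      then show "y \<in> f ` topspace X" using x by blast
    qed (use ht f_def in blast)
    have comp: "continuous_map X (MN_Y d n) (\<lambda>x. f x n)" for n
      unfolding continuous_map_def
    proof (intro conjI allI impI)
      let ?R = "MN_rel d n"
      note E = equiv_MN_rel[of n d]
      have top: "topspace (MN_Y d n) = topspace (MN_pre n) // ?R"
        unfolding MN_Y_def by (rule topspace_quotient_topology[OF E])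
      have pre: "(ht x, bit_list n S) \<in> topspace (MN_pre n)" if "x \<in> topspace X" for x S
        using ht[OF that] by (simp add: topspace_MN_pre)
      show "(\<lambda>x. f x n) \<in> topspace X \<rightarrow> topspace (MN_Y d n)"
        unfolding top f_def MN_point_def using pre by (auto intro: quotientI)
      fix U assume "openin (MN_Y d n) U"
      then have U: "U \<subseteq> topspace (MN_pre n) // ?R" "openin (MN_pre n) (\<Union>U)"
        unfolding MN_Y_def openin_quotient_topology[OF E] by auto
      have memU: "?R `` {p} \<in> U \<longleftrightarrow> p \<in> \<Union>U" if p: "p \<in> topspace (MN_pre n)" for p
      proof
        assume "p \<in> \<Union>U"
        then obtain C where C: "C \<in> U" "p \<in> C" by blast
        then obtain q where "C = ?R `` {q}" using U by (auto elim!: quotientE)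
        then have "?R `` {p} = C" using C equiv_class_eq[OF E, of q p] by auto
        then show "?R `` {p} \<in> U" using C by simp
      qed (use equiv_class_self[OF E p] in blast)
      show "openin X {x \<in> topspace X. f x n \<in> U}"
      proof (subst openin_subopen, intro ballI)
        fix x assume "x \<in> {x \<in> topspace X. f x n \<in> U}"
        then have x: "x \<in> topspace X" "?R `` {(ht x, bit_list n (bs x))} \<in> U"
          by (auto simp: f_def MN_point_def)
        \<comment> \<open>Bits with \<open>d j \<ge> ht x\<close> are not controlled near
          \<open>x\<close>. So all lists that lie over \<open>ht x\<close> in the preimage of
          \<open>U\<close> are treated at once; there are finitely many, and \<open>e0\<close> is a
          radius that suits them all.\<close>
        let ?B = "{r. length r = n \<and> (ht x, r) \<in> \<Union>U}"
        have finB: "finite ?B"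
          using finite_lists_length_eq[of "UNIV :: bool set" n] by (auto intro: finite_subset[rotated])
        have "\<forall>r\<in>?B. \<exists>e>0. \<forall>t'\<in>{0..1}. \<bar>t' - ht x\<bar> < e \<longrightarrow> (t', r) \<in> \<Union>U"
          using U(2) unfolding openin_MN_pre by blast
        from bchoice[OF this] obtain e where "\<forall>r\<in>?B. e r > 0 \<and>
            (\<forall>t'\<in>{0..1}. \<bar>t' - ht x\<bar> < e r \<longrightarrow> (t', r) \<in> \<Union>U)" by blast
        then have e: "\<And>r. r \<in> ?B \<Longrightarrow> e r > 0"
          "\<And>r t'. r \<in> ?B \<Longrightarrow> t' \<in> {0..1} \<Longrightarrow> \<bar>t' - ht x\<bar> < e r \<Longrightarrow> (t', r) \<in> \<Union>U" by blast+
        define e0 where "e0 = Min (insert 1 (e ` ?B))"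
        have e0: "e0 > 0" "\<And>r. r \<in> ?B \<Longrightarrow> e0 \<le> e r"
          unfolding e0_def using finB e(1) by auto
        obtain W where W: "openin X W" "x \<in> W" "\<And>y. y \<in> W \<Longrightarrow> \<bar>ht y - ht x\<bar> < e0"
          "\<And>y j. y \<in> W \<Longrightarrow> 1 \<le> j \<Longrightarrow> j \<le> n \<Longrightarrow> d j < ht x \<Longrightarrow> j \<in> bs y \<longleftrightarrow> j \<in> bs x"
          using cont[OF x(1) e0(1), of n] by blast
        have "y \<in> {x \<in> topspace X. f x n \<in> U}" if y: "y \<in> W" for y
        proof -
          have yX: "y \<in> topspace X" using y W openin_subset by blast
          let ?r = "bit_list n (bs y)"
          \<comment> \<open>The bits of \<open>y\<close>, moved to the height of \<open>x\<close>,
            represent the class of \<open>x\<close>. From there only the height changes, within one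
            slice.\<close>
          have "((ht x, bit_list n (bs x)), (ht x, ?r)) \<in> ?R"
            unfolding MN_rel_iff using ht[OF x(1)] W(4)[OF y] by fastforce
          then have "?R `` {(ht x, ?r)} \<in> U" using x(2) equiv_class_eq[OF E] by metis
          then have r: "?r \<in> ?B" using memU[OF pre[OF x(1)]] by simp
          then have "(ht y, ?r) \<in> \<Union>U" using e(2)[OF r ht[OF yX]] e0(2)[OF r] W(3)[OF y] by linarith
          then show ?thesis using memU[OF pre[OF yX]] yX by (simp add: f_def MN_point_def)
        qed
        then show "\<exists>T. openin X T \<and> x \<in> T \<and> T \<subseteq> {x \<in> topspace X. f x n \<in> U}" using W by blast
      qed
    qed
    show "continuous_map X (MN_dendroid d) f"
      unfolding MN_dendroid_def
    proof (rule continuous_map_into_subtopology)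
      show "continuous_map X (product_topology (MN_Y d) UNIV) f"
        unfolding continuous_map_componentwise_UNIV using comp by blast
      have "f ` topspace X \<subseteq> topspace (MN_dendroid d)"
        unfolding topspace_MN_dendroid f_def using ht by blast
      then show "f \<in> topspace X \<rightarrow> {y. \<forall>n. y n \<in> topspace (MN_Y d n) \<and> MN_g n (y (Suc n)) = y n}"
        unfolding MN_dendroid_def by auto
    qed
  qed (rule ker)
qed

section \<open>The limit and its tower of grid trees\<close>

lemma simple_confluent_hom:
  assumes "simple_confluent A B f"
  shows "f ` verts A = verts B" "(x, y) \<in> edges A \<Longrightarrow> (f x, f y) \<in> edges B"
proof -
  have "f ` verts A = verts B \<and> (\<forall>x y. (x, y) \<in> edges A \<longrightarrow> (f x, f y) \<in> edges B) \<and>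
      is_rtree A \<and> is_rtree B"
    using assms
  proof (induction rule: simple_confluent.induct)
    case (light_confluent A B f)
    then have f: "f ` verts A = verts B" "(\<lambda>(x, y). (f x, f y)) ` edges A = edges B"
      "is_rtree A" "is_rtree B" unfolding epimorphism_def by blast+
    have "(f x, f y) \<in> edges B" if "(x, y) \<in> edges A" for x y
      using imageI[OF that, of "\<lambda>(x, y). (f x, f y)"] f(2) by simp
    then show ?case using f by blast
  next
    case (splitting A B f)
    obtain a b x where "is_rtree B" "is_rtree A" and ab: "tcov B a b" and x: "x \<notin> verts B"
      and V: "verts A = insert x (verts B)" and "root A = root B"
      and cov: "\<forall>u v. tcov A u v \<longleftrightarrow>
        tcov B u v \<and> (u, v) \<noteq> (a, b) \<or> (u, v) = (a, x) \<or> (u, v) = (x, b)"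
      and f: "\<forall>v\<in>verts B. f v = v" and fx: "f x = a \<or> f x = b"
      by (rule splitting_edge_mapD[OF splitting])
    interpret tree_order "verts B" "tree_le B" "root B" by (rule tree_order_rtree) fact
    note abV = covD[OF ab]
    have fV: "f u \<in> verts B" if "u \<in> verts A" for u using that V f fx abV by auto
    have hom: "f u = f v \<or> tcov B (f u) (f v)" if "tcov A u v" for u v
    proof -
      have "tcov B u v \<or> (u, v) = (a, x) \<or> (u, v) = (x, b)" using cov[rule_format, of u v] that by auto
      then consider "tcov B u v" | "u = a" "v = x" | "u = x" "v = b" by auto
      then show ?thesis
      proof cases
        case 1
        then show ?thesis using f covD by metis
      qed (use f fx ab abV in auto)
    qed
    have "(f u, f v) \<in> edges B" if "(u, v) \<in> edges A" for u v
      using that hom[of u v] hom[of v u] fV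
      unfolding edges_rtree[OF \<open>is_rtree A\<close>] edges_rtree[OF \<open>is_rtree B\<close>] by auto
    moreover have "f ` verts A = verts B" using V f fx abV by auto
    ultimately show ?case using \<open>is_rtree A\<close> \<open>is_rtree B\<close> by blast
  next
    case (comp A B f C g h)
    have "h ` verts A = g ` f ` verts A" using comp.hyps(3) by (auto simp: image_iff)
    moreover have "(h x, h y) \<in> edges C" if "(x, y) \<in> edges A" for x y
    proof -
      have "edges A \<subseteq> verts A \<times> verts A" using comp.IH(1) unfolding is_rtree_def by (elim conjE)
      then have "h x = g (f x)" "h y = g (f y)" using that comp.hyps(3) by auto
      moreover have "(f x, f y) \<in> edges B" using that comp.IH(1) by blast
      ultimately show ?thesis using comp.IH(2) by simp
    qed
    ultimately show ?case using comp.IH by auto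
  qed
  then show "f ` verts A = verts B" "(x, y) \<in> edges A \<Longrightarrow> (f x, f y) \<in> edges B" by blast+
qed

lemma TCE_map_id: "in_TCE A \<Longrightarrow> TCE_map A A id"
proof -
  assume A: "in_TCE A"
  then have r: "is_rtree A" by (simp add: in_TCE_def)
  have "tree_covering A A id" by (auto simp: tree_covering_def)
  then show ?thesis
    using tree_covering_imp_light_confluent[OF r r] simple_confluent.light_confluent A
    unfolding TCE_map_def by blast
qed

lemma TCE_map_comp: "TCE_map A B f \<Longrightarrow> TCE_map B C g \<Longrightarrow> TCE_map A C (g \<circ> f)"
  unfolding TCE_map_def by (auto intro: simple_confluent.comp)

lemma TCE_map_hom:
  assumes "TCE_map A B f"
  shows "f ` verts A = verts B" "(x, y) \<in> edges A \<Longrightarrow> (f x, f y) \<in> edges B"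
  using simple_confluent_hom[of A B f] assms unfolding TCE_map_def by blast+

section \<open>Finite stages of the limit and its extension property\<close>

locale TCE_limit = MN_seq d for d +
  fixes F :: "nat \<Rightarrow> rtree" and \<alpha> :: "nat \<Rightarrow> nat \<Rightarrow> nat"
  assumes limit: "is_TCE_Fraisse_limit F \<alpha>"
begin

lemma F_TCE: "in_TCE (F n)" and \<alpha>_TCE: "TCE_map (F (Suc n)) (F n) (\<alpha> n)"
  using limit unfolding is_TCE_Fraisse_limit_def by blast+

text \<open>The composed bonding map from \<open>F m\<close> to \<open>F n\<close> when
  \<open>n \<le> m\<close>; for \<open>m < n\<close> the identity is a default value.\<close>

primrec bond :: "nat \<Rightarrow> nat \<Rightarrow> nat \<Rightarrow> nat" where
  "bond n 0 = id"
| "bond n (Suc m) = (if m < n then id else bond n m \<circ> \<alpha> m)"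

lemma bond_le [simp]: "m \<le> n \<Longrightarrow> bond n m = id"
  by (cases m) auto

lemma bond_trans: "n \<le> m \<Longrightarrow> m \<le> k \<Longrightarrow> bond n m (bond m k v) = bond n k v"
proof (induction k arbitrary: v)
  case (Suc k)
  then show ?case by (cases "m = Suc k") auto
qed auto

lemma bond_TCE: "n \<le> m \<Longrightarrow> TCE_map (F m) (F n) (bond n m)"
proof (induction m)
  case 0
  then show ?case using TCE_map_id[OF F_TCE[of 0]] by (simp add: id_def)
next
  case (Suc m)
  show ?case
  proof (cases "n = Suc m")
    case True
    then show ?thesis using TCE_map_id[OF F_TCE[of "Suc m"]] by (simp add: id_def)
  next
    case False
    then have "bond n (Suc m) = bond n m \<circ> \<alpha> m" "n \<le> m" using Suc.prems by auto
    then show ?thesis using TCE_map_comp[OF \<alpha>_TCE Suc.IH] by metis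
  qed
qed

lemma bond_invlim: "x \<in> invlim_verts F \<alpha> \<Longrightarrow> n \<le> m \<Longrightarrow> bond n m (x m) = x n"
proof (induction m)
  case (Suc m)
  have "\<alpha> m (x (Suc m)) = x m" using Suc.prems by (simp add: invlim_verts_def)
  then show ?case using Suc by (cases "n = Suc m") auto
qed auto

text \<open>A thread on a cofinal subsequence extends to all coordinates. Since
  \<open>n \<le> m n\<close>, coordinate \<open>n\<close> is read off from \<open>p n\<close>, and
  any other stage beyond \<open>n\<close> gives the same value.\<close>

lemma invlim_ex:
  assumes m: "\<And>i. m i < m (Suc i)" and p: "\<And>i. p i \<in> verts (F (m i))"
    and b: "\<And>i. bond (m i) (m (Suc i)) (p (Suc i)) = p i"
  shows "\<exists>x\<in>invlim_verts F \<alpha>. \<forall>i. x (m i) = p i"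
proof -
  have smono: "strict_mono m" using m by (simp add: strict_mono_Suc_iff)
  then have mge: "n \<le> m n" for n by (rule strict_mono_imp_increasing)
  have mle: "m i \<le> m j" if "i \<le> j" for i j using smono that by (simp add: strict_mono_less_eq)
  define x where "x n = bond n (m n) (p n)" for n
  have const: "bond n (m j) (p j) = bond n (m i) (p i)" if "i \<le> j" "n \<le> m i" for i j n
    using that
  proof (induction j rule: dec_induct)
    case (step j)
    have "bond n (m (Suc j)) (p (Suc j)) = bond n (m j) (bond (m j) (m (Suc j)) (p (Suc j)))"
      using bond_trans[of n "m j" "m (Suc j)"] mle[of i j] mle[of j "Suc j"] step by simp
    then show ?case using b step by simp
  qed simp
  have xi: "x n = bond n (m i) (p i)" if "n \<le> m i" for n i
    unfolding x_def using const[of n i n] const[of i n n] that mge by (cases "n \<le> i") auto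
  have "x n \<in> verts (F n)" for n
    unfolding x_def using TCE_map_hom(1)[OF bond_TCE[OF mge]] p by blast
  moreover have "\<alpha> n (x (Suc n)) = x n" for n
  proof -
    have "x n = bond n (Suc n) (x (Suc n))"
      using bond_trans[of n "Suc n" "m (Suc n)"] mge[of "Suc n"]
      by (simp add: xi[of n "Suc n"] xi[of "Suc n" "Suc n"] del: bond.simps)
    then show ?thesis by simp
  qed
  ultimately have "x \<in> invlim_verts F \<alpha>" by (simp add: invlim_verts_def)
  moreover have "x (m i) = p i" for i using xi[of "m i" i] by simp
  ultimately show ?thesis by blast
qed

lemma invlim_surj:
  assumes "v \<in> verts (F n)"
  shows "\<exists>x\<in>invlim_verts F \<alpha>. x n = v"
proof -
  have "\<exists>w. \<forall>i. (w i \<in> verts (F (n + i)) \<and> (i = 0 \<longrightarrow> w i = v)) \<and> \<alpha> (n + i) (w (Suc i)) = w i"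
  proof (rule dependent_nat_choice)
    fix w i assume "w \<in> verts (F (n + i)) \<and> (i = 0 \<longrightarrow> w = v)"
    then obtain w' where "w' \<in> verts (F (n + Suc i))" "\<alpha> (n + i) w' = w"
      using TCE_map_hom(1)[OF \<alpha>_TCE[of "n + i"]] by (metis add_Suc_right imageE)
    then show "\<exists>w'. (w' \<in> verts (F (n + Suc i)) \<and> (Suc i = 0 \<longrightarrow> w' = v)) \<and> \<alpha> (n + i) w' = w" by blast
  qed (use assms in auto)
  then obtain w where w: "\<And>i. w i \<in> verts (F (n + i))" "w 0 = v" "\<And>i. \<alpha> (n + i) (w (Suc i)) = w i"
    by blast
  have "\<exists>x\<in>invlim_verts F \<alpha>. \<forall>i. x (n + i) = w i"
    by (rule invlim_ex) (use w in auto)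
  then show ?thesis using w(2) by (metis add_0_right)
qed

text \<open>The extension property speaks about maps on the limit. Applied to the projection onto
  \<open>F n\<close> it gives a factorization over points, which descends to a finite stage because
  every vertex of \<open>F m\<close> is a coordinate of some point.\<close>

lemma extension:
  assumes p: "TCE_map G (F n) p"
  shows "\<exists>m h. n < m \<and> TCE_map (F m) G h \<and> (\<forall>v\<in>verts (F m). p (h v) = bond n m v)"
proof -
  have adm: "admissible F \<alpha> (F n) (\<lambda>x. x n)"
    unfolding admissible_def using TCE_map_id[OF F_TCE] by (intro exI[of _ n] exI[of _ id]) auto
  have "in_TCE G" "in_TCE (F n)" using p by (auto simp: TCE_map_def)
  obtain H where H: "admissible F \<alpha> G H" "\<And>x. x \<in> invlim_verts F \<alpha> \<Longrightarrow> x n = p (H x)"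
  proof -
    have "\<forall>A B f g. in_TCE A \<and> in_TCE B \<and> admissible F \<alpha> A f \<and> TCE_map B A g \<longrightarrow>
        (\<exists>h. admissible F \<alpha> B h \<and> (\<forall>x\<in>invlim_verts F \<alpha>. f x = g (h x)))"
      using limit unfolding is_TCE_Fraisse_limit_def by (elim conjE)
    from this[rule_format, of "F n" G "\<lambda>x. x n" p] show ?thesis
      using p that \<open>in_TCE G\<close> \<open>in_TCE (F n)\<close> adm by blast
  qed
  obtain k h where h: "TCE_map (F k) G h" "\<And>x. x \<in> invlim_verts F \<alpha> \<Longrightarrow> H x = h (x k)"
    using H(1) unfolding admissible_def by blast
  let ?m = "max k (Suc n)"
  have "TCE_map (F ?m) G (h \<circ> bond k ?m)" by (rule TCE_map_comp[OF bond_TCE h(1)]) simp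
  moreover have "p ((h \<circ> bond k ?m) v) = bond n ?m v" if v: "v \<in> verts (F ?m)" for v
  proof -
    obtain x where x: "x \<in> invlim_verts F \<alpha>" "x ?m = v" using invlim_surj[OF v] by blast
    then have "bond k ?m v = x k" "bond n ?m v = x n" using bond_invlim by fastforce+
    then show ?thesis using H(2) h(2) x(1) by simp
  qed
  ultimately show ?thesis by (intro exI[of _ ?m] exI[of _ "h \<circ> bond k ?m"]) auto
qed

lemma nice_over_grid:
  assumes "grid u N J" "TCE_map A (grid_tree u N J) h"
  shows "\<exists>M L K \<sigma>. nice A M L K \<sigma> \<and>
    (\<forall>t\<ge>0. \<forall>S. h (vertex_at A M \<sigma> t S) = grid_point u N J t S)"
proof -
  obtain M L \<sigma> where G: "nice (grid_tree u N J) M L J \<sigma>"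
    "\<And>t S. 0 \<le> t \<Longrightarrow> vertex_at (grid_tree u N J) M \<sigma> t S = grid_point u N J t S"
    using nice_grid_tree[OF assms(1)] by blast
  have "simple_confluent A (grid_tree u N J) h" using assms(2) by (simp add: TCE_map_def)
  from nice_lift[OF this G(1)] show ?thesis using G(2) by metis
qed

text \<open>\<open>P\<close> is the assignment of vertices of \<open>F m\<close> to pairs
  \<open>(t, S)\<close>, compatible with \<open>h\<close>. The mesh bound and
  \<open>{1..i} \<subseteq> J\<close> ensure that the grids finally resolve all heights and all
  indices.\<close>

definition stage where
  "stage i = (\<lambda>(m, u, N, J, h, P). grid u N J \<and> {1..i} \<subseteq> J \<and>
     (\<forall>k<N. u (Suc k) - u k < 1 / Suc i) \<and> 1 - u N < 1 / Suc i \<and>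
     TCE_map (F m) (grid_tree u N J) h \<and>
     (\<exists>M L K \<sigma>. nice (F m) M L K \<sigma> \<and> P = vertex_at (F m) M \<sigma>) \<and>
     (\<forall>t\<ge>0. \<forall>S. h (P t S) = grid_point u N J t S))"

definition refines where
  "refines = (\<lambda>(m, u, N, J, h, P) (m', u', N', J', h', P'). m < m' \<and> J \<subseteq> J' \<and>
     (\<exists>p. TCE_map (grid_tree u' N' J') (F m) p \<and>
       (\<forall>t\<ge>0. \<forall>S. p (grid_point u' N' J' t S) = P t S) \<and>
       (\<forall>v\<in>verts (F m'). p (h' v) = bond m m' v)))"

text \<open>Here the limit is required to map onto a given member of the family: the start needs
  some \<open>F m\<close> over a grid tree. Afterwards the extension property takes over.\<close>

lemma stage_0: "\<exists>s. stage 0 s"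
proof -
  obtain u N where g: "grid u N {}" "\<forall>i<N. u (Suc i) - u i < 1" "1 - u N < 1"
    using grid_refinement[of "{}" "{}" 1] by auto
  obtain H where "admissible F \<alpha> (grid_tree u N {}) H"
    using limit in_TCE_grid_tree[OF g(1)] unfolding is_TCE_Fraisse_limit_def by blast
  then obtain m h where h: "TCE_map (F m) (grid_tree u N {}) h" unfolding admissible_def by blast
  obtain M L K \<sigma> where n: "nice (F m) M L K \<sigma>"
    "\<forall>t\<ge>0. \<forall>S. h (vertex_at (F m) M \<sigma> t S) = grid_point u N {} t S"
    using nice_over_grid[OF g(1) h] by blast
  have "stage 0 (m, u, N, {}, h, vertex_at (F m) M \<sigma>)"
    unfolding stage_def using g h n by auto
  then show ?thesis by blast
qed

lemma stage_Suc:
  assumes "stage i s"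
  shows "\<exists>s'. stage (Suc i) s' \<and> refines s s'"
proof -
  obtain m u N J h P where s: "s = (m, u, N, J, h, P)" by (cases s)
  obtain M L K \<sigma> where n: "nice (F m) M L K \<sigma>" "P = vertex_at (F m) M \<sigma>"
    and J: "finite J" "J \<subseteq> {1..}"
    using assms gridD(4,5)[of u N J] unfolding s stage_def by auto
  interpret T: tree_order "verts (F m)" "tree_le (F m)" "root (F m)"
    by (rule tree_order_rtree[OF nice_rtree(1)[OF n(1)]])
  \<comment> \<open>\<open>grid_projection\<close> needs the heights of \<open>F m\<close> among the
    grid points; \<open>0\<close> is one by definition of \<open>grid\<close>. The indices are those
    of the previous grid, those used by the marking of \<open>F m\<close>, and those up to
    \<open>Suc i\<close>.\<close>
  let ?U = "M ` verts (F m) - {0}" and ?J = "J \<union> K \<union> {1..Suc i}"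
  have U: "finite ?U" "?U \<subseteq> {0<..<1}" "?U \<inter> D = {}"
  proof -
    have "M b \<notin> D \<and> 0 < M b \<and> M b < 1" if "b \<in> verts (F m)" "M b \<noteq> 0" for b
      using nice_M[OF n(1), of b] nice_M_range[OF n(1), of b] nice_rtree(5)[OF n(1)] that
      by (cases "b = root (F m)") auto
    then show "finite ?U" "?U \<subseteq> {0<..<1}" "?U \<inter> D = {}" using T.finite_V by fastforce+
  qed
  have "finite ?J" "?J \<subseteq> {1..}" using J nice_rtree(2,3)[OF n(1)] by auto
  then obtain u' N' where g: "grid u' N' ?J" "?U \<subseteq> u' ` {..N'}"
    "\<forall>k<N'. u' (Suc k) - u' k < 1 / Suc (Suc i)" "1 - u' N' < 1 / Suc (Suc i)"
    using grid_refinement[OF U, of ?J "1 / Suc (Suc i)"] by auto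
  have "0 \<in> u' ` {..N'}" using gridD(2)[OF g(1)] by force
  then have "M ` verts (F m) \<subseteq> u' ` {..N'}" using g(2) unfolding Diff_subset_conv by auto
  then obtain p where p: "TCE_map (grid_tree u' N' ?J) (F m) p"
    "\<forall>t\<ge>0. \<forall>S. p (grid_point u' N' ?J t S) = P t S"
    using grid_projection[OF n(1) g(1)] n(2) by auto
  obtain m' h' where m': "m < m'" "TCE_map (F m') (grid_tree u' N' ?J) h'"
    "\<forall>v\<in>verts (F m'). p (h' v) = bond m m' v"
    using extension[OF p(1)] by blast
  obtain M' L' K' \<sigma>' where n': "nice (F m') M' L' K' \<sigma>'"
    "\<forall>t\<ge>0. \<forall>S. h' (vertex_at (F m') M' \<sigma>' t S) = grid_point u' N' ?J t S"
    using nice_over_grid[OF g(1) m'(2)] by blast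
  have "stage (Suc i) (m', u', N', ?J, h', vertex_at (F m') M' \<sigma>')"
    unfolding stage_def using g m' n' by auto
  moreover have "refines s (m', u', N', ?J, h', vertex_at (F m') M' \<sigma>')"
    unfolding refines_def s using m' p by auto
  ultimately show ?thesis by blast
qed

lemma invlim_topology_props:
  "topspace (invlim_topology F \<alpha>) = invlim_verts F \<alpha>"
  "compact_space (invlim_topology F \<alpha>)"
  "openin (invlim_topology F \<alpha>) {x \<in> invlim_verts F \<alpha>. x n = v}"
proof -
  let ?X = "product_topology (\<lambda>n. discrete_topology (verts (F n))) UNIV"
  have sub: "invlim_verts F \<alpha> \<subseteq> topspace ?X" by (auto simp: invlim_verts_def)
  then show "topspace (invlim_topology F \<alpha>) = invlim_verts F \<alpha>"
    unfolding invlim_topology_def by auto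
  have fin: "finite (verts (F n))" for n using F_TCE by (simp add: in_TCE_def is_rtree_def)
  have proj: "continuous_map ?X (discrete_topology (verts (F n))) (\<lambda>x. x n)" for n
    by (rule continuous_map_product_projection) simp
  have cl: "closedin ?X {x \<in> topspace ?X. x n \<in> C}" if "C \<subseteq> verts (F n)" for n C
    using closedin_continuous_map_preimage[OF proj[of n], of C] that by simp
  have "invlim_verts F \<alpha> = (\<Inter>n. {x \<in> topspace ?X. \<alpha> n (x (Suc n)) = x n})"
    by (auto simp: invlim_verts_def PiE_iff)
  moreover have "closedin ?X {x \<in> topspace ?X. \<alpha> n (x (Suc n)) = x n}" for n
  proof -
    have "{x \<in> topspace ?X. \<alpha> n (x (Suc n)) = x n} =
      (\<Union>v\<in>verts (F n). {x \<in> topspace ?X. x n \<in> {v}} \<inter>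
        {x \<in> topspace ?X. x (Suc n) \<in> {w \<in> verts (F (Suc n)). \<alpha> n w = v}})"
      by (auto simp: PiE_iff)
    also have "closedin ?X \<dots>"
    proof (rule closedin_Union)
      fix C assume "C \<in> (\<lambda>v. {x \<in> topspace ?X. x n \<in> {v}} \<inter>
        {x \<in> topspace ?X. x (Suc n) \<in> {w \<in> verts (F (Suc n)). \<alpha> n w = v}}) ` verts (F n)"
      then obtain v where v: "v \<in> verts (F n)" and C: "C = {x \<in> topspace ?X. x n \<in> {v}} \<inter>
        {x \<in> topspace ?X. x (Suc n) \<in> {w \<in> verts (F (Suc n)). \<alpha> n w = v}}" by (rule imageE)
      show "closedin ?X C" unfolding C by (intro closedin_Int cl) (use v in auto)
    qed (use fin in simp)
    finally show ?thesis .
  qed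
  ultimately have "closedin ?X (invlim_verts F \<alpha>)" by (metis (no_types, lifting) closedin_INT UNIV_not_empty)
  moreover have "compact_space ?X"
    using fin by (simp add: compact_space_product_topology compact_space_discrete_topology)
  ultimately show "compact_space (invlim_topology F \<alpha>)"
    unfolding invlim_topology_def by (intro compact_space_subtopology closedin_compact_space)
  have "openin ?X {x \<in> topspace ?X. x n \<in> {v} \<inter> verts (F n)}"
    by (rule openin_continuous_map_preimage[OF proj]) simp
  moreover have "{x \<in> invlim_verts F \<alpha>. x n = v} = {x \<in> topspace ?X. x n \<in> {v} \<inter> verts (F n)} \<inter> invlim_verts F \<alpha>"
    by (auto simp: invlim_verts_def)
  ultimately show "openin (invlim_topology F \<alpha>) {x \<in> invlim_verts F \<alpha>. x n = v}"
    unfolding invlim_topology_def openin_subtopology by blast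
qed

end

section \<open>Heights and bits of the points of the limit\<close>

locale TCE_tower = TCE_limit d F \<alpha> for d F \<alpha> +
  fixes m :: "nat \<Rightarrow> nat" and u :: "nat \<Rightarrow> nat \<Rightarrow> real" and N :: "nat \<Rightarrow> nat" and J :: "nat \<Rightarrow> nat set"
    and h p :: "nat \<Rightarrow> nat \<Rightarrow> nat" and P :: "nat \<Rightarrow> real \<Rightarrow> nat set \<Rightarrow> nat"
  assumes m_less: "m i < m (Suc i)"
    and grids: "grid (u i) (N i) (J i)"
    and J_ge: "{1..i} \<subseteq> J i" and J_Suc: "J i \<subseteq> J (Suc i)"
    and mesh: "k < N i \<Longrightarrow> u i (Suc k) - u i k < 1 / Suc i" "1 - u i (N i) < 1 / Suc i"
    and h_TCE: "TCE_map (F (m i)) (grid_tree (u i) (N i) (J i)) (h i)"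
    and p_TCE: "TCE_map (grid_tree (u (Suc i)) (N (Suc i)) (J (Suc i))) (F (m i)) (p i)"
    and P_vert: "0 \<le> t \<Longrightarrow> P i t S \<in> verts (F (m i))"
    and h_P: "0 \<le> t \<Longrightarrow> h i (P i t S) = grid_point (u i) (N i) (J i) t S"
    and p_point: "0 \<le> t \<Longrightarrow> p i (grid_point (u (Suc i)) (N (Suc i)) (J (Suc i)) t S) = P i t S"
    and p_h: "v \<in> verts (F (m (Suc i))) \<Longrightarrow> p i (h (Suc i) v) = bond (m i) (m (Suc i)) v"
begin

abbreviation "Tree i \<equiv> grid_tree (u i) (N i) (J i)"
abbreviation "Limit \<equiv> invlim_verts F \<alpha>"

definition lev :: "nat \<Rightarrow> (nat \<Rightarrow> nat) \<Rightarrow> nat" where "lev i x = fst (dec (h i (x (m i))))"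
definition bt :: "nat \<Rightarrow> (nat \<Rightarrow> nat) \<Rightarrow> nat set" where "bt i x = snd (dec (h i (x (m i))))"
definition lo :: "nat \<Rightarrow> (nat \<Rightarrow> nat) \<Rightarrow> real" where "lo i x = u i (lev i x)"
text \<open>With \<open>lo\<close> this bounds the cell of \<open>x\<close> at stage
  \<open>i\<close>. The top level has no next grid point, so its cell reaches up to
  \<open>1\<close>.\<close>

definition hi :: "nat \<Rightarrow> (nat \<Rightarrow> nat) \<Rightarrow> real" where
  "hi i x = (if lev i x < N i then u i (Suc (lev i x)) else 1)"
text \<open>The cells of \<open>x\<close> are nested and shorter than \<open>1 / Suc i\<close>, so
  their lower ends increase to the one height shared by all closed cells.\<close>

definition ht :: "(nat \<Rightarrow> nat) \<Rightarrow> real" where "ht x = (SUP i. lo i x)"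
definition bs :: "(nat \<Rightarrow> nat) \<Rightarrow> nat set" where "bs x = (\<Union>i. bt i x)"

lemma m_ge: "i \<le> m i"
  using m_less by (intro strict_mono_imp_increasing) (simp add: strict_mono_Suc_iff)

lemma J_mono: "i \<le> j \<Longrightarrow> J i \<subseteq> J j"
  by (rule lift_Suc_mono_le[of J, OF J_Suc])

lemma x_vert: "x \<in> Limit \<Longrightarrow> x n \<in> verts (F n)"
  by (simp add: invlim_verts_def)

lemma h_enc:
  assumes "x \<in> Limit"
  shows "h i (x (m i)) = enc (lev i x, bt i x)" "lev i x \<le> N i" "bt i x \<subseteq> low (J i) (lo i x)"
proof -
  have "h i (x (m i)) \<in> verts (Tree i)" using TCE_map_hom(1)[OF h_TCE] x_vert[OF assms] by blast
  then obtain k S where "h i (x (m i)) = enc (k, S)" "(k, S) \<in> grid_verts (u i) (N i) (J i)"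
    unfolding verts_grid_tree[OF grids] by auto
  then show "h i (x (m i)) = enc (lev i x, bt i x)" "lev i x \<le> N i" "bt i x \<subseteq> low (J i) (lo i x)"
    using dec_enc_grid[OF grids, of "(k, S)" i] by (auto simp: lev_def bt_def lo_def grid_verts_def)
qed

lemma lo_range: "x \<in> Limit \<Longrightarrow> 0 \<le> lo i x"
  using grid_mono[OF grids, of 0 "lev i x" i] gridD(2)[OF grids] h_enc(2) by (simp add: lo_def)

lemma lo_hi: "x \<in> Limit \<Longrightarrow> lo i x < hi i x" "x \<in> Limit \<Longrightarrow> hi i x - lo i x < 1 / Suc i"
  "x \<in> Limit \<Longrightarrow> hi i x \<le> 1"
proof -
  assume x: "x \<in> Limit"
  have u1: "u i k < 1" if "k \<le> N i" for k
    using gridD(6)[OF grids, of k i] gridD(2)[OF grids, of i] that by (cases "k = 0") auto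
  show "lo i x < hi i x"
    using h_enc(2)[OF x, of i] gridD(3)[OF grids, of "lev i x" i] u1[of "N i"] by (auto simp: lo_def hi_def)
  show "hi i x - lo i x < 1 / Suc i"
    using h_enc(2)[OF x, of i] mesh(1)[of "lev i x" i] mesh(2)[of i] by (auto simp: lo_def hi_def)
  show "hi i x \<le> 1"
    using u1[of "Suc (lev i x)"] by (auto simp: hi_def)
qed

lemma level_between:
  assumes "x \<in> Limit" "lo i x \<le> t" "t < hi i x"
  shows "level (u i) (N i) t = lev i x"
  by (rule level_eqI[OF grids]) (use assms h_enc(2) in \<open>auto simp: lo_def hi_def split: if_splits\<close>)

text \<open>For each \<open>t\<close> in the finer cell, \<open>p i\<close> sends the grid vertex to
  \<open>P i t S\<close> with \<open>S = bt (Suc i) x\<close>, and this is \<open>x (m i)\<close>.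
  Hence \<open>t\<close> lies in the coarser cell too; having this for every such \<open>t\<close>
  gives the inclusion of cells.\<close>

lemma h_step:
  assumes x: "x \<in> Limit" and t: "lo (Suc i) x \<le> t" "t < hi (Suc i) x"
  shows "lev i x = level (u i) (N i) t" "bt i x = bt (Suc i) x \<inter> low (J i) (lo i x)"
proof -
  let ?S = "bt (Suc i) x"
  have t0: "0 \<le> t" using t lo_range[OF x, of "Suc i"] by simp
  have "h (Suc i) (x (m (Suc i))) = grid_point (u (Suc i)) (N (Suc i)) (J (Suc i)) t ?S"
    using h_enc[OF x, of "Suc i"] level_between[OF x t] by (simp add: grid_point_def lo_def Int_absorb2)
  then have "p i (h (Suc i) (x (m (Suc i)))) = P i t ?S" using p_point[OF t0] by simp
  then have "x (m i) = P i t ?S"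
    using p_h[OF x_vert[OF x]] bond_invlim[OF x, of "m i" "m (Suc i)"] m_less[of i] by simp
  then have "dec (h i (x (m i))) = dec (grid_point (u i) (N i) (J i) t ?S)" using h_P[OF t0] by simp
  then have "(lev i x, bt i x) = (level (u i) (N i) t, ?S \<inter> low (J i) (u i (level (u i) (N i) t)))"
    unfolding lev_def bt_def grid_point_def using dec_enc_grid[OF grids, of _ i] level_props(1)[OF grids t0]
    by (subst (asm) dec_enc_grid[OF grids, of _ i]) (auto simp: grid_verts_def)
  then show "lev i x = level (u i) (N i) t" "bt i x = bt (Suc i) x \<inter> low (J i) (lo i x)"
    by (auto simp: lo_def)
qed

lemma nested:
  assumes x: "x \<in> Limit"
  shows "lo i x \<le> lo (Suc i) x" "hi (Suc i) x \<le> hi i x"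
    "bt i x = bt (Suc i) x \<inter> low (J i) (lo i x)"
proof -
  note lh = lo_hi[OF x]
  have l: "lev i x = level (u i) (N i) t" if "lo (Suc i) x \<le> t" "t < hi (Suc i) x" for t
    by (rule h_step(1)[OF x that])
  have 0: "0 \<le> lo (Suc i) x" by (rule lo_range[OF x])
  show "lo i x \<le> lo (Suc i) x"
    unfolding lo_def[of i] l[OF order_refl lh(1)] by (rule level_props(2)[OF grids 0])
  show "bt i x = bt (Suc i) x \<inter> low (J i) (lo i x)" by (rule h_step(2)[OF x order_refl lh(1)])
  show "hi (Suc i) x \<le> hi i x"
  proof (cases "lev i x < N i")
    case True
    show ?thesis
    proof (rule ccontr)
      assume n: "\<not> ?thesis"
      \<comment> \<open>A height of the finer cell at or beyond the end of the coarser one, which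
        \<open>h_step\<close> excludes.\<close>
      define t where "t = max (lo (Suc i) x) (hi i x)"
      have t: "lo (Suc i) x \<le> t" "t < hi (Suc i) x" using n lh(1)[of "Suc i"] by (auto simp: t_def)
      have "0 \<le> t" using 0 t by simp
      then have "t < hi i x" using level_props(3)[OF grids \<open>0 \<le> t\<close>, of i] l[OF t] True by (simp add: hi_def)
      then show False by (simp add: t_def)
    qed
  next
    case False
    then show ?thesis using lh(3) by (simp add: hi_def)
  qed
qed

lemma lo_mono: "x \<in> Limit \<Longrightarrow> i \<le> j \<Longrightarrow> lo i x \<le> lo j x"
  by (rule lift_Suc_mono_le[of "\<lambda>i. lo i x", OF nested(1)])

lemma hi_antimono: "x \<in> Limit \<Longrightarrow> i \<le> j \<Longrightarrow> hi j x \<le> hi i x"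
  by (rule lift_Suc_antimono_le[of "\<lambda>i. hi i x", OF nested(2)])

lemma lo_less_hi: "x \<in> Limit \<Longrightarrow> lo i x < hi j x"
  using lo_mono[of x i "max i j"] hi_antimono[of x j "max i j"] lo_hi(1)[of x "max i j"] by fastforce

lemma ht_bounds:
  assumes "x \<in> Limit"
  shows "lo i x \<le> ht x" "ht x \<le> hi i x"
proof -
  have "bdd_above (range (\<lambda>i. lo i x))"
    using lo_less_hi[OF assms, of _ 0] by (intro bdd_aboveI[of _ "hi 0 x"]) (auto intro: less_imp_le)
  then show "lo i x \<le> ht x" unfolding ht_def by (rule cSUP_upper[OF UNIV_I])
  show "ht x \<le> hi i x"
    unfolding ht_def using lo_less_hi[OF assms] by (intro cSUP_least) (auto intro: less_imp_le)
qed

lemma ht_range: "x \<in> Limit \<Longrightarrow> ht x \<in> {0..1}"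
  using ht_bounds[of x 0] lo_range[of x 0] lo_hi(3)[of x 0] by auto

lemma ht_close: "x \<in> Limit \<Longrightarrow> ht x - lo i x < 1 / Suc i"
  using ht_bounds[of x i] lo_hi(2)[of x i] by simp

lemma bt_eq_gen:
  assumes x: "x \<in> Limit" and "i \<le> j"
  shows "bt i x = bt j x \<inter> low (J i) (lo i x)"
  using assms(2)
proof (induction j rule: dec_induct)
  case base
  show ?case using h_enc(3)[OF x] by blast
next
  case (step j)
  have "low (J i) (lo i x) \<subseteq> low (J j) (lo j x)"
    using J_mono[OF step(1)] lo_mono[OF x step(1)] by (auto simp: low_def)
  then show ?case using step nested(3)[OF x, of j] by blast
qed

text \<open>Coarser stages record restrictions of finer ones, so the union over all stages adds no
  index in a range already recorded.\<close>

lemma bs_eq: "x \<in> Limit \<Longrightarrow> bs x \<inter> low (J i) (lo i x) = bt i x"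
proof (intro equalityI subsetI)
  fix j assume x: "x \<in> Limit" and "j \<in> bs x \<inter> low (J i) (lo i x)"
  then obtain k where k: "j \<in> bt k x" "j \<in> low (J i) (lo i x)" by (auto simp: bs_def)
  show "j \<in> bt i x"
  proof (cases "i \<le> k")
    case True
    then show ?thesis using bt_eq_gen[OF x True] k by blast
  next
    case False
    then show ?thesis using bt_eq_gen[OF x, of k i] k by auto
  qed
next
  fix j assume "x \<in> Limit" "j \<in> bt i x"
  then show "j \<in> bs x \<inter> low (J i) (lo i x)" using h_enc(3) by (auto simp: bs_def)
qed

lemma eventually_inverse_less: "0 < e \<Longrightarrow> eventually (\<lambda>i. 1 / Suc i < e) sequentially"
  using LIMSEQ_inverse_real_of_nat by (simp add: order_tendsto_iff inverse_eq_divide)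

text \<open>Since \<open>d j < ht x\<close> is strict, the lower ends of the cells eventually pass
  \<open>d j\<close>; and \<open>j \<le> i\<close> puts \<open>j\<close> into
  \<open>J i\<close>.\<close>

lemma eventually_bit:
  assumes x: "x \<in> Limit" and j: "1 \<le> j" "d j < ht x"
  shows "eventually (\<lambda>i. j \<in> low (J i) (lo i x)) sequentially"
proof -
  have "eventually (\<lambda>i. 1 / Suc i < ht x - d j) sequentially"
    using j by (intro eventually_inverse_less) simp
  moreover have "eventually (\<lambda>i. j \<le> i) sequentially" by (rule eventually_ge_at_top)
  ultimately show ?thesis
  proof eventually_elim
    case (elim i)
    have "j \<in> J i" using J_ge[of i] j elim by auto
    then show ?case using ht_close[OF x, of i] elim by (simp add: low_def)
  qed
qed

text \<open>The vertices \<open>P i t S\<close> of one pair form a thread, because \<open>h\<close>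
  and \<open>p\<close> respect pairs at all stages. All closed cells of the resulting point contain
  \<open>t\<close>.\<close>

lemma limit_surj:
  assumes t: "t \<in> {0..1}"
  shows "\<exists>x\<in>Limit. ht x = t \<and> (\<forall>j\<ge>1. d j < t \<longrightarrow> (j \<in> bs x \<longleftrightarrow> j \<in> S))"
proof -
  have t0: "0 \<le> t" using t by simp
  have "bond (m i) (m (Suc i)) (P (Suc i) t S) = P i t S" for i
    using p_h[OF P_vert[OF t0]] h_P[OF t0] p_point[OF t0] by metis
  then obtain x where x: "x \<in> Limit" "\<And>i. x (m i) = P i t S"
    using invlim_ex[of m "\<lambda>i. P i t S"] m_less P_vert[OF t0] by blast
  have dec: "dec (h i (x (m i))) = (level (u i) (N i) t, S \<inter> low (J i) (u i (level (u i) (N i) t)))" for i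
    unfolding x(2) h_P[OF t0] grid_point_def
    by (rule dec_enc_grid[OF grids]) (use level_props(1)[OF grids t0] in \<open>auto simp: grid_verts_def\<close>)
  have lev: "lev i x = level (u i) (N i) t" and bt: "bt i x = S \<inter> low (J i) (lo i x)" for i
    using dec[of i] by (auto simp: lev_def bt_def lo_def)
  have between: "lo i x \<le> t" "t \<le> hi i x" for i
    using level_props[OF grids t0, of i] t by (auto simp: lo_def hi_def lev)
  have "ht x = t"
  proof (rule ccontr)
    assume "ht x \<noteq> t"
    then have "0 < \<bar>ht x - t\<bar>" by simp
    from eventually_happens'[OF _ eventually_inverse_less[OF this]]
    obtain i where "1 / Suc i < \<bar>ht x - t\<bar>" by auto
    then show False using between[of i] ht_bounds[OF x(1), of i] lo_hi(2)[OF x(1), of i] by linarith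
  qed
  moreover have "j \<in> bs x \<longleftrightarrow> j \<in> S" if j: "1 \<le> j" "d j < t" for j
  proof -
    have "d j < ht x" using j \<open>ht x = t\<close> by simp
    from eventually_happens'[OF _ eventually_bit[OF x(1) j(1) this]]
    obtain i where "j \<in> low (J i) (lo i x)" by auto
    then show ?thesis using bs_eq[OF x(1), of i] bt[of i] by blast
  qed
  ultimately show ?thesis using x(1) by blast
qed

text \<open>Points agreeing at coordinate \<open>m i\<close> have the same cell and the same
  recorded bits at stage \<open>i\<close>. A late stage resolves \<open>e\<close> and the finitely
  many indices in question.\<close>

lemma limit_continuous:
  assumes x: "x \<in> Limit" and e: "0 < e"
  shows "\<exists>W. openin (invlim_topology F \<alpha>) W \<and> x \<in> W \<and>
    (\<forall>y\<in>W. \<bar>ht y - ht x\<bar> < e \<and> (\<forall>j. 1 \<le> j \<and> j \<le> n \<and> d j < ht x \<longrightarrow> (j \<in> bs y \<longleftrightarrow> j \<in> bs x)))"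
proof -
  have "eventually (\<lambda>i. \<forall>j\<in>{j. 1 \<le> j \<and> j \<le> n \<and> d j < ht x}. j \<in> low (J i) (lo i x)) sequentially"
    using eventually_bit[OF x] by (intro eventually_ball_finite) (auto intro: finite_subset[of _ "{..n}"])
  from eventually_happens'[OF _ eventually_conj[OF this eventually_inverse_less[OF e]]]
  obtain i where i: "\<And>j. 1 \<le> j \<Longrightarrow> j \<le> n \<Longrightarrow> d j < ht x \<Longrightarrow> j \<in> low (J i) (lo i x)" "1 / Suc i < e"
    by auto
  let ?W = "{y \<in> Limit. y (m i) = x (m i)}"
  have "\<forall>y\<in>?W. \<bar>ht y - ht x\<bar> < e \<and>
    (\<forall>j. 1 \<le> j \<and> j \<le> n \<and> d j < ht x \<longrightarrow> (j \<in> bs y \<longleftrightarrow> j \<in> bs x))"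
  proof
    fix y assume y: "y \<in> ?W"
    have yL: "y \<in> Limit" and "lev i y = lev i x" and b: "bt i y = bt i x"
      using y by (auto simp: lev_def bt_def)
    then have l: "lo i y = lo i x" "hi i y = hi i x" by (auto simp: lo_def hi_def)
    have "\<bar>ht y - ht x\<bar> < e"
      using ht_bounds[OF x, of i] ht_bounds[OF yL, of i] lo_hi(2)[OF x, of i] i(2) unfolding l by linarith
    moreover have "j \<in> bs y \<longleftrightarrow> j \<in> bs x" if "1 \<le> j" "j \<le> n" "d j < ht x" for j
      using i(1)[OF that] bs_eq[OF x, of i] bs_eq[OF yL, of i] l b by auto
    ultimately show "\<bar>ht y - ht x\<bar> < e \<and>
      (\<forall>j. 1 \<le> j \<and> j \<le> n \<and> d j < ht x \<longrightarrow> (j \<in> bs y \<longleftrightarrow> j \<in> bs x))" by blast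
  qed
  moreover have "x \<in> ?W" using x by simp
  ultimately show ?thesis
    by (intro exI[of _ ?W] conjI) (rule invlim_topology_props(3))
qed

lemma edge_grid:
  assumes x: "x \<in> Limit" and y: "y \<in> Limit"
  shows "(h i (x (m i)), h i (y (m i))) \<in> edges (Tree i) \<longleftrightarrow>
    (lev i x = lev i y \<and> bt i x = bt i y) \<or>
    (lev i y = Suc (lev i x) \<and> bt i x = bt i y \<inter> low (J i) (lo i x)) \<or>
    (lev i x = Suc (lev i y) \<and> bt i y = bt i x \<inter> low (J i) (lo i y))"
proof -
  have V: "(lev i z, bt i z) \<in> grid_verts (u i) (N i) (J i)" if "z \<in> Limit" for z
    using h_enc[OF that, of i] by (simp add: grid_verts_def lo_def)
  have eq: "enc (lev i z, bt i z) = enc (k, S) \<longleftrightarrow> lev i z = k \<and> bt i z = S"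
    if "z \<in> Limit" "(k, S) \<in> grid_verts (u i) (N i) (J i)" for z k S
  proof
    assume "enc (lev i z, bt i z) = enc (k, S)"
    then have "dec (enc (lev i z, bt i z)) = dec (enc (k, S))" by simp
    then show "lev i z = k \<and> bt i z = S"
      unfolding dec_enc_grid[OF grids V[OF that(1)]] dec_enc_grid[OF grids that(2)] by simp
  qed simp
  have cov: "tcov (Tree i) (enc (lev i z, bt i z)) (enc (lev i w, bt i w)) \<longleftrightarrow>
      lev i w = Suc (lev i z) \<and> bt i z = bt i w \<inter> low (J i) (lo i z)"
    if "z \<in> Limit" "w \<in> Limit" for z w
    unfolding tcov_grid_tree[OF grids]
  proof
    assume "\<exists>k S. k < N i \<and> S \<subseteq> low (J i) (u i (Suc k)) \<and>
      enc (lev i z, bt i z) = enc (k, S \<inter> low (J i) (u i k)) \<and> enc (lev i w, bt i w) = enc (Suc k, S)"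
    then obtain k S where k: "k < N i" "S \<subseteq> low (J i) (u i (Suc k))"
      "enc (lev i z, bt i z) = enc (k, S \<inter> low (J i) (u i k))" "enc (lev i w, bt i w) = enc (Suc k, S)"
      by blast
    have "lev i z = k \<and> bt i z = S \<inter> low (J i) (u i k)" "lev i w = Suc k \<and> bt i w = S"
      using k eq[OF that(1), of k "S \<inter> low (J i) (u i k)"] eq[OF that(2), of "Suc k" S]
      by (auto simp: grid_verts_def)
    then show "lev i w = Suc (lev i z) \<and> bt i z = bt i w \<inter> low (J i) (lo i z)" by (auto simp: lo_def)
  next
    assume *: "lev i w = Suc (lev i z) \<and> bt i z = bt i w \<inter> low (J i) (lo i z)"
    then show "\<exists>k S. k < N i \<and> S \<subseteq> low (J i) (u i (Suc k)) \<and>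
      enc (lev i z, bt i z) = enc (k, S \<inter> low (J i) (u i k)) \<and> enc (lev i w, bt i w) = enc (Suc k, S)"
      using h_enc(2,3)[OF that(2), of i] by (intro exI[of _ "lev i z"] exI[of _ "bt i w"]) (auto simp: lo_def)
  qed
  have "enc (lev i z, bt i z) \<in> verts (Tree i)" if "z \<in> Limit" for z
    unfolding verts_grid_tree[OF grids] using V[OF that] by blast
  then show ?thesis
    unfolding edges_rtree[OF is_rtree_grid[OF grids]] h_enc(1)[OF x] h_enc(1)[OF y]
    using cov[OF x y] cov[OF y x] eq[OF x V[OF y]] x y by blast
qed

text \<open>Adjacent vertices have equal or consecutive cells, each shorter than
  \<open>1 / Suc i\<close>.\<close>

lemma edge_imp_ht:
  assumes x: "x \<in> Limit" and y: "y \<in> Limit"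
    and e: "(h i (x (m i)), h i (y (m i))) \<in> edges (Tree i)"
  shows "ht x - ht y < 2 / Suc i"
proof -
  have "lev i x \<le> Suc (lev i y)" using e unfolding edge_grid[OF x y] by auto
  then have "lo i x \<le> hi i y"
    using h_enc(2)[OF x, of i] h_enc(2)[OF y, of i] grid_mono[OF grids, of "lev i x" "Suc (lev i y)" i]
      lo_hi(1)[OF x, of i] lo_hi(3)[OF x, of i] by (auto simp: lo_def hi_def)
  then show ?thesis
    using ht_bounds[OF x, of i] ht_bounds[OF y, of i] lo_hi(2)[OF x, of i] lo_hi(2)[OF y, of i]
    by (simp add: add_divide_distrib)
qed

text \<open>Adjacency at all stages squeezes the heights together and makes the recorded bits agree.
  Conversely, points with equal height and bits lie at each stage in equal or touching cells, so
  their grid vertices are adjacent, and these edges are carried down to every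
  \<open>F n\<close>.\<close>

lemma invlim_edges_iff:
  "(x, y) \<in> invlim_edges F \<alpha> \<longleftrightarrow> x \<in> Limit \<and> y \<in> Limit \<and> ht x = ht y \<and>
    (\<forall>j\<ge>1. d j < ht x \<longrightarrow> (j \<in> bs x \<longleftrightarrow> j \<in> bs y))"
proof (intro iffI)
  assume xy: "(x, y) \<in> invlim_edges F \<alpha>"
  then have x: "x \<in> Limit" and y: "y \<in> Limit" and E: "\<And>n. (x n, y n) \<in> edges (F n)"
    by (auto simp: invlim_edges_def)
  have e: "(h i (x (m i)), h i (y (m i))) \<in> edges (Tree i)"
    and e': "(h i (y (m i)), h i (x (m i))) \<in> edges (Tree i)" for i
  proof -
    show "(h i (x (m i)), h i (y (m i))) \<in> edges (Tree i)" by (rule TCE_map_hom(2)[OF h_TCE E])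
    then show "(h i (y (m i)), h i (x (m i))) \<in> edges (Tree i)"
      using is_rtree_grid[OF grids, of i] unfolding is_rtree_def by blast
  qed
  have "ht x = ht y"
  proof (rule ccontr)
    assume "ht x \<noteq> ht y"
    then have "0 < \<bar>ht x - ht y\<bar> / 2" by simp
    from eventually_happens'[OF _ eventually_inverse_less[OF this]]
    obtain i where "2 / Suc i < \<bar>ht x - ht y\<bar>" by (auto simp: field_simps)
    then show False using edge_imp_ht[OF x y e, of i] edge_imp_ht[OF y x e', of i] by linarith
  qed
  moreover have "j \<in> bs x \<longleftrightarrow> j \<in> bs y" if j: "1 \<le> j" "d j < ht x" for j
  proof -
    have "d j < ht y" using j \<open>ht x = ht y\<close> by simp
    from eventually_happens'[OF _ eventually_conj[OF eventually_bit[OF x j] eventually_bit[OF y j(1) this]]]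
    obtain i where i: "j \<in> low (J i) (lo i x)" "j \<in> low (J i) (lo i y)" by auto
    then have "j \<in> bt i x \<longleftrightarrow> j \<in> bt i y" using e[of i] unfolding edge_grid[OF x y] by blast
    then show ?thesis using i bs_eq[OF x, of i] bs_eq[OF y, of i] by blast
  qed
  ultimately show "x \<in> Limit \<and> y \<in> Limit \<and> ht x = ht y \<and>
    (\<forall>j\<ge>1. d j < ht x \<longrightarrow> (j \<in> bs x \<longleftrightarrow> j \<in> bs y))" using x y by blast
next
  assume xy: "x \<in> Limit \<and> y \<in> Limit \<and> ht x = ht y \<and> (\<forall>j\<ge>1. d j < ht x \<longrightarrow> (j \<in> bs x \<longleftrightarrow> j \<in> bs y))"
  then have x: "x \<in> Limit" and y: "y \<in> Limit" by auto
  \<comment> \<open>The lower of the two cells decides which bits are compared. Their values are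
    below the common height, so they agree.\<close>
  have cmp: "(lev i w = lev i z \<and> bt i w = bt i z) \<or>
      (lev i z = Suc (lev i w) \<and> bt i w = bt i z \<inter> low (J i) (lo i w))"
    if zw: "z \<in> Limit" "w \<in> Limit" "ht z = ht w" "\<And>j. 1 \<le> j \<Longrightarrow> d j < ht z \<Longrightarrow> j \<in> bs z \<longleftrightarrow> j \<in> bs w"
      and le: "lev i w \<le> lev i z" for i z w
  proof -
    have "lo i w \<le> lo i z"
      unfolding lo_def using grid_mono[OF grids le] h_enc(2)[OF zw(1)] by simp
    then have "low (J i) (lo i w) \<subseteq> low (J i) (lo i z)" by (auto simp: low_def)
    moreover have "bs w \<inter> low (J i) (lo i w) = bs z \<inter> low (J i) (lo i w)"
      using zw(4) ht_bounds(1)[OF zw(2), of i] zw(3) gridD(5)[OF grids, of i] by (force simp: low_def)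
    ultimately have b: "bt i w = bt i z \<inter> low (J i) (lo i w)"
      using bs_eq[OF zw(1), of i] bs_eq[OF zw(2), of i] by blast
    show ?thesis
    proof (cases "lev i w = lev i z")
      case True
      then have "lo i w = lo i z" by (simp add: lo_def)
      then show ?thesis using True b h_enc(3)[OF zw(1), of i] by auto
    next
      case False
      then have less: "Suc (lev i w) \<le> lev i z" using le by simp
      have z: "lev i z \<le> N i" by (rule h_enc(2)[OF zw(1)])
      \<comment> \<open>The common height is at least \<open>lo i z\<close> and at most
        \<open>hi i w\<close>. It may be an endpoint of both cells, which is why consecutive levels
        occur and not only equal ones.\<close>
      have "u i (lev i z) \<le> u i (Suc (lev i w))"
        using ht_bounds(1)[OF zw(1), of i] ht_bounds(2)[OF zw(2), of i] zw(3) less z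
        by (auto simp: lo_def hi_def)
      then have "lev i z = Suc (lev i w)" using grid_le_iff[OF grids, of "lev i z" i "Suc (lev i w)"] less z by simp
      then show ?thesis using b by blast
    qed
  qed
  have e: "(h i (x (m i)), h i (y (m i))) \<in> edges (Tree i)" for i
    unfolding edge_grid[OF x y] using cmp[of x y i] cmp[of y x i] xy by (metis nle_le)
  \<comment> \<open>Edges are not pulled back along \<open>h i\<close>. The edge is taken from the
    next grid tree and pushed down by \<open>p i\<close>, since \<open>p i\<close> after
    \<open>h (Suc i)\<close> is the bonding map.\<close>
  have em: "(x (m i), y (m i)) \<in> edges (F (m i))" for i
  proof -
    have "(p i (h (Suc i) (x (m (Suc i)))), p i (h (Suc i) (y (m (Suc i))))) \<in> edges (F (m i))"
      by (rule TCE_map_hom(2)[OF p_TCE e])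
    then show ?thesis
      unfolding p_h[OF x_vert[OF x]] p_h[OF x_vert[OF y]]
      using bond_invlim[OF x, of "m i" "m (Suc i)"] bond_invlim[OF y, of "m i" "m (Suc i)"] m_less[of i] by simp
  qed
  have "(x n, y n) \<in> edges (F n)" for n
    using TCE_map_hom(2)[OF bond_TCE[OF m_ge] em[of n]] bond_invlim[OF x m_ge[of n]] bond_invlim[OF y m_ge[of n]]
    by simp
  then show "(x, y) \<in> invlim_edges F \<alpha>" using x y by (simp add: invlim_edges_def)
qed

lemma realization_homeomorphic: "TCE_realization F \<alpha> homeomorphic_space MN_dendroid d"
  unfolding TCE_realization_def
  by (rule quotient_homeomorphic_MN_dendroid[where X = "invlim_topology F \<alpha>" and ht = ht and bs = bs, unfolded invlim_topology_props(1),
        OF invlim_topology_props(2) ht_range limit_surj limit_continuous invlim_edges_iff])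

end

lemma (in TCE_limit) TCE_realization_homeomorphic: "TCE_realization F \<alpha> homeomorphic_space MN_dendroid d"
proof -
  have "\<exists>s. \<forall>i. stage i (s i) \<and> refines (s i) (s (Suc i))"
    by (rule dependent_nat_choice[where Q = "\<lambda>_. refines"]) (use stage_0 stage_Suc in auto)
  then obtain s where s: "\<And>i. stage i (s i)" "\<And>i. refines (s i) (s (Suc i))" by blast
  define m where "m i = fst (s i)" for i
  define u where "u i = fst (snd (s i))" for i
  define N where "N i = fst (snd (snd (s i)))" for i
  define J where "J i = fst (snd (snd (snd (s i))))" for i
  define h where "h i = fst (snd (snd (snd (snd (s i)))))" for i
  define P where "P i = snd (snd (snd (snd (snd (s i)))))" for i
  have s_eq: "s i = (m i, u i, N i, J i, h i, P i)" for i
    by (simp add: m_def u_def N_def J_def h_def P_def)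
  note st = s(1)[unfolded s_eq stage_def prod.case] and re = s(2)[unfolded s_eq refines_def prod.case]
  have "\<exists>p. \<forall>i. TCE_map (grid_tree (u (Suc i)) (N (Suc i)) (J (Suc i))) (F (m i)) (p i) \<and>
     (\<forall>t\<ge>0. \<forall>S. p i (grid_point (u (Suc i)) (N (Suc i)) (J (Suc i)) t S) = P i t S) \<and>
     (\<forall>v\<in>verts (F (m (Suc i))). p i (h (Suc i) v) = bond (m i) (m (Suc i)) v)"
    by (rule choice) (use re in blast)
  then obtain p where p: "\<And>i. TCE_map (grid_tree (u (Suc i)) (N (Suc i)) (J (Suc i))) (F (m i)) (p i)"
    "\<And>i t S. 0 \<le> t \<Longrightarrow> p i (grid_point (u (Suc i)) (N (Suc i)) (J (Suc i)) t S) = P i t S"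
    "\<And>i v. v \<in> verts (F (m (Suc i))) \<Longrightarrow> p i (h (Suc i) v) = bond (m i) (m (Suc i)) v" by blast
  have "TCE_tower d F \<alpha> m u N J h p P"
  proof
    fix i t S assume "0 \<le> (t :: real)"
    moreover obtain M L K \<sigma> where "nice (F (m i)) M L K \<sigma>" "P i = vertex_at (F (m i)) M \<sigma>"
      using st[of i] by blast
    ultimately show "P i t S \<in> verts (F (m i))" using vertex_at_in_verts by metis
  qed (use st re p in \<open>blast+\<close>)
  then show ?thesis by (rule TCE_tower.realization_homeomorphic)
qed

theorem theorem10p1:
  fixes F :: "nat \<Rightarrow> rtree" and \<alpha> :: "nat \<Rightarrow> nat \<Rightarrow> nat" and d :: "nat \<Rightarrow> real"
  assumes "is_TCE_Fraisse_limit F \<alpha>"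
    and "MN_sequence d"
  shows "TCE_realization F \<alpha> homeomorphic_space MN_dendroid d"
proof -
  interpret TCE_limit d F \<alpha> by unfold_locales (fact assms)+
  show ?thesis by (rule TCE_realization_homeomorphic)
qed

end
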